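(* Let $\tau_1,\tau_2:\mathbb{T}^2\to\mathbb{T}^2$ be the free involutions $\tau_1(x,y)=\left(x+\frac12,y\right)$ and $\tau_2(x,y)=\left(-x,y+\frac12\right)$. Let $f:\mathbb{T}^2\to\mathbb{T}^2$ be a continuous map and let $f_{\#}$ be the homomorphism (a $2\times2$ integer matrix) induced by $f$ on the fundamental group $\pi_1(\mathbb{T}^2)=\mathbb{Z}^2$. Then $$\mathrm{NBU}(f,\tau_1)=0$$ and $$\mathrm{NBU}(f,\tau_2)=\begin{cases}2 & \text{if } f_{\#}=\begin{pmatrix} p & 2k \\ q & 2l \end{pmatrix} \text{ for some } p,q,k,l\in\mathbb{Z} \text{ with } (p,q)\neq(0,0),\\ 0 & \text{otherwise}.\end{cases}$$ Moreover, for each continuous map $f:\mathbb{T}^2\to\mathbb{T}^2$ and each $i\in\{1,2\}$ there exists a map $f'$ homotopic to $f$ which realizes $\mathrm{NBU}(f,\tau_i)$, i.e. the torus $\mathbb{T}^2$ is a Wecken type space in Nielsen-Borsuk-Ulam theory.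
   Context: $\mathbb{T}^n=\mathbb{R}^n/\mathbb{Z}^n$ is the $n$-torus, written additively, and $\pi_1(\mathbb{T}^n)=\mathbb{Z}^n$. Maps are continuous. Homotopy classes of selfmaps of $\mathbb{T}^n$ correspond bijectively to $n\times n$ integer matrices, a matrix $M$ acting on column vectors; e.g. $f_{\#}=\begin{pmatrix} p & 2k \\ q & 2l \end{pmatrix}$ means that $f$ is homotopic to $(x,y)\mapsto(px+2ky,\,qx+2ly)$. Two free involutions $\tau,\tau'$ of a manifold $M$ are equivalent if $h\circ\tau'=\tau\circ h$ for some homeomorphism $h$ of $M$; it is known that every free involution of $\mathbb{T}^2$ is equivalent to exactly one of $\tau_1,\tau_2$. The involution $\tau_1$ preserves orientation and $\tau_2$ reverses it. **Borsuk-Ulam coincidence classes.** Let $X,Y$ be closed orientable triangulable $n$-manifolds, $\tau$ a free involution on $X$, and $f:X\to Y$ a map with $\mathrm{Coin}(f,f\circ\tau)=\{x\in X: f(x)=f(\tau(x))\}$ finite, say equal to $\{x_1,\tau(x_1),\dots,x_m,\tau(x_m)\}$. Put $\mathrm{BUCoin}(f,\tau)=\{(x_1,\tau(x_1)),\dots,(x_m,\tau(x_m))\}$ (one pair for each $\tau$-orbit). Two pairs $(x_i,\tau(x_i))$, $(x_j,\tau(x_j))$ are in the same Borsuk-Ulam coincidence class if there is a path $\gamma$ from a point of $\{x_i,\tau(x_i)\}$ to a point of $\{x_j,\tau(x_j)\}$ such that $f\circ\gamma$ is homotopic to $f\circ\tau\circ\gamma$ with fixed endpoints. A class $C$ is single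 if for one (equivalently any) pair $(x,\tau(x))\in C$ there is a path $\gamma$ from $x$ to $\tau(x)$ with $f\circ\gamma$ homotopic to $f\circ\tau\circ\gamma$ rel endpoints; otherwise it is double. A single class consists of exactly one usual (Nielsen) coincidence class of $(f,f\circ\tau)$; a double class $C=\{(x_1,\tau(x_1)),\dots,(x_k,\tau(x_k))\}$ can be relabelled so that $C=C_1\cup C_2$ with $C_1=\{x_1,\dots,x_k\}$ and $C_2=\{\tau(x_1),\dots,\tau(x_k)\}$ two distinct usual coincidence classes of $(f,f\circ\tau)$. **Pseudo-index.** Let $\mathrm{ind}(f,f\circ\tau;c)$ be the usual local coincidence index at an isolated coincidence $c$ (for $X=Y=\mathbb{T}^n$ it is, up to a global sign convention, the local degree at $c$ of $x\mapsto f(x)-f(\tau(x))$ as a map near $c$ into a neighbourhood of $0\in\mathbb{T}^n$), and let the index of a finite set of coincidences be the sum of the local indices. Call the situation of type A if ($\tau$ reverses orientation and $n$ is even) or ($\tau$ preserves orientation and $n$ is odd), and of type B if ($\tau$ preserves orientation and $n$ is even) or ($\tau$ reverses orientation and $n$ is odd). The pseudo-index $|\mathrm{ind}|(f,\tau;C)$ of a class $C=\{(x_1,\tau(x_1)),\dots,(x_k,\tau(x_k))\}$ is: $\sum_{i=1}^k \mathrm{ind}(f,f\circ\tau;x_i) \bmod 2$ if $C$ is single and type A; $\frac12\mathrm{ind}(f,f\circ\tau;C)$ if $C$ is single and type B; $|\mathrm{ind}(f,f\circ\tau;C_1)|$ if $C=C_1\cup C_2$ is double and type A; $\mathrm{ind}(f,f\circ\tau;C_1)$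 if $C=C_1\cup C_2$ is double and type B. **Nielsen-Borsuk-Ulam number.** A class $C$ is essential if $|\mathrm{ind}|(f,\tau;C)\neq0$. $\mathrm{NBU}(f,\tau)$ is the number of essential Borsuk-Ulam coincidence classes. It is a homotopy invariant of $f$; for an arbitrary map $f$ it is computed on any map homotopic to $f$ with finite coincidence set. Every map homotopic to $f$ has at least $\mathrm{NBU}(f,\tau)$ pairs of Borsuk-Ulam coincidence points. A map $f'$ homotopic to $f$ realizes $\mathrm{NBU}(f,\tau)$ if $\mathrm{BUCoin}(f',\tau)$ has exactly $\mathrm{NBU}(f,\tau)$ pairs; being a Wecken type space means that such an $f'$ exists for each selfmap $f$ and each of the involutions considered. *)

theory Defs
  imports "HOL-Complex_Analysis.Complex_Analysis"
begin

section \<open>The torus $R^2/Z^2$\<close>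

definition torus_rel :: "real \<times> real \<Rightarrow> real \<times> real \<Rightarrow> bool" where
  "torus_rel u v \<longleftrightarrow> fst u - fst v \<in> \<int> \<and> snd u - snd v \<in> \<int>"

quotient_type torus = "real \<times> real" / torus_rel
  morphisms rep_torus torus_of
proof (rule equivpI)
  show "reflp torus_rel"
    by (simp add: reflp_def torus_rel_def)
  show "symp torus_rel"
    unfolding symp_def torus_rel_def by (metis Ints_minus minus_diff_eq)
  show "transp torus_rel"
    unfolding transp_def torus_rel_def by (metis Ints_add diff_add_cancel add_diff_eq)
qed

instantiation torus :: ab_group_add
begin

lift_definition zero_torus :: torus is "(0, 0)" .

lift_definition plus_torus :: "torus \<Rightarrow> torus \<Rightarrow> torus" is "(+)"
  unfolding torus_rel_def by (metis Ints_add add_diff_add fst_add snd_add)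

lift_definition uminus_torus :: "torus \<Rightarrow> torus" is "uminus"
  unfolding torus_rel_def by (metis Ints_minus fst_uminus snd_uminus minus_diff_minus)

lift_definition minus_torus :: "torus \<Rightarrow> torus \<Rightarrow> torus" is "(-)"
proof -
  fix a b c d :: "real \<times> real"
  have eq: "(x - y) - (x' - y') = (x - x') - (y - y')" for x y x' y' :: real
    by simp
  assume "torus_rel a b" "torus_rel c d"
  then show "torus_rel (a - c) (b - d)"
    unfolding torus_rel_def fst_diff snd_diff eq by (blast intro: Ints_diff)
qed

instance
  by standard (transfer; simp add: torus_rel_def)+

end

text \<open>The quotient topology:\<close>

instantiation torus :: topological_space
begin

definition open_torus :: "torus set \<Rightarrow> bool" where
  "open_torus U \<longleftrightarrow> open (torus_of -` U)"

instance
proof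
  show "open (UNIV :: torus set)"
    by (simp add: open_torus_def)
  show "open (S \<inter> T)" if "open S" "open T" for S T :: "torus set"
    using that by (simp add: open_torus_def open_Int vimage_Int)
  show "open (\<Union>K)" if "\<forall>S\<in>K. open S" for K :: "torus set set"
    using that by (simp add: open_torus_def open_UN vimage_Union)
qed

end

lift_definition tau1 :: "torus \<Rightarrow> torus" (\<open>\<tau>\<^sub>1\<close>) is "\<lambda>(x, y). (x + 1/2, y)"
  by (auto simp: torus_rel_def)

lift_definition tau2 :: "torus \<Rightarrow> torus" (\<open>\<tau>\<^sub>2\<close>) is "\<lambda>(x, y). (- x, y + 1/2)"
  by (auto simp: torus_rel_def) (metis Ints_minus minus_diff_eq)

lemma tau1_free_involution: "\<tau>\<^sub>1 (\<tau>\<^sub>1 p) = p" "\<tau>\<^sub>1 p \<noteq> p"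
proof -
  show "\<tau>\<^sub>1 (\<tau>\<^sub>1 p) = p"
    by transfer (auto simp: torus_rel_def)
  have "(1/2 :: real) \<notin> \<int>"
    using fraction_not_in_Ints[of 2 1, where 'a = real] by simp
  then show "\<tau>\<^sub>1 p \<noteq> p"
    by transfer (auto simp: torus_rel_def)
qed

lemma tau2_free_involution: "\<tau>\<^sub>2 (\<tau>\<^sub>2 p) = p" "\<tau>\<^sub>2 p \<noteq> p"
proof -
  show "\<tau>\<^sub>2 (\<tau>\<^sub>2 p) = p"
    by transfer (auto simp: torus_rel_def)
  have "(1/2 :: real) \<notin> \<int>"
    using fraction_not_in_Ints[of 2 1, where 'a = real] by simp
  then show "\<tau>\<^sub>2 p \<noteq> p"
    by transfer (auto simp: torus_rel_def)
qed


section \<open>Induced homomorphism on the fundamental group\<close>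

text \<open>
  The identification of the fundamental group of the torus based at \<open>c\<close> with the integer
  vectors: \<open>v\<close> corresponds to the class of the loop \<open>torus_loop c v\<close>.
\<close>

definition torus_loop :: "torus \<Rightarrow> int ^ 2 \<Rightarrow> real \<Rightarrow> torus" where
  "torus_loop c v = (\<lambda>t. c + torus_of (t * of_int (v $ 1), t * of_int (v $ 2)))"

definition pi1_matrix :: "(torus \<Rightarrow> torus) \<Rightarrow> int ^ 2 ^ 2" where
  "pi1_matrix f = (THE M. \<forall>v. homotopic_paths UNIV (f \<circ> torus_loop 0 v) (torus_loop (f 0) (M *v v)))"


section \<open>Local degree and coincidence index\<close>

text \<open>
  Local degree of a planar map at a point \<open>z\<close> isolated in the fibre over \<open>F z\<close>: the degree, i.e.
  winding number about \<open>F z\<close>, of the restriction of \<open>F\<close> to small circles around \<open>z\<close>.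
\<close>

definition local_degree :: "(complex \<Rightarrow> complex) \<Rightarrow> complex \<Rightarrow> int" where
  "local_degree F z =
     (THE k. \<forall>\<^sub>F r in at_right 0. winding_number (F \<circ> circlepath z r) (F z) = of_int k)"

definition torus_exp :: "complex \<Rightarrow> torus" where
  "torus_exp z = torus_of (Re z, Im z)"

text \<open>Inverse of \<open>torus_exp\<close>, continuous on a neighbourhood of \<open>0\<close>.\<close>

definition torus_log :: "torus \<Rightarrow> complex" where
  "torus_log p = (THE z. Re z \<in> {-1/2..<1/2} \<and> Im z \<in> {-1/2..<1/2} \<and> torus_exp z = p)"

text \<open>
  Local degree at \<open>c\<close> of a selfmap of the torus, in the orientation-compatible charts
  \<open>z \<mapsto> c + torus_exp z\<close> and \<open>w \<mapsto> \<phi> c + torus_exp w\<close>.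
\<close>

definition torus_local_degree :: "(torus \<Rightarrow> torus) \<Rightarrow> torus \<Rightarrow> int" where
  "torus_local_degree \<phi> c = local_degree (\<lambda>z. torus_log (\<phi> (c + torus_exp z) - \<phi> c)) 0"

definition reverses_orientation :: "(torus \<Rightarrow> torus) \<Rightarrow> bool" where
  "reverses_orientation h \<longleftrightarrow> (\<forall>c. torus_local_degree h c = -1)"

definition Coin :: "(torus \<Rightarrow> torus) \<Rightarrow> (torus \<Rightarrow> torus) \<Rightarrow> torus set" where
  "Coin f g = {x. f x = g x}"

definition coin_index :: "(torus \<Rightarrow> torus) \<Rightarrow> (torus \<Rightarrow> torus) \<Rightarrow> torus \<Rightarrow> int" where
  "coin_index f g c = torus_local_degree (\<lambda>x. f x - g x) c"

definition coin_index_set :: "(torus \<Rightarrow> torus) \<Rightarrow> (torus \<Rightarrow> torus) \<Rightarrow> torus set \<Rightarrow> int" where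
  "coin_index_set f g S = (\<Sum>c\<in>S. coin_index f g c)"

definition Nielsen_related :: "(torus \<Rightarrow> torus) \<Rightarrow> (torus \<Rightarrow> torus) \<Rightarrow> torus \<Rightarrow> torus \<Rightarrow> bool" where
  "Nielsen_related f g x y \<longleftrightarrow>
     (\<exists>\<gamma>. path \<gamma> \<and> pathstart \<gamma> = x \<and> pathfinish \<gamma> = y \<and> homotopic_paths UNIV (f \<circ> \<gamma>) (g \<circ> \<gamma>))"

definition Nielsen_classes :: "(torus \<Rightarrow> torus) \<Rightarrow> (torus \<Rightarrow> torus) \<Rightarrow> torus set set" where
  "Nielsen_classes f g =
     Coin f g // {(x, y). x \<in> Coin f g \<and> y \<in> Coin f g \<and> Nielsen_related f g x y}"


section \<open>Borsuk-Ulam coincidence classes\<close>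

text \<open>
  A pair \<open>(x, \<tau> x)\<close>, of which there is one for each \<open>\<tau>\<close>-orbit, is encoded as the orbit
  \<open>{x, \<tau> x}\<close>; a Borsuk-Ulam coincidence class is a set of such orbits, and its underlying set of
  points is its union.
\<close>

definition BUCoin :: "(torus \<Rightarrow> torus) \<Rightarrow> (torus \<Rightarrow> torus) \<Rightarrow> torus set set" where
  "BUCoin f \<tau> = (\<lambda>x. {x, \<tau> x}) ` Coin f (f \<circ> \<tau>)"

definition BU_rel :: "(torus \<Rightarrow> torus) \<Rightarrow> (torus \<Rightarrow> torus) \<Rightarrow> (torus set \<times> torus set) set" where
  "BU_rel f \<tau> = {(P, Q). P \<in> BUCoin f \<tau> \<and> Q \<in> BUCoin f \<tau> \<and>
                          (\<exists>x\<in>P. \<exists>y\<in>Q. Nielsen_related f (f \<circ> \<tau>) x y)}"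

definition BU_classes :: "(torus \<Rightarrow> torus) \<Rightarrow> (torus \<Rightarrow> torus) \<Rightarrow> torus set set set" where
  "BU_classes f \<tau> = BUCoin f \<tau> // BU_rel f \<tau>"

definition BU_single :: "(torus \<Rightarrow> torus) \<Rightarrow> (torus \<Rightarrow> torus) \<Rightarrow> torus set set \<Rightarrow> bool" where
  "BU_single f \<tau> C \<longleftrightarrow> (\<exists>P\<in>C. \<exists>x\<in>P. Nielsen_related f (f \<circ> \<tau>) x (\<tau> x))"

text \<open>
  In dimension 2, type A means that \<open>\<tau>\<close> reverses orientation, type B that it preserves it.  The
  values do not depend on the chosen representatives of the orbits, nor on which of the two usual
  coincidence classes \<open>C1\<close>, \<open>C2\<close> that make up a double class is chosen: the local indices at \<open>x\<close>
  and \<open>\<tau> x\<close> are opposite in type A and equal in type B.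
\<close>

definition pseudo_index :: "(torus \<Rightarrow> torus) \<Rightarrow> (torus \<Rightarrow> torus) \<Rightarrow> torus set set \<Rightarrow> rat" where
  "pseudo_index f \<tau> C =
     (if BU_single f \<tau> C then
        (if reverses_orientation \<tau>
         then of_int ((\<Sum>P\<in>C. coin_index f (f \<circ> \<tau>) (SOME x. x \<in> P)) mod 2)
         else of_int (coin_index_set f (f \<circ> \<tau>) (\<Union>C)) / 2)
      else
        (let C1 = (SOME D. D \<in> Nielsen_classes f (f \<circ> \<tau>) \<and> D \<subseteq> \<Union>C) in
         if reverses_orientation \<tau>
         then of_int \<bar>coin_index_set f (f \<circ> \<tau>) C1\<bar>
         else of_int (coin_index_set f (f \<circ> \<tau>) C1)))"

definition essential_BU_class :: "(torus \<Rightarrow> torus) \<Rightarrow> (torus \<Rightarrow> torus) \<Rightarrow> torus set set \<Rightarrow> bool" where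
  "essential_BU_class f \<tau> C \<longleftrightarrow> pseudo_index f \<tau> C \<noteq> 0"

abbreviation homotopic_maps :: "(torus \<Rightarrow> torus) \<Rightarrow> (torus \<Rightarrow> torus) \<Rightarrow> bool" where
  "homotopic_maps \<equiv> homotopic_with_canon (\<lambda>_. True) UNIV UNIV"

text \<open>The number of essential classes, meaningful when \<open>Coin f (f \<circ> \<tau>)\<close> is finite:\<close>

definition NBU_finite :: "(torus \<Rightarrow> torus) \<Rightarrow> (torus \<Rightarrow> torus) \<Rightarrow> nat" where
  "NBU_finite f \<tau> = card {C \<in> BU_classes f \<tau>. essential_BU_class f \<tau> C}"

text \<open>
  For an arbitrary map the number is computed on any homotopic map with finite coincidence set;
  the description operator denotes only because the result is the same for all such maps.
\<close>

definition NBU :: "(torus \<Rightarrow> torus) \<Rightarrow> (torus \<Rightarrow> torus) \<Rightarrow> nat" where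
  "NBU f \<tau> = (THE m. \<exists>g. homotopic_maps f g \<and> finite (Coin g (g \<circ> \<tau>)) \<and> m = NBU_finite g \<tau>)"

definition realizes_NBU :: "(torus \<Rightarrow> torus) \<Rightarrow> (torus \<Rightarrow> torus) \<Rightarrow> (torus \<Rightarrow> torus) \<Rightarrow> bool" where
  "realizes_NBU f' f \<tau> \<longleftrightarrow>
     homotopic_maps f f' \<and> finite (BUCoin f' \<tau>) \<and> card (BUCoin f' \<tau>) = NBU f \<tau>"

end

theory Submission
  imports Defs
begin

text \<open>
  Identify the universal cover of the torus with the complex plane and let \<open>G\<close> lift \<open>g\<close>, \<open>\<sigma>\<close> lift
  the involution, and \<open>\<Phi> z = G z - G (\<sigma> z)\<close>.  Coincidences are the points where \<open>\<Phi>\<close> takes values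
  in the lattice, \<open>\<Phi>\<close> changes by multiples of \<open>2\<mu>\<close> under lattice translations, and
  Nielsen classes correspond to lattice values modulo \<open>2\<mu>\<close>.  The coincidences of one class are
  the zeros of a doubly periodic function \<open>\<Psi>\<close>, namely \<open>\<Phi> - w\<close> or \<open>exp (\<pi> i (\<Phi> - w) / \<mu>) - 1\<close>; the
  boundary of a fundamental domain contributes no winding, so every Nielsen class has index \<open>0\<close>
  and only single classes for \<open>\<tau>\<^sub>2\<close> can be essential.  For these, \<open>\<Psi> \<circ> \<sigma>\<close> is \<open>\<Psi>\<close> times
  a function winding \<open>-1\<close> times (or \<open>0\<close> times if \<open>\<mu> = 0\<close>) along the first circle, and going around half of
  the fundamental domain shows that the pseudo-index is \<open>1\<close> (respectively \<open>0\<close>).  Small explicit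
  perturbations of linear maps realize the resulting numbers.
\<close>

section \<open>Winding numbers and local degrees\<close>

text \<open>Maps are only continuous, so the argument principle is proved for continuous planar
  functions, with local degrees in place of orders of zeros. The obstacle is that \<Phi> itself is
  not periodic when \<mu> is nonzero: one turn along the first circle adds 2\<mu>, and a Nielsen
  class collects the preimages of a whole progression w + 2k\<mu>. The exponential has the multiples
  of 2\<mu> as its periods, so it merges these preimages into the zeros of one periodic function
  without changing local degrees. The value 2 has an algebraic origin: the involution acts on values
  by w -> -w - \<nu>, single classes are its fixed points modulo 2\<mu>, and these are -\<nu>/2 and
  -\<nu>/2 + \<mu>, lattice points only if \<nu>/2 is one. The half domain yields a parity only,
  since the winding along its lower side is an unknown integer that enters twice. All counts depend
  just on the two shift vectors of a lift, the columns of the matrix, which are constant along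
  homotopies; this gives the independence that the description operator in \<open>NBU\<close>
  requires.\<close>

lemma winding_number_exp:
  assumes "path q" "\<And>t. t \<in> {0..1} \<Longrightarrow> p t = exp (q t)"
  shows "winding_number p 0 = (pathfinish q - pathstart q) / (2 * of_real pi * \<i>)"
proof -
  have "winding_number p 0 = winding_number (exp \<circ> q) 0"
    by (rule winding_number_cong) (use assms in auto)
  then show ?thesis
    using winding_number_compose_exp[OF assms(1)] by simp
qed

lemma path_log:
  fixes p :: "real \<Rightarrow> complex"
  assumes "path p" "0 \<notin> path_image p"
  obtains q where "path q" "\<And>t. t \<in> {0..1} \<Longrightarrow> p t = exp (q t)"
  using winding_number_as_continuous_log[OF assms] by auto

lemma winding_number_times:
  assumes "path p" "0 \<notin> path_image p" "path q" "0 \<notin> path_image q"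
  shows "winding_number (\<lambda>t. p t * q t) 0 = winding_number p 0 + winding_number q 0"
proof -
  obtain p' where p': "path p'" "\<And>t. t \<in> {0..1} \<Longrightarrow> p t = exp (p' t)"
    using path_log[OF assms(1,2)] by blast
  obtain q' where q': "path q'" "\<And>t. t \<in> {0..1} \<Longrightarrow> q t = exp (q' t)"
    using path_log[OF assms(3,4)] by blast
  have "path (\<lambda>t. p' t + q' t)"
    using p'(1) q'(1) by (simp add: path_def continuous_on_add)
  then have "winding_number (\<lambda>t. p t * q t) 0 =
      (pathfinish (\<lambda>t. p' t + q' t) - pathstart (\<lambda>t. p' t + q' t)) / (2 * of_real pi * \<i>)"
    by (rule winding_number_exp) (simp add: p' q' exp_add)
  moreover have "winding_number p 0 = (pathfinish p' - pathstart p') / (2 * of_real pi * \<i>)"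
    by (rule winding_number_exp) (use p' in auto)
  moreover have "winding_number q 0 = (pathfinish q' - pathstart q') / (2 * of_real pi * \<i>)"
    by (rule winding_number_exp) (use q' in auto)
  ultimately show ?thesis
    by (simp only: pathfinish_def pathstart_def add_divide_distrib[symmetric]) (simp add: algebra_simps)
qed

lemma winding_number_power_int:
  assumes "path p" "0 \<notin> path_image p"
  shows "winding_number (\<lambda>t. p t powi d) 0 = of_int d * winding_number p 0"
proof -
  obtain p' where p': "path p'" "\<And>t. t \<in> {0..1} \<Longrightarrow> p t = exp (p' t)"
    using path_log[OF assms] by blast
  have "path (\<lambda>t. of_int d * p' t)"
    using p'(1) by (simp add: path_def continuous_on_mult_left)
  then have "winding_number (\<lambda>t. p t powi d) 0 =
      (pathfinish (\<lambda>t. of_int d * p' t) - pathstart (\<lambda>t. of_int d * p' t)) / (2 * of_real pi * \<i>)"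
    by (rule winding_number_exp) (simp add: p' exp_power_int)
  moreover have "winding_number p 0 = (pathfinish p' - pathstart p') / (2 * of_real pi * \<i>)"
    by (rule winding_number_exp) (use p' in auto)
  ultimately show ?thesis
    by (simp only: pathfinish_def pathstart_def) (simp add: algebra_simps)
qed

text \<open>A continuous logarithm exists on all of \<open>S\<close>, so along a closed path it
  returns to its initial value.\<close>

lemma winding_number_nonvanishing:
  fixes K :: "complex \<Rightarrow> complex"
  assumes "continuous_on S K" "convex S" "\<And>z. z \<in> S \<Longrightarrow> K z \<noteq> 0"
    and "path g" "path_image g \<subseteq> S" "pathfinish g = pathstart g"
  shows "winding_number (K \<circ> g) 0 = 0"
proof -
  obtain l where l: "continuous_on S l" "\<And>z. z \<in> S \<Longrightarrow> K z = exp (l z)"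
    using continuous_logarithm_on_contractible[OF assms(1) convex_imp_contractible[OF assms(2)] assms(3)]
    by blast
  have "path (l \<circ> g)"
    using assms(4,5) l(1) by (meson continuous_on_subset path_continuous_image)
  then have "winding_number (K \<circ> g) 0 =
      (pathfinish (l \<circ> g) - pathstart (l \<circ> g)) / (2 * of_real pi * \<i>)"
    by (rule winding_number_exp) (use assms(5) l(2) in \<open>force simp: path_image_def\<close>)
  then show ?thesis
    using assms(6) by (simp add: pathfinish_compose pathstart_compose)
qed

text \<open>Radial interpolation moves one circle to the other. The distance to z is then a convex
  combination of r and R, so the homotopy never meets a zero at z.\<close>

lemma winding_number_circles_eq:
  assumes "continuous_on (cball z R) F" "\<And>w. w \<in> cball z R - {z} \<Longrightarrow> F w \<noteq> 0"
    and "0 < r" "r \<le> R"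
  shows "winding_number (F \<circ> circlepath z r) 0 = winding_number (F \<circ> circlepath z R) 0"
proof -
  have "homotopic_loops (cball z R - {z}) (circlepath z r) (circlepath z R)"
  proof (rule homotopic_loops_linear)
    fix t :: real
    show "closed_segment (circlepath z r t) (circlepath z R t) \<subseteq> cball z R - {z}"
    proof
      fix w assume "w \<in> closed_segment (circlepath z r t) (circlepath z R t)"
      then obtain u where u: "0 \<le> u" "u \<le> 1"
        "w = (1 - u) *\<^sub>R circlepath z r t + u *\<^sub>R circlepath z R t"
        by (auto simp: in_segment)
      have w: "w - z = of_real ((1 - u) * r + u * R) * exp (2 * of_real pi * \<i> * of_real t)"
        by (simp add: u(3) circlepath scaleR_conv_of_real algebra_simps)
      have e: "norm (exp (2 * of_real pi * \<i> * of_real t)) = 1"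
        by (simp add: norm_exp_eq_Re)
      have pos: "(1 - u) * r + u * R > 0"
        using u(1,2) assms(3,4)
        by (smt (verit) mult_nonneg_nonneg mult_pos_pos)
      have le: "(1 - u) * r + u * R \<le> R"
        using u(1,2) assms(3,4) by (metis add.commute convex_bound_le diff_add_cancel diff_ge_0_iff_ge order_refl)
      have "norm (w - z) = (1 - u) * r + u * R"
        unfolding w norm_mult e norm_of_real using pos by simp
      then show "w \<in> cball z R - {z}"
        using pos le by (auto simp: dist_norm norm_minus_commute)
    qed
  qed auto
  then have "homotopic_loops (-{0}) (F \<circ> circlepath z r) (F \<circ> circlepath z R)"
    by (rule homotopic_loops_continuous_image)
       (use assms(1,2) in \<open>auto intro: continuous_on_subset\<close>)
  then show ?thesis
    by (rule winding_number_homotopic_loops)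
qed

section \<open>Local degree at an isolated zero\<close>

lemma path_image_compose_circlepath:
  assumes "0 < r"
  shows "path_image (F \<circ> circlepath z r) = F ` sphere z r"
  using assms by (simp add: path_image_compose)

text \<open>Shrinking the radius does not change the winding number, so the eventual value in the
  definition exists and can be read off on any circle with no other zero inside or on it.\<close>

lemma local_degree_eqI:
  assumes "continuous_on (cball z R) F" "\<And>w. w \<in> cball z R - {z} \<Longrightarrow> F w \<noteq> 0" "F z = 0"
    and "0 < R"
  shows "winding_number (F \<circ> circlepath z R) 0 = of_int (local_degree F z)"
proof -
  have "path (F \<circ> circlepath z R)"
    using assms(1,4) by (intro path_continuous_image) (auto intro: continuous_on_subset)
  moreover have "0 \<notin> path_image (F \<circ> circlepath z R)"
    unfolding path_image_compose_circlepath[OF assms(4)]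
  proof
    assume "0 \<in> F ` sphere z R"
    then obtain w where "w \<in> sphere z R" "F w = 0" by auto
    moreover from this have "w \<in> cball z R - {z}" using assms(4) by auto
    ultimately show False using assms(2) by blast
  qed
  ultimately obtain k where k: "winding_number (F \<circ> circlepath z R) 0 = of_int k"
    using integer_winding_number[of "F \<circ> circlepath z R" 0]
    by (auto simp: pathfinish_compose pathstart_compose elim: Ints_cases)
  have ev: "\<forall>\<^sub>F r in at_right 0. winding_number (F \<circ> circlepath z r) 0 = of_int k"
  proof -
    have "winding_number (F \<circ> circlepath z r) 0 = of_int k" if "0 < r" "r < R" for r
      using winding_number_circles_eq[OF assms(1,2) that(1)] that(2) k by simp
    then show ?thesis
      unfolding eventually_at_right_field using assms(4) by blast
  qed
  have "local_degree F z = k"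
    unfolding local_degree_def assms(3)
  proof (rule the_equality)
    show "\<forall>\<^sub>F r in at_right 0. winding_number (F \<circ> circlepath z r) 0 = of_int k"
      by (rule ev)
    fix k' assume "\<forall>\<^sub>F r in at_right 0. winding_number (F \<circ> circlepath z r) 0 = of_int k'"
    with ev have "\<forall>\<^sub>F r in at_right (0::real). of_int k = (of_int k' :: complex)"
      by eventually_elim simp
    then show "k' = k"
      by simp
  qed
  with k show ?thesis by simp
qed

lemma local_degree_cong:
  assumes "\<forall>\<^sub>F w in nhds z. F w = F' w"
  shows "local_degree F z = local_degree F' z"
proof -
  obtain e where e: "e > 0" "\<And>w. dist w z < e \<Longrightarrow> F w = F' w"
    using assms by (auto simp: eventually_nhds_metric)
  have "\<forall>\<^sub>F r in at_right 0. winding_number (F \<circ> circlepath z r) (F z) = winding_number (F' \<circ> circlepath z r) (F' z)"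
    unfolding eventually_at_right_field
  proof (intro exI[of _ e] conjI allI impI)
    fix r assume r: "0 < r" "r < e"
    have "winding_number (F \<circ> circlepath z r) (F z) = winding_number (F' \<circ> circlepath z r) (F z)"
    proof (rule winding_number_cong)
      fix t :: real assume "0 \<le> t" "t \<le> 1"
      then have "circlepath z r t \<in> path_image (circlepath z r)"
        by (auto simp: path_image_def)
      then show "(F \<circ> circlepath z r) t = (F' \<circ> circlepath z r) t"
        using r e(2) by (simp add: dist_commute)
    qed
    then show "winding_number (F \<circ> circlepath z r) (F z) = winding_number (F' \<circ> circlepath z r) (F' z)"
      using e by simp
  qed (use e in auto)
  then have "(\<forall>\<^sub>F r in at_right 0. winding_number (F \<circ> circlepath z r) (F z) = of_int k) \<longleftrightarrow>
    (\<forall>\<^sub>F r in at_right 0. winding_number (F' \<circ> circlepath z r) (F' z) = of_int k)" for k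
    by (rule eventually_subst[OF eventually_mono]) simp
  then show ?thesis
    unfolding local_degree_def by simp
qed

text \<open>On a small disc around z the factor \<open>K\<close> is nonzero and contributes no
  winding. This compares \<Psi> with \<Phi> and transfers degrees after another zero has been
  divided out.\<close>

lemma local_degree_mult:
  assumes "open S" "z \<in> S" "continuous_on S A" "continuous_on S K" "A z = 0" "K z \<noteq> 0"
    and "\<And>w. w \<in> S - {z} \<Longrightarrow> A w \<noteq> 0"
  shows "local_degree (\<lambda>w. A w * K w) z = local_degree A z"
proof -
  have "open {w \<in> S. K w \<noteq> 0}"
    using continuous_open_preimage[OF assms(4,1), of "-{0}"] by (simp add: vimage_def Int_def open_Compl)
  then obtain R where R: "R > 0" "cball z R \<subseteq> {w \<in> S. K w \<noteq> 0}"
    using assms(2,6) open_contains_cball by (metis (mono_tags, lifting) mem_Collect_eq)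
  have cA: "continuous_on (cball z R) A" and cK: "continuous_on (cball z R) K"
    using R(2) assms(3,4) by (auto intro: continuous_on_subset)
  have pA: "path (A \<circ> circlepath z R)" and pK: "path (K \<circ> circlepath z R)"
    using cA cK R(1) by (auto intro!: path_continuous_image intro: continuous_on_subset)
  have nz: "0 \<notin> path_image (A \<circ> circlepath z R)" "0 \<notin> path_image (K \<circ> circlepath z R)"
    unfolding path_image_compose_circlepath[OF R(1)]
  proof -
    have *: "w \<in> S - {z}" "K w \<noteq> 0" if "w \<in> sphere z R" for w
    proof -
      have "w \<in> cball z R" "w \<noteq> z" using that R(1) by auto
      then show "w \<in> S - {z}" "K w \<noteq> 0" using R(2) by auto
    qed
    show "0 \<notin> A ` sphere z R" "0 \<notin> K ` sphere z R"
      using * assms(7) by (metis imageE)+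
  qed
  have "of_int (local_degree (\<lambda>w. A w * K w) z) = winding_number ((\<lambda>w. A w * K w) \<circ> circlepath z R) 0"
    using cA cK R assms by (intro local_degree_eqI[symmetric]) (auto intro!: continuous_intros)
  also have "\<dots> = winding_number (A \<circ> circlepath z R) 0 + winding_number (K \<circ> circlepath z R) 0"
    using winding_number_times[OF pA nz(1) pK nz(2)] by (simp add: o_def)
  also have "winding_number (K \<circ> circlepath z R) 0 = 0"
    by (rule winding_number_nonvanishing[OF cK]) (use R in auto)
  also have "winding_number (A \<circ> circlepath z R) 0 = of_int (local_degree A z)"
    using cA R assms by (intro local_degree_eqI) auto
  finally show ?thesis by simp
qed

text \<open>Winding number 0 makes the boundary loop null-homotopic in the punctured plane, and a
  null-homotopic map on a circle extends over the disc. This is the tool for erasing a zero of a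
  merely continuous function.\<close>

lemma nonvanishing_extension_to_disc:
  fixes f :: "complex \<Rightarrow> complex"
  assumes "continuous_on (sphere z r) f" "\<And>w. w \<in> sphere z r \<Longrightarrow> f w \<noteq> 0" "0 < r"
    and "winding_number (f \<circ> circlepath z r) 0 = 0"
  obtains g where "continuous_on (cball z r) g" "\<And>w. w \<in> cball z r \<Longrightarrow> g w \<noteq> 0"
    "\<And>w. w \<in> sphere z r \<Longrightarrow> g w = f w"
proof -
  define F where "F = (\<lambda>w. f (z + of_real r * w))"
  have "path (f \<circ> circlepath z r)"
    using assms(1,3) by (intro path_continuous_image) auto
  moreover have "0 \<notin> path_image (f \<circ> circlepath z r)"
    unfolding path_image_compose_circlepath[OF assms(3)] using assms(2) by force
  ultimately obtain a where "homotopic_loops (-{0}) (f \<circ> circlepath z r) (\<lambda>t. a)"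
    using winding_number_homotopic_loops_null_eq assms(4) by blast
  from homotopic_loops_imp_homotopic_circlemaps[OF this]
  have "homotopic_with_canon (\<lambda>h. True) (sphere 0 1) (-{0}) F (\<lambda>w. a)"
  proof (rule homotopic_with_eq)
    fix w :: complex assume "w \<in> topspace (top_of_set (sphere 0 1))"
    then have "exp (\<i> * of_real (Arg2pi w)) = w"
      using complex_norm_eq_1_exp by auto
    then show "F w = (f \<circ> circlepath z r \<circ> (\<lambda>z. Arg2pi z / (2 * pi))) w"
      by (simp add: F_def circlepath mult.commute)
  qed auto
  then obtain g where g: "continuous_on (cball 0 1) g" "g ` cball 0 1 \<subseteq> -{0}"
    "\<forall>w\<in>sphere 0 1. g w = F w"
    using nullhomotopic_from_sphere_extension[of 0 1 "-{0}" F] by blast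
  have nrm: "norm ((w - z) / of_real r) = dist z w / r" for w
    using assms(3) by (simp add: norm_divide dist_norm norm_minus_commute)
  show ?thesis
  proof (rule that[of "\<lambda>w. g ((w - z) / of_real r)"])
    have im: "(\<lambda>w. (w - z) / of_real r) ` cball z r \<subseteq> cball 0 1"
      using assms(3) nrm by auto
    show "continuous_on (cball z r) (\<lambda>w. g ((w - z) / of_real r))"
      by (rule continuous_on_compose2[OF g(1) _ im]) (use assms(3) in \<open>auto intro!: continuous_intros\<close>)
    show "g ((w - z) / of_real r) \<noteq> 0" if "w \<in> cball z r" for w
      using that im g(2) by blast
    show "g ((w - z) / of_real r) = f w" if "w \<in> sphere z r" for w
    proof -
      have "(w - z) / of_real r \<in> sphere 0 1"
        using that nrm[of w] assms(3) by simp
      then have "g ((w - z) / of_real r) = F ((w - z) / of_real r)"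
        using g(3) by blast
      then show ?thesis
        using assms(3) by (simp add: F_def)
    qed
  qed
qed

text \<open>Argument principle for continuous functions, erasing one zero at a time. Dividing by (z
  - z0)^d, with d the local degree, leaves winding number 0 around z0, so the quotient can be
  refilled over a disc without zeros; the removed power accounts for d times the winding number of
  \<open>g\<close> around z0.\<close>

theorem winding_number_eq_sum_local_degree:
  assumes "finite Z" "open S" "convex S" "Z \<subseteq> S" "continuous_on S F"
    and "\<And>z. z \<in> S \<Longrightarrow> F z = 0 \<longleftrightarrow> z \<in> Z"
    and "path g" "path_image g \<subseteq> S - Z" "pathfinish g = pathstart g"
  shows "winding_number (F \<circ> g) 0 = (\<Sum>z\<in>Z. of_int (local_degree F z) * winding_number g z)"
  using assms(1,4-6,8)
proof (induction Z arbitrary: F rule: finite_induct)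
  case empty
  then show ?case
    using winding_number_nonvanishing[of S F g] assms(3,7,9) by (simp add: o_def)
next
  case (insert z0 Z)
  have "open (S - Z - path_image g)"
    using insert.hyps assms(2,7) by (simp add: finite_imp_closed open_Diff closed_path_image)
  moreover have "z0 \<in> S - Z - path_image g"
    using insert.hyps insert.prems by auto
  ultimately obtain r where r: "r > 0" "cball z0 r \<subseteq> S - Z - path_image g"
    using open_contains_cball by metis
  define d where "d = local_degree F z0"
  \<comment> \<open>The exponent may have either sign, and \<open>Q\<close> need not extend
    continuously to z0; only its values outside a disc around z0 survive in
    \<open>F1\<close>.\<close>
  define Q where "Q = (\<lambda>z. F z * (z - z0) powi (- d))"
  have contQ: "continuous_on (S - {z0}) Q"
    unfolding Q_def by (intro continuous_intros continuous_on_subset[OF insert.prems(2)]) auto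
  have Q0: "Q z = 0 \<longleftrightarrow> z \<in> Z" if "z \<in> S - {z0}" for z
    using that insert.prems(3)[of z] by (auto simp: Q_def)
  have sph: "sphere z0 r \<subseteq> S - {z0}" "sphere z0 r \<inter> Z = {}"
    using r by auto
  have cF: "continuous_on (cball z0 r) F"
    using r(2) by (intro continuous_on_subset[OF insert.prems(2)]) auto
  have Fnz: "F w \<noteq> 0" if "w \<in> cball z0 r - {z0}" for w
    using that r(2) insert.prems(3)[of w] by auto
  have wd: "winding_number (F \<circ> circlepath z0 r) 0 = of_int d"
    unfolding d_def by (rule local_degree_eqI[OF cF Fnz]) (use insert.prems r in auto)
  have pF: "path (F \<circ> circlepath z0 r)"
    using r by (intro path_continuous_image continuous_on_subset[OF cF]) auto
  have Fc: "0 \<notin> path_image (F \<circ> circlepath z0 r)"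
    unfolding path_image_compose_circlepath[OF r(1)]
  proof
    assume "0 \<in> F ` sphere z0 r"
    then obtain w where "w \<in> sphere z0 r" "F w = 0" by auto
    moreover from this have "w \<in> cball z0 r - {z0}" using r(1) by auto
    ultimately show False using Fnz by blast
  qed
  have powpath: "path (\<lambda>t. (h t - z0) powi k) \<and> 0 \<notin> path_image (\<lambda>t. (h t - z0) powi k) \<and>
     winding_number (\<lambda>t. (h t - z0) powi k) 0 = of_int k * winding_number h z0"
    if "path h" "z0 \<notin> path_image h" for h k
  proof (intro conjI)
    show "path (\<lambda>t. (h t - z0) powi k)"
      using that unfolding path_def by (intro continuous_intros) (auto simp: path_image_def)
    show "0 \<notin> path_image (\<lambda>t. (h t - z0) powi k)"
      using that by (auto simp: path_image_def)
    have "path (\<lambda>t. h t - z0)"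
      using that unfolding path_def by (intro continuous_intros) auto
    moreover have "0 \<notin> path_image (\<lambda>t. h t - z0)"
      using that by (auto simp: path_image_def)
    ultimately show "winding_number (\<lambda>t. (h t - z0) powi k) 0 = of_int k * winding_number h z0"
      using winding_number_power_int winding_number_offset[of h z0] by simp
  qed
  have "winding_number (Q \<circ> circlepath z0 r) 0 =
      winding_number (F \<circ> circlepath z0 r) 0 + winding_number (\<lambda>t. (circlepath z0 r t - z0) powi (-d)) 0"
    using winding_number_times[OF pF Fc, of "\<lambda>t. (circlepath z0 r t - z0) powi (-d)"]
      powpath[of "circlepath z0 r" "-d"] r
    by (simp add: Q_def o_def)
  also have "\<dots> = 0"
    using powpath[of "circlepath z0 r" "-d"] r wd by (simp add: winding_number_circlepath_centre)
  finally have "winding_number (Q \<circ> circlepath z0 r) 0 = 0" .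
  moreover have Qsph: "Q w \<noteq> 0" if "w \<in> sphere z0 r" for w
    using Q0[of w] that sph by blast
  ultimately obtain E where E: "continuous_on (cball z0 r) E" "\<And>w. w \<in> cball z0 r \<Longrightarrow> E w \<noteq> 0"
    "\<And>w. w \<in> sphere z0 r \<Longrightarrow> E w = Q w"
    using nonvanishing_extension_to_disc[OF continuous_on_subset[OF contQ sph(1)] Qsph r(1)] by blast
  define F1 where "F1 = (\<lambda>z. if z \<in> cball z0 r then E z else Q z)"
  have F1Q: "F1 z = Q z" if "z \<notin> ball z0 r" for z
    using that E(3)[of z] by (auto simp: F1_def)
  have "continuous_on (cball z0 r \<union> (S - ball z0 r)) F1"
    unfolding F1_def
  proof (rule continuous_on_cases_local)
    show "closedin (top_of_set (cball z0 r \<union> (S - ball z0 r))) (cball z0 r)"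
      by (auto intro: closed_subset)
    show "closedin (top_of_set (cball z0 r \<union> (S - ball z0 r))) (S - ball z0 r)"
      unfolding closedin_closed
      using r(2) by (intro exI[of _ "- ball z0 r"]) auto
    show "continuous_on (S - ball z0 r) Q"
      using r(1) by (intro continuous_on_subset[OF contQ]) auto
  qed (use E in auto)
  moreover have "cball z0 r \<union> (S - ball z0 r) = S"
    using r(2) by auto
  ultimately have contF1: "continuous_on S F1" by simp
  have F10: "F1 z = 0 \<longleftrightarrow> z \<in> Z" if "z \<in> S" for z
  proof (cases "z \<in> cball z0 r")
    case True
    then show ?thesis using E(2) r(2) by (auto simp: F1_def)
  next
    case False
    then have "z \<noteq> z0" using r(1) by auto
    then show ?thesis using False Q0[of z] that by (simp add: F1_def)
  qed
  have IH: "winding_number (F1 \<circ> g) 0 = (\<Sum>z\<in>Z. of_int (local_degree F1 z) * winding_number g z)"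
    by (rule insert.IH[OF _ contF1 F10]) (use insert.prems in auto)
  have deg: "local_degree F1 z = local_degree F z" if "z \<in> Z" for z
  proof -
    \<comment> \<open>On \<open>T\<close> the refilled function agrees with \<open>Q\<close>, and z
      is the only zero of \<open>F\<close>.\<close>
    define T where "T = S - cball z0 r - (Z - {z})"
    have T: "open T" "z \<in> T" "T \<subseteq> S - {z0}"
      using that r insert.hyps insert.prems assms(2)
      by (auto simp: T_def intro!: open_Diff finite_imp_closed)
    have "local_degree F1 z = local_degree Q z"
    proof (rule local_degree_cong)
      show "\<forall>\<^sub>F w in nhds z. F1 w = Q w"
        unfolding eventually_nhds using T
        by (intro exI[of _ T]) (auto simp: F1_def T_def)
    qed
    also have "\<dots> = local_degree F z"
      unfolding Q_def
    proof (rule local_degree_mult[OF T(1,2)])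
      show "continuous_on T F" using T(3) by (intro continuous_on_subset[OF insert.prems(2)]) auto
      show "continuous_on T (\<lambda>w. (w - z0) powi (- d))"
        using T(3) by (intro continuous_intros) auto
      show "F z = 0" "(z - z0) powi (- d) \<noteq> 0"
        using that insert.hyps insert.prems by auto
      show "F w \<noteq> 0" if "w \<in> T - {z}" for w
        using that T(3) insert.prems(3)[of w] by (auto simp: T_def)
    qed
    finally show ?thesis .
  qed
  have gz0: "z0 \<notin> path_image g"
    using insert.prems by auto
  \<comment> \<open>The path avoids the refilled disc, so multiplying back by the power recovers
    \<open>F\<close> along \<open>g\<close>.\<close>
  have eq: "F (g t) = F1 (g t) * (g t - z0) powi d" if "t \<in> {0..1}" for t
  proof -
    have "g t \<in> path_image g" using that by (auto simp: path_image_def)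
    then have "g t \<notin> cball z0 r" "g t \<noteq> z0" using r(2) gz0 by auto
    then show ?thesis
      by (auto simp: F1_def Q_def power_int_minus)
  qed
  have "winding_number (F \<circ> g) 0 = winding_number (\<lambda>t. (F1 \<circ> g) t * (g t - z0) powi d) 0"
    by (rule winding_number_cong) (use eq in auto)
  also have "\<dots> = winding_number (F1 \<circ> g) 0 + winding_number (\<lambda>t. (g t - z0) powi d) 0"
  proof (rule winding_number_times)
    show "path (F1 \<circ> g)"
      using insert.prems(4) assms(7) by (intro path_continuous_image continuous_on_subset[OF contF1]) auto
    show "0 \<notin> path_image (F1 \<circ> g)"
    proof
      assume "0 \<in> path_image (F1 \<circ> g)"
      then obtain w where "w \<in> path_image g" "F1 w = 0" by (auto simp: path_image_compose)
      then show False using F10[of w] insert.prems(4) by blast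
    qed
  qed (use powpath[OF assms(7) gz0] in auto)
  also have "\<dots> = (\<Sum>z\<in>Z. of_int (local_degree F z) * winding_number g z) + of_int d * winding_number g z0"
    using IH deg powpath[OF assms(7) gz0] by simp
  finally show ?case
    using insert.hyps by (simp add: d_def add.commute o_def)
qed

section \<open>Doubly periodic functions\<close>

text \<open>The Gaussian integers. Closure under products serves for integer multiples and, in the
  realization, for multiplication by the conjugate of a lattice vector.\<close>

definition lattice :: "complex set" where
  "lattice = {z. Re z \<in> \<int> \<and> Im z \<in> \<int>}"

lemma lattice_simps [simp]:
  "0 \<in> lattice" "1 \<in> lattice" "\<i> \<in> lattice" "of_int k \<in> lattice" "Complex (of_int k) (of_int l) \<in> lattice"
  by (auto simp: lattice_def)

lemma lattice_add: "u \<in> lattice \<Longrightarrow> v \<in> lattice \<Longrightarrow> u + v \<in> lattice"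
  and lattice_diff: "u \<in> lattice \<Longrightarrow> v \<in> lattice \<Longrightarrow> u - v \<in> lattice"
  and lattice_uminus: "u \<in> lattice \<Longrightarrow> - u \<in> lattice"
  and lattice_mult: "u \<in> lattice \<Longrightarrow> v \<in> lattice \<Longrightarrow> u * v \<in> lattice"
  by (auto simp: lattice_def)

lemma lattice_norm_ge_1:
  assumes "v \<in> lattice" "v \<noteq> 0"
  shows "1 \<le> norm v"
proof -
  have "Re v \<noteq> 0 \<or> Im v \<noteq> 0"
    using assms(2) complex_eq_iff by auto
  then have "1 \<le> \<bar>Re v\<bar> \<or> 1 \<le> \<bar>Im v\<bar>"
    using assms(1) Ints_nonzero_abs_ge1 by (auto simp: lattice_def)
  then show ?thesis
    using abs_Re_le_cmod[of v] abs_Im_le_cmod[of v] by linarith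
qed

text \<open>Distinct lattice points are at distance at least 1, so a continuous choice cannot jump.
  Uniqueness of lifts and constancy of their shifts rest on this.\<close>

lemma continuous_lattice_valued_constant:
  fixes f :: "'a::topological_space \<Rightarrow> complex"
  assumes "connected S" "continuous_on S f" "\<And>x. x \<in> S \<Longrightarrow> f x \<in> lattice" "x \<in> S" "y \<in> S"
  shows "f x = f y"
proof -
  have "f constant_on S"
  proof (rule continuous_discrete_range_constant[OF assms(1,2)])
    fix x assume "x \<in> S"
    then show "\<exists>e>0. \<forall>y. y \<in> S \<and> f y \<noteq> f x \<longrightarrow> e \<le> norm (f y - f x)"
      using assms(3) lattice_diff lattice_norm_ge_1 by (intro exI[of _ 1]) auto
  qed
  then show ?thesis
    using assms(4,5) unfolding constant_on_def by metis
qed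

text \<open>The argument principle asks for an open convex domain, so the rectangle is enlarged by a
  margin; zeros in the margin have winding number 0 and drop out.\<close>

lemma winding_number_rectpath_eq_sum_local_degree:
  assumes "Re a < Re b" "Im a < Im b" "continuous_on UNIV F"
    and fin: "\<And>R. finite {z \<in> cball 0 R. F z = 0}"
    and nz: "\<And>z. z \<in> path_image (rectpath a b) \<Longrightarrow> F z \<noteq> 0"
  shows "winding_number (F \<circ> rectpath a b) 0 = of_int (\<Sum>z | z \<in> box a b \<and> F z = 0. local_degree F z)"
proof -
  define S where "S = box (a - Complex 1 1) (b + Complex 1 1)"
  define Z where "Z = {z \<in> S. F z = 0}"
  have sub: "cbox a b \<subseteq> S"
    by (auto simp: S_def in_box_complex_iff in_cbox_complex_iff)
  have "bounded S" by (simp add: S_def)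
  then obtain R where "S \<subseteq> cball 0 R"
    by (auto simp: bounded_iff subset_iff)
  then have "Z \<subseteq> {z \<in> cball 0 R. F z = 0}" by (auto simp: Z_def)
  then have finZ: "finite Z" using fin finite_subset by blast
  have pi: "path_image (rectpath a b) \<subseteq> cbox a b"
    using assms(1,2) by (intro path_image_rectpath_subset_cbox) auto
  have "winding_number (F \<circ> rectpath a b) 0 =
      (\<Sum>z\<in>Z. of_int (local_degree F z) * winding_number (rectpath a b) z)"
  proof (rule winding_number_eq_sum_local_degree[where S = S])
    show "path_image (rectpath a b) \<subseteq> S - Z"
      using pi sub nz by (auto simp: Z_def)
    show "continuous_on S F" using assms(3) continuous_on_subset by blast
  qed (use finZ in \<open>auto simp: S_def Z_def\<close>)
  also have "\<dots> = (\<Sum>z\<in>{z \<in> box a b. F z = 0}. of_int (local_degree F z) * winding_number (rectpath a b) z)"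
  proof (rule sum.mono_neutral_right[OF finZ])
    show "{z \<in> box a b. F z = 0} \<subseteq> Z"
      using sub by (auto simp: Z_def) (meson box_subset_cbox subsetD)
    show "\<forall>z\<in>Z - {z \<in> box a b. F z = 0}. of_int (local_degree F z) * winding_number (rectpath a b) z = 0"
    proof
      fix z assume z: "z \<in> Z - {z \<in> box a b. F z = 0}"
      then have "z \<notin> path_image (rectpath a b)" "z \<notin> box a b" using nz by (auto simp: Z_def)
      then have "z \<notin> cbox a b"
        using assms(1,2) by (subst (asm) path_image_rectpath) (auto simp: in_box_complex_iff in_cbox_complex_iff)
      then show "of_int (local_degree F z) * winding_number (rectpath a b) z = 0"
        using assms(1,2) winding_number_rectpath_outside by simp
    qed
  qed
  also have "\<dots> = (\<Sum>z\<in>{z \<in> box a b. F z = 0}. of_int (local_degree F z))"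
    by (rule sum.cong) (auto simp: winding_number_rectpath)
  finally show ?thesis by simp
qed

text \<open>Opposite sides are oriented the same way, so that a translation can compare them. The
  sides are open arcs, whose winding numbers need not be integers.\<close>

lemma winding_number_compose_rectpath:
  fixes F :: "complex \<Rightarrow> complex"
  assumes "Re a \<le> Re b" "Im a \<le> Im b" "continuous_on UNIV F"
    and nz: "\<And>z. z \<in> path_image (rectpath a b) \<Longrightarrow> F z \<noteq> 0"
  defines "a2 \<equiv> Complex (Re b) (Im a)" and "a4 \<equiv> Complex (Re a) (Im b)"
  shows "winding_number (F \<circ> rectpath a b) 0 =
     winding_number (F \<circ> linepath a a2) 0 + winding_number (F \<circ> linepath a2 b) 0
     - winding_number (F \<circ> linepath a4 b) 0 - winding_number (F \<circ> linepath a a4) 0"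
proof -
  have path: "path (F \<circ> linepath u v)" for u v
    using assms(3) continuous_on_subset by (intro path_continuous_image) auto
  have pi: "path_image (rectpath a b) = closed_segment a a2 \<union> closed_segment a2 b \<union>
      closed_segment b a4 \<union> closed_segment a4 a"
    by (simp add: rectpath_def Let_def path_image_join a2_def a4_def Un_assoc)
  have nzs: "0 \<notin> path_image (F \<circ> linepath a a2)" "0 \<notin> path_image (F \<circ> linepath a2 b)"
    "0 \<notin> path_image (F \<circ> linepath b a4)" "0 \<notin> path_image (F \<circ> linepath a4 a)"
    using nz unfolding pi by (force simp: path_image_compose)+
  have rev: "winding_number (F \<circ> linepath v u) 0 = - winding_number (F \<circ> linepath u v) 0"
    if "0 \<notin> path_image (F \<circ> linepath v u)" for u v
  proof -
    have "F \<circ> linepath u v = reversepath (F \<circ> linepath v u)"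
      by (auto simp: reversepath_def linepath_def fun_eq_iff add.commute)
    then show ?thesis
      using winding_number_reversepath[OF path that] by simp
  qed
  have "F \<circ> rectpath a b = (F \<circ> linepath a a2) +++ (F \<circ> linepath a2 b) +++
      (F \<circ> linepath b a4) +++ (F \<circ> linepath a4 a)"
    by (simp add: rectpath_def Let_def path_compose_join a2_def a4_def)
  then have "winding_number (F \<circ> rectpath a b) 0 =
     winding_number (F \<circ> linepath a a2) 0 + winding_number (F \<circ> linepath a2 b) 0
     + winding_number (F \<circ> linepath b a4) 0 + winding_number (F \<circ> linepath a4 a) 0"
    using nzs by (simp add: winding_number_join path path_image_join pathstart_compose pathfinish_compose)
  then show ?thesis
    using rev[OF nzs(3)] rev[OF nzs(4)] by simp
qed

lemma compose_linepath_translate: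
  assumes "\<And>z. F (z + c) = F z" "u' = u + c" "v' = v + c"
  shows "F \<circ> linepath u' v' = F \<circ> linepath (u::complex) v"
proof
  fix t
  have "linepath u' v' t = linepath u v t + c"
    by (simp add: assms linepath_def algebra_simps)
  then show "(F \<circ> linepath u' v') t = (F \<circ> linepath u v) t"
    by (simp add: assms(1))
qed

text \<open>Translation by a period identifies opposite sides, so their contributions cancel.
  Periodicity also carries the absence of zeros from two grid lines to the other two sides.\<close>

lemma sum_local_degree_periodic:
  assumes "continuous_on UNIV F" "\<And>z. F (z + 1) = F z" "\<And>z. F (z + \<i>) = F z"
    and "\<And>R. finite {z \<in> cball 0 R. F z = 0}"
    and nz: "\<And>z. Re z = Re a \<or> Im z = Im a \<Longrightarrow> F z \<noteq> 0"
  shows "(\<Sum>z | z \<in> box a (a + Complex 1 1) \<and> F z = 0. local_degree F z) = 0"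
proof -
  let ?b = "a + Complex 1 1"
  have nz': "F z \<noteq> 0" if "z \<in> path_image (rectpath a ?b)" for z
  proof -
    have "Re z = Re a \<or> Im z = Im a \<or> Re z = Re a + 1 \<or> Im z = Im a + 1"
      using that by (subst (asm) path_image_rectpath) auto
    then have "F z \<noteq> 0 \<or> F (z - 1) \<noteq> 0 \<or> F (z - \<i>) \<noteq> 0"
      using nz[of z] nz[of "z - 1"] nz[of "z - \<i>"] by auto
    then show ?thesis
      using assms(2)[of "z - 1"] assms(3)[of "z - \<i>"] by auto
  qed
  have 1: "F \<circ> linepath (Complex (Re ?b) (Im a)) ?b = F \<circ> linepath a (Complex (Re a) (Im ?b))"
    by (rule compose_linepath_translate[where c = 1]) (auto simp: assms complex_eq_iff)
  have 2: "F \<circ> linepath (Complex (Re a) (Im ?b)) ?b = F \<circ> linepath a (Complex (Re ?b) (Im a))"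
    by (rule compose_linepath_translate[where c = \<i>]) (auto simp: assms complex_eq_iff)
  have "of_int (\<Sum>z | z \<in> box a ?b \<and> F z = 0. local_degree F z) = winding_number (F \<circ> rectpath a ?b) 0"
    by (rule winding_number_rectpath_eq_sum_local_degree[symmetric]) (use assms nz' in auto)
  also have "\<dots> = 0"
    by (subst winding_number_compose_rectpath) (use assms nz' 1 2 in auto)
  finally show ?thesis
    using of_int_eq_0_iff by blast
qed

lemma exp_eq_1_imp_Ints:
  assumes "exp w = (1::complex)"
  shows "w / (2 * of_real pi * \<i>) \<in> \<int>"
proof -
  obtain n where "Re w = 0" "Im w = of_int (2 * n) * pi"
    using assms exp_eq_1 by blast
  then have "w = 2 * of_real pi * \<i> * of_int n"
    by (simp add: complex_eq_iff)
  then show ?thesis by simp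
qed

text \<open>The glide reflection maps the lower side of the half cell to the upper side with
  direction reversed, up to a horizontal translation. If the lower side winds n times, the upper one
  read from left to right winds -(n + k) times, and the vertical sides cancel: the total is 2n +
  k.\<close>

lemma sum_local_degree_half_period:
  assumes contF: "continuous_on UNIV F" and per: "\<And>z. F (z + 1) = F z"
    and tau: "\<And>z. F (- cnj z + \<i> / 2) = F z * exp (\<kappa> z)"
    and cont\<kappa>: "continuous_on UNIV \<kappa>" and \<kappa>: "\<And>z. \<kappa> (z + 1) = \<kappa> z + 2 * of_real pi * \<i> * of_int k"
    and fin: "\<And>R. finite {z \<in> cball 0 R. F z = 0}"
    and nz: "\<And>z. Re z = Re a \<or> Im z = Im a \<Longrightarrow> F z \<noteq> 0"
  shows "(\<Sum>z | z \<in> box a (a + Complex 1 (1/2)) \<and> F z = 0. local_degree F z) mod 2 = k mod 2"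
proof -
  let ?b = "a + Complex 1 (1/2)"
  let ?ln = "\<lambda>x. Complex x (Im a)"
  have nz': "F z \<noteq> 0" if "z \<in> path_image (rectpath a ?b)" for z
  proof -
    have "Re z = Re a \<or> Im z = Im a \<or> Re z = Re a + 1 \<or> Im z = Im a + 1/2"
      using that by (subst (asm) path_image_rectpath) auto
    \<comment> \<open>A point z of the upper side is the image of - cnj (z - \<i>/2), which lies on
      the lower line.\<close>
    then have "F z \<noteq> 0 \<or> F (z - 1) \<noteq> 0 \<or> F (- cnj (z - \<i>/2)) \<noteq> 0"
      using nz[of z] nz[of "z - 1"] nz[of "- cnj (z - \<i>/2)"] by auto
    then show ?thesis
      using per[of "z - 1"] tau[of "- cnj (z - \<i>/2)"] by auto
  qed
  have contln: "continuous_on UNIV ?ln"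
    by (simp add: Complex_eq continuous_intros)
  have "continuous_on UNIV (\<lambda>x. F (?ln x))"
    by (rule continuous_on_compose2[OF contF contln]) auto
  \<comment> \<open>The logarithm is taken on the whole line: the reflection relates the upper side
    to the interval from - Re a - 1 to - Re a, not to the lower side of this cell.\<close>
  then obtain l where l: "continuous_on UNIV l" "\<And>x. F (?ln x) = exp (l x)"
    using continuous_logarithm_on_contractible[of UNIV "\<lambda>x. F (?ln x)"] nz
    by (metis UNIV_I complex.sel(2) contractible_UNIV)
  \<comment> \<open>The increment of the logarithm over a unit step is the same integer everywhere,
    so the lower side and its reflected copy share one n.\<close>
  have lper: "\<exists>n::int. \<forall>x. l (x + 1) = l x + 2 * of_real pi * \<i> * of_int n"
  proof -
    define q where "q = (\<lambda>x. (l (x + 1) - l x) / (2 * of_real pi * \<i>))"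
    have "exp (l (x + 1) - l x) = 1" for x
    proof -
      have "?ln (x + 1) = ?ln x + 1" by (simp add: complex_eq_iff)
      then show ?thesis using l(2)[of x] l(2)[of "x + 1"] per[of "?ln x"] by (simp add: exp_diff)
    qed
    then have qI: "q x \<in> \<int>" for x
      unfolding q_def by (rule exp_eq_1_imp_Ints)
    then have qL: "q x \<in> lattice" for x
      by (metis Ints_cases lattice_simps(4))
    have "continuous_on UNIV (\<lambda>x. l (x + 1))"
      by (rule continuous_on_compose2[OF l(1)]) (auto intro!: continuous_intros)
    then have "continuous_on UNIV q"
      unfolding q_def using l(1) by (intro continuous_intros) auto
    then have "q x = q 0" for x
      using continuous_lattice_valued_constant[of UNIV q x 0] qL by auto
    moreover obtain n where "q 0 = of_int n" using qI Ints_cases by blast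
    ultimately have "q x = of_int n" for x by simp
    then have "l (x + 1) - l x = 2 * of_real pi * \<i> * of_int n" for x
      by (simp add: q_def divide_eq_eq mult.commute)
    then show ?thesis by (metis add.commute diff_add_cancel)
  qed
  then obtain n :: int where n: "\<And>x. l (x + 1) = l x + 2 * of_real pi * \<i> * of_int n" by blast
  have 1: "F \<circ> linepath (Complex (Re ?b) (Im a)) ?b = F \<circ> linepath a (Complex (Re a) (Im ?b))"
    by (rule compose_linepath_translate[where c = 1]) (auto simp: per complex_eq_iff)
  have bottom: "winding_number (F \<circ> linepath a (Complex (Re ?b) (Im a))) 0 = of_int n"
  proof -
    let ?q = "\<lambda>t. l (Re a + t)"
    have "path ?q"
      unfolding path_def by (rule continuous_on_compose2[OF l(1)]) (auto intro!: continuous_intros)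
    then have "winding_number (F \<circ> linepath a (Complex (Re ?b) (Im a))) 0 =
        (pathfinish ?q - pathstart ?q) / (2 * of_real pi * \<i>)"
    proof (rule winding_number_exp)
      fix t
      have "linepath a (Complex (Re ?b) (Im a)) t = ?ln (Re a + t)"
        by (simp add: linepath_def complex_eq_iff algebra_simps)
      then show "(F \<circ> linepath a (Complex (Re ?b) (Im a))) t = exp (l (Re a + t))"
        using l(2) by simp
    qed
    then show ?thesis using n[of "Re a"] by (simp add: pathfinish_def pathstart_def)
  qed
  have top: "winding_number (F \<circ> linepath (Complex (Re a) (Im ?b)) ?b) 0 = - of_int (n + k)"
  proof -
    let ?q = "\<lambda>t. l (- Re a - t) + \<kappa> (?ln (- Re a - t))"
    have "path ?q"
      unfolding path_def
      by (intro continuous_on_add continuous_on_compose2[OF l(1)] continuous_on_compose2[OF cont\<kappa>]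
          continuous_on_compose2[OF contln]) (auto intro!: continuous_intros)
    then have "winding_number (F \<circ> linepath (Complex (Re a) (Im ?b)) ?b) 0 =
        (pathfinish ?q - pathstart ?q) / (2 * of_real pi * \<i>)"
    proof (rule winding_number_exp)
      fix t
      have "linepath (Complex (Re a) (Im ?b)) ?b t = - cnj (?ln (- Re a - t)) + \<i> / 2"
        by (simp add: linepath_def complex_eq_iff algebra_simps)
      then show "(F \<circ> linepath (Complex (Re a) (Im ?b)) ?b) t = exp (?q t)"
        using l(2) tau by (simp add: exp_add)
    qed
    also have "pathfinish ?q - pathstart ?q = - 2 * of_real pi * \<i> * of_int (n + k)"
    proof -
      have "?ln (- Re a) = ?ln (- Re a - 1) + 1" by (simp add: complex_eq_iff)
      then show ?thesis
        using n[of "- Re a - 1"] \<kappa>[of "?ln (- Re a - 1)"]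
        by (simp add: pathfinish_def pathstart_def algebra_simps)
    qed
    finally show ?thesis by (simp add: o_def)
  qed
  have "of_int (\<Sum>z | z \<in> box a ?b \<and> F z = 0. local_degree F z) = winding_number (F \<circ> rectpath a ?b) 0"
    by (rule winding_number_rectpath_eq_sum_local_degree[symmetric]) (use contF fin nz' in auto)
  also have "\<dots> = of_int (2 * n + k)"
    by (subst winding_number_compose_rectpath) (use contF nz' 1 bottom top in auto)
  finally have "(\<Sum>z | z \<in> box a ?b \<and> F z = 0. local_degree F z) = 2 * n + k"
    using of_int_eq_iff by blast
  then show ?thesis by simp
qed

section \<open>Lifting to the plane\<close>

lemma torus_exp_eq_iff: "torus_exp z = torus_exp w \<longleftrightarrow> z - w \<in> lattice"
  by (simp add: torus_exp_def torus.abs_eq_iff torus_rel_def lattice_def)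

lemma torus_exp_add: "torus_exp (z + w) = torus_exp z + torus_exp w"
  by (simp add: torus_exp_def plus_torus.abs_eq)

lemma torus_exp_diff: "torus_exp (z - w) = torus_exp z - torus_exp w"
  by (simp add: torus_exp_def minus_torus.abs_eq)

lemma torus_exp_0 [simp]: "torus_exp 0 = 0"
  by (simp add: torus_exp_def zero_torus_def)

lemma torus_exp_surj: "\<exists>z. torus_exp z = p"
proof -
  obtain u where "torus_of u = p"
    by (metis Quotient3_abs_rep Quotient3_torus)
  then have "torus_exp (Complex (fst u) (snd u)) = p"
    by (simp add: torus_exp_def)
  then show ?thesis ..
qed

lemma continuous_on_torus_exp: "continuous_on UNIV torus_exp"
proof -
  have "open (torus_exp -` U)" if "open U" for U
  proof -
    have "open ((\<lambda>z. (Re z, Im z)) -` (torus_of -` U))"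
      using that by (intro open_vimage[where f = "\<lambda>z. (Re z, Im z)"])
        (auto simp: open_torus_def intro!: continuous_intros)
    then show ?thesis
      by (simp add: torus_exp_def vimage_def)
  qed
  then show ?thesis
    by (simp add: continuous_on_open_vimage)
qed

lemma open_torus_exp_vimage: "open (torus_exp -` U) \<Longrightarrow> open U"
proof -
  assume "open (torus_exp -` U)"
  then have "open ((\<lambda>u. Complex (fst u) (snd u)) -` (torus_exp -` U))"
    by (rule open_vimage) (auto simp: Complex_eq intro!: continuous_intros)
  then show "open U"
    by (simp add: open_torus_def torus_exp_def vimage_def)
qed

lemma open_map_torus_exp:
  assumes "open U"
  shows "open (torus_exp ` U)"
proof (rule open_torus_exp_vimage)
  have "torus_exp -` (torus_exp ` U) = (\<Union>v\<in>lattice. (+) v ` U)"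
  proof (intro equalityI subsetI)
    fix z assume "z \<in> torus_exp -` (torus_exp ` U)"
    then obtain u where "u \<in> U" "z - u \<in> lattice"
      by (auto simp: torus_exp_eq_iff)
    then show "z \<in> (\<Union>v\<in>lattice. (+) v ` U)"
      by (intro UN_I[of "z - u"]) auto
  next
    fix z assume "z \<in> (\<Union>v\<in>lattice. (+) v ` U)"
    then obtain v u where "v \<in> lattice" "u \<in> U" "z = v + u" by auto
    then have "torus_exp z = torus_exp u"
      by (simp add: torus_exp_eq_iff)
    then show "z \<in> torus_exp -` (torus_exp ` U)"
      using \<open>u \<in> U\<close> by auto
  qed
  then show "open (torus_exp -` (torus_exp ` U))"
    using assms by (auto intro: open_translation)
qed

text \<open>The projection is open, so its product with an identity map still detects continuity.
  Homotopies of torus maps can thus be checked upstairs, even when written with representatives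
  chosen without any continuity.\<close>

lemma continuous_on_times_torusI:
  fixes H :: "'a::topological_space \<times> torus \<Rightarrow> 'b::topological_space"
  assumes "continuous_on (A \<times> UNIV) (\<lambda>x. H (fst x, torus_exp (snd x)))"
  shows "continuous_on (A \<times> UNIV) H"
  unfolding continuous_on_topological
proof (intro ballI allI impI)
  fix x B assume x: "x \<in> A \<times> UNIV" and B: "open B" "H x \<in> B"
  obtain z where z: "torus_exp z = snd x" using torus_exp_surj by blast
  then have "(fst x, z) \<in> A \<times> UNIV" "H (fst (fst x, z), torus_exp (snd (fst x, z))) \<in> B"
    using x B by auto
  then obtain C where C: "open C" "(fst x, z) \<in> C"
    "\<forall>y\<in>A \<times> UNIV. y \<in> C \<longrightarrow> H (fst y, torus_exp (snd y)) \<in> B"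
    using assms B(1) unfolding continuous_on_topological by metis
  obtain C1 C2 where C12: "open C1" "open C2" "(fst x, z) \<in> C1 \<times> C2" "C1 \<times> C2 \<subseteq> C"
    by (rule open_prod_elim[OF C(1,2)])
  show "\<exists>A'. open A' \<and> x \<in> A' \<and> (\<forall>y\<in>A \<times> UNIV. y \<in> A' \<longrightarrow> H y \<in> B)"
  proof (intro exI[of _ "C1 \<times> torus_exp ` C2"] conjI ballI impI)
    show "open (C1 \<times> torus_exp ` C2)"
      using C12 open_map_torus_exp by (intro open_Times)
    show "x \<in> C1 \<times> torus_exp ` C2"
      using C12 z by (cases x) auto
    fix y assume y: "y \<in> A \<times> UNIV" "y \<in> C1 \<times> torus_exp ` C2"
    then obtain w where "w \<in> C2" "snd y = torus_exp w" by auto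
    then show "H y \<in> B"
      using C(3)[rule_format, of "(fst y, w)"] y C12(4) by (cases y) auto
  qed
qed

text \<open>Meant for \<open>P\<close> equal to \<open>Re\<close> or \<open>Im\<close>: the two
  circle coordinates of the torus, which then do not depend on the chosen representative. They
  reduce lifting to continuous logarithms.\<close>

definition torus_circle :: "(complex \<Rightarrow> real) \<Rightarrow> torus \<Rightarrow> complex" where
  "torus_circle P p = exp (2 * of_real pi * \<i> * of_real (P (SOME z. torus_exp z = p)))"

lemma torus_circle_torus_exp:
  assumes "P = Re \<or> P = Im"
  shows "torus_circle P (torus_exp z) = exp (2 * of_real pi * \<i> * of_real (P z))"
proof -
  define w where "w = (SOME w. torus_exp w = torus_exp z)"
  have "torus_exp w = torus_exp z"
    unfolding w_def by (rule someI) simp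
  then have "P w - P z \<in> \<int>"
    using assms by (auto simp: torus_exp_eq_iff lattice_def)
  then obtain n where "P w = P z + of_int n"
    by (metis Ints_cases add.commute diff_add_cancel)
  then have "2 * of_real pi * \<i> * of_real (P w) =
     2 * of_real pi * \<i> * of_real (P z) + of_int n * (2 * of_real pi * \<i>)"
    by (simp add: algebra_simps)
  then have "exp (2 * of_real pi * \<i> * of_real (P w)) =
     exp (2 * of_real pi * \<i> * of_real (P z)) * exp (of_int n * (2 * of_real pi * \<i>))"
    by (simp only: exp_add)
  also have "exp (of_int n * (2 * of_real pi * \<i>)) = 1"
    by (metis exp_power_int exp_two_pi_i power_int_1_left)
  finally show ?thesis
    by (simp add: torus_circle_def w_def)
qed

lemma continuous_on_torus_circle:
  assumes "P = Re \<or> P = Im"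
  shows "continuous_on UNIV (torus_circle P)"
proof -
  have "continuous_on UNIV P"
    using assms by (auto intro: continuous_intros)
  then have "continuous_on UNIV (\<lambda>z. torus_circle P (torus_exp z))"
    unfolding torus_circle_torus_exp[OF assms] by (intro continuous_intros)
  then have "open (torus_exp -` (torus_circle P -` U))" if "open U" for U
    using that by (simp add: continuous_on_open_vimage vimage_def)
  then show ?thesis
    using open_torus_exp_vimage by (simp add: continuous_on_open_vimage)
qed

text \<open>Each circle coordinate of \<open>h\<close> has a continuous logarithm on a contractible
  set; its imaginary part divided by 2 pi lifts that coordinate.\<close>

lemma lift_to_plane:
  fixes h :: "'a::real_normed_vector \<Rightarrow> torus"
  assumes "contractible S" "continuous_on S h"
  obtains H where "continuous_on S H" "\<And>x. x \<in> S \<Longrightarrow> h x = torus_exp (H x)"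
proof -
  have lg: "\<exists>l. continuous_on S l \<and> (\<forall>x\<in>S. torus_circle P (h x) = exp (l x))"
    if P: "P = Re \<or> P = Im" for P
  proof -
    have "continuous_on S (\<lambda>x. torus_circle P (h x))"
      by (rule continuous_on_compose2[OF continuous_on_torus_circle[OF P] assms(2)]) auto
    from continuous_logarithm_on_contractible[OF this assms(1)]
    show ?thesis by (metis exp_not_eq_zero torus_circle_def)
  qed
  obtain l1 where l1: "continuous_on S l1" "\<And>x. x \<in> S \<Longrightarrow> torus_circle Re (h x) = exp (l1 x)"
    using lg by blast
  obtain l2 where l2: "continuous_on S l2" "\<And>x. x \<in> S \<Longrightarrow> torus_circle Im (h x) = exp (l2 x)"
    using lg by blast
  have frac: "Im w / (2 * pi) - x \<in> \<int>" if w: "exp w = exp (2 * of_real pi * \<i> * of_real x)" for w x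
  proof -
    obtain n :: int where "w = 2 * of_real pi * \<i> * of_real x + of_real (of_int (2 * n) * pi) * \<i>"
      using w exp_eq[of w] by blast
    then have "Im w / (2 * pi) = x + of_int n"
      by (simp add: field_simps)
    then show ?thesis by simp
  qed
  show ?thesis
  proof
    show "continuous_on S (\<lambda>x. Complex (Im (l1 x) / (2 * pi)) (Im (l2 x) / (2 * pi)))"
      unfolding Complex_eq using l1(1) l2(1) by (intro continuous_intros) auto
    fix x assume x: "x \<in> S"
    obtain z where z: "torus_exp z = h x" using torus_exp_surj by blast
    have "exp (l1 x) = exp (2 * of_real pi * \<i> * of_real (Re z))"
      "exp (l2 x) = exp (2 * of_real pi * \<i> * of_real (Im z))"
      using l1(2)[OF x] l2(2)[OF x] torus_circle_torus_exp[of Re z] torus_circle_torus_exp[of Im z]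
      by (simp_all add: z)
    from frac[OF this(1)] frac[OF this(2)]
    have "torus_exp (Complex (Im (l1 x) / (2 * pi)) (Im (l2 x) / (2 * pi))) = torus_exp z"
      by (simp add: torus_exp_eq_iff lattice_def)
    then show "h x = torus_exp (Complex (Im (l1 x) / (2 * pi)) (Im (l2 x) / (2 * pi)))"
      by (simp add: z)
  qed
qed

section \<open>Uniqueness of lifts and homotopy of paths\<close>

lemma lifts_differ_by_constant:
  fixes F G :: "'a::topological_space \<Rightarrow> complex"
  assumes "connected S" "continuous_on S F" "continuous_on S G"
    and "\<And>x. x \<in> S \<Longrightarrow> torus_exp (F x) = torus_exp (G x)" "x \<in> S" "y \<in> S"
  shows "F x - G x = F y - G y"
  by (rule continuous_lattice_valued_constant[of S])
     (use assms in \<open>auto simp: torus_exp_eq_iff intro: continuous_on_diff\<close>)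

text \<open>A homotopy lifts over the unit square, and the lifted endpoints stay fixed because they
  vary in a discrete set. Conversely, after a lattice translation the endpoints agree and the
  straight-line homotopy in the plane projects to the torus.\<close>

lemma homotopic_paths_torus_exp_iff:
  assumes "path p" "path q"
  shows "homotopic_paths UNIV (torus_exp \<circ> p) (torus_exp \<circ> q) \<longleftrightarrow>
    pathstart p - pathstart q \<in> lattice \<and> pathfinish p - pathfinish q = pathstart p - pathstart q"
proof
  assume "homotopic_paths UNIV (torus_exp \<circ> p) (torus_exp \<circ> q)"
  then obtain h where h: "continuous_on ({0..1} \<times> {0..1}) h"
    "\<And>t. t \<in> {0..1} \<Longrightarrow> h (0, t) = torus_exp (p t)" "\<And>t. t \<in> {0..1} \<Longrightarrow> h (1, t) = torus_exp (q t)"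
    "\<And>s. s \<in> {0..1::real} \<Longrightarrow> h (s, 0) = torus_exp (p 0) \<and> h (s, 1) = torus_exp (p 1)"
    by (auto simp: homotopic_paths pathstart_def pathfinish_def)
  have "contractible ({0..1::real} \<times> {0..1::real})"
    by (intro convex_imp_contractible convex_Times) auto
  then obtain H where H: "continuous_on ({0..1} \<times> {0..1}) H"
    "\<And>x. x \<in> {0..1} \<times> {0..1} \<Longrightarrow> h x = torus_exp (H x)"
    using lift_to_plane h(1) by blast
  have cH: "continuous_on {0..1} (\<lambda>t. H (s, t))" "continuous_on {0..1} (\<lambda>t. H (t, s))" if "s \<in> {0..1}" for s
    using that by (auto intro!: continuous_on_compose2[OF H(1)] continuous_intros)
  have "H (0, 1) - p 1 = H (0, 0) - p 0"
    by (rule lifts_differ_by_constant[of "{0..1}"]) (use cH assms h H(2) in \<open>auto simp: path_def\<close>)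
  moreover have "H (1, 1) - q 1 = H (1, 0) - q 0"
    by (rule lifts_differ_by_constant[of "{0..1}"])
       (use cH assms h H(2) in \<open>auto simp: path_def\<close>)
  \<comment> \<open>Along the two sides where the homotopy fixes an endpoint, the lift is
    constant.\<close>
  moreover have "H (0, e) - p e = H (1, e) - p e" if "e = 0 \<or> e = 1" for e
  proof (rule lifts_differ_by_constant[of "{0..1}" "\<lambda>s. H (s, e)" "\<lambda>s. p e"])
    show "torus_exp (H (s, e)) = torus_exp (p e)" if s: "s \<in> {0..1}" for s
      using H(2)[of "(s, e)"] h(4)[OF s] \<open>e = 0 \<or> e = 1\<close> s by auto
  qed (use cH that in auto)
  from this[of 0] this[of 1] have "H (0, 0) = H (1, 0)" "H (0, 1) = H (1, 1)"
    by simp_all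
  moreover have "torus_exp (p 0) = torus_exp (q 0)"
    using h(3)[of 0] h(4)[of 1] by simp
  then have "p 0 - q 0 \<in> lattice"
    by (simp add: torus_exp_eq_iff)
  ultimately show "pathstart p - pathstart q \<in> lattice \<and>
      pathfinish p - pathfinish q = pathstart p - pathstart q"
    by (simp add: pathstart_def pathfinish_def) (metis add_diff_cancel_left' add_diff_eq diff_add_cancel diff_diff_eq2)
next
  assume *: "pathstart p - pathstart q \<in> lattice \<and> pathfinish p - pathfinish q = pathstart p - pathstart q"
  define c where "c = pathstart p - pathstart q"
  let ?q = "\<lambda>t. q t + c"
  have "path ?q"
    using assms(2) by (simp add: path_def continuous_on_add)
  then have "homotopic_paths UNIV p ?q"
    using assms(1) * by (intro homotopic_paths_linear)
       (auto simp: c_def pathstart_def pathfinish_def algebra_simps)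
  then have "homotopic_paths UNIV (torus_exp \<circ> p) (torus_exp \<circ> ?q)"
    by (rule homotopic_paths_continuous_image[OF _ continuous_on_torus_exp]) auto
  moreover have "torus_exp \<circ> ?q = torus_exp \<circ> q"
    using * by (auto simp: fun_eq_iff torus_exp_eq_iff c_def)
  ultimately show "homotopic_paths UNIV (torus_exp \<circ> p) (torus_exp \<circ> q)"
    by simp
qed

text \<open>The columns of the matrix induced on the fundamental group are \<open>m\<close> and \<open>n\<close>.\<close>

definition is_torus_lift :: "(torus \<Rightarrow> torus) \<Rightarrow> (complex \<Rightarrow> complex) \<Rightarrow> complex \<Rightarrow> complex \<Rightarrow> bool" where
  "is_torus_lift f F m n \<longleftrightarrow> continuous_on UNIV F \<and> (\<forall>z. f (torus_exp z) = torus_exp (F z)) \<and>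
     m \<in> lattice \<and> n \<in> lattice \<and> (\<forall>z. F (z + 1) = F z + m) \<and> (\<forall>z. F (z + \<i>) = F z + n)"

lemma add_of_int_multiple:
  fixes F :: "complex \<Rightarrow> complex"
  assumes "\<And>z. F (z + v) = F z + m"
  shows "F (z + of_int k * v) = F z + of_int k * m"
proof (induction k arbitrary: z rule: int_induct[where k = 0])
  case (step1 i)
  then show ?case
    using assms[of "z + of_int i * v"] by (simp add: algebra_simps)
next
  case (step2 i)
  then show ?case
    using assms[of "z + of_int (i - 1) * v"] by (simp add: algebra_simps)
qed simp

lemma is_torus_lift_lattice:
  assumes "is_torus_lift f F m n" "v \<in> lattice"
  shows "F (z + v) = F z + of_real (Re v) * m + of_real (Im v) * n"
proof -
  obtain k l where kl: "Re v = of_int k" "Im v = of_int l"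
    using assms(2) by (auto simp: lattice_def elim!: Ints_cases)
  have v: "v = of_int k * 1 + of_int l * \<i>"
    by (simp add: complex_eq_iff kl)
  have "F (z + v) = F (z + of_int k * 1 + of_int l * \<i>)"
    by (simp add: v add.assoc)
  also have "\<dots> = F (z + of_int k * 1) + of_int l * n"
    by (rule add_of_int_multiple) (use assms(1) in \<open>simp add: is_torus_lift_def\<close>)
  also have "F (z + of_int k * 1) = F z + of_int k * m"
    by (rule add_of_int_multiple) (use assms(1) in \<open>simp add: is_torus_lift_def\<close>)
  finally show ?thesis
    by (simp add: kl)
qed

lemma continuous_on_translate:
  fixes F :: "complex \<Rightarrow> complex"
  assumes "continuous_on UNIV F"
  shows "continuous_on UNIV (\<lambda>z. F (z + v))"
  by (rule continuous_on_compose2[OF assms]) (auto intro!: continuous_intros)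

text \<open>\<open>F (z + v)\<close> and \<open>F z\<close> lie over the same point, so their
  difference is lattice valued and continuous, hence independent of z: these are the shift
  vectors.\<close>

lemma ex_torus_lift:
  assumes "continuous_on UNIV f"
  obtains F m n where "is_torus_lift f F m n"
proof -
  have "continuous_on UNIV (\<lambda>z. f (torus_exp z))"
    by (rule continuous_on_compose2[OF assms continuous_on_torus_exp]) auto
  then obtain F where F: "continuous_on UNIV F" "\<And>z. f (torus_exp z) = torus_exp (F z)"
    using lift_to_plane[of UNIV "\<lambda>z. f (torus_exp z)"] by auto
  have shift: "F (z + v) = F z + (F v - F 0)" "F v - F 0 \<in> lattice" if "v \<in> lattice" for v z
  proof -
    have eq: "torus_exp (F (z + v)) = torus_exp (F z)" for z
    proof -
      have "torus_exp (z + v) = torus_exp z"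
        using that by (simp add: torus_exp_eq_iff)
      then show ?thesis by (metis F(2))
    qed
    then have "F (z + v) - F z = F (0 + v) - F 0"
      by (intro lifts_differ_by_constant[of UNIV]) (auto intro: F continuous_on_translate)
    then show "F (z + v) = F z + (F v - F 0)"
      by (simp add: algebra_simps)
    show "F v - F 0 \<in> lattice"
      using eq[of 0] by (simp add: torus_exp_eq_iff)
  qed
  have "is_torus_lift f F (F 1 - F 0) (F \<i> - F 0)"
    unfolding is_torus_lift_def using F shift by simp
  then show ?thesis by (rule that)
qed

lemma continuous_map_unit_interval_times_iff:
  fixes h :: "real \<times> torus \<Rightarrow> torus"
  shows "continuous_map (prod_topology (top_of_set {0..1}) euclidean) euclidean h \<longleftrightarrow>
    continuous_on ({0..1} \<times> UNIV) h"
  using prod_topology_subtopology_eu[of "{0..1::real}" "UNIV :: torus set"] by simp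

text \<open>For the lifted homotopy the shift by a lattice vector is again lattice valued and
  continuous, hence constant also in the homotopy parameter. So m and n are invariants of the
  homotopy class.\<close>

lemma homotopic_torus_lift:
  assumes "is_torus_lift f F m n" "homotopic_maps f g"
  obtains G where "is_torus_lift g G m n"
proof -
  obtain h where h: "continuous_on ({0..1::real} \<times> UNIV) h" "\<And>x. h (0, x) = f x" "\<And>x. h (1, x) = g x"
    using assms(2) by (auto simp: homotopic_with continuous_map_unit_interval_times_iff)
  let ?S = "{0..1::real} \<times> (UNIV :: complex set)"
  have conv: "convex ?S" by (intro convex_Times) auto
  have "continuous_on ?S (\<lambda>x. (fst x, torus_exp (snd x)))"
    by (intro continuous_on_Pair continuous_on_compose2[OF continuous_on_torus_exp]) (auto intro!: continuous_intros)
  then have "continuous_on ?S (\<lambda>x. h (fst x, torus_exp (snd x)))"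
    by (rule continuous_on_compose2[OF h(1)]) auto
  then obtain H where H: "continuous_on ?S H" "\<And>x. x \<in> ?S \<Longrightarrow> h (fst x, torus_exp (snd x)) = torus_exp (H x)"
    using lift_to_plane[OF convex_imp_contractible[OF conv]] by blast
  have sec: "continuous_on UNIV (\<lambda>z. H (s, z))" if "s \<in> {0..1}" for s
    by (rule continuous_on_compose2[OF H(1)]) (use that in \<open>auto intro!: continuous_intros\<close>)
  \<comment> \<open>The lifted homotopy need not start at \<open>F\<close>, only at \<open>F\<close>
    plus a constant, and constants do not affect shifts.\<close>
  have c: "H (0, z) - F z = H (0, w) - F w" for z w
    by (rule lifts_differ_by_constant[of UNIV])
       (use assms(1) sec H(2)[of "(0, _)"] h(2) in \<open>auto simp: is_torus_lift_def\<close>)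
  have shift: "H (1, z + v) = H (1, z) + (F v - F 0)" if "v \<in> lattice" for v z
  proof -
    have cont: "continuous_on ?S (\<lambda>x. H (fst x, snd x + v))"
      by (rule continuous_on_compose2[OF H(1)]) (auto intro!: continuous_intros)
    have "torus_exp (z + v) = torus_exp z" for z
      using that by (simp add: torus_exp_eq_iff)
    then have eq: "torus_exp (H (fst x, snd x + v)) = torus_exp (H x)" if "x \<in> ?S" for x
      using H(2)[of x] H(2)[of "(fst x, snd x + v)"] that by auto
    have "H (1, z + v) - H (1, z) = H (0, v) - H (0, 0)"
      using lifts_differ_by_constant[OF convex_connected[OF conv] cont H(1) eq, of "(1, z)" "(0, 0)"]
      by simp
    also have "\<dots> = F v - F 0"
      using c[of v 0] by (simp add: algebra_simps)
    finally show ?thesis by (simp add: algebra_simps)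
  qed
  have "is_torus_lift g (\<lambda>z. H (1, z)) m n"
    using assms(1) sec[of 1] shift[of 1] shift[of \<i>] H(2)[of "(1, _)"] h(3)
    unfolding is_torus_lift_def by (metis add_diff_cancel_left' add_0 atLeastAtMost_iff diff_add_cancel fst_conv
      lattice_simps(2,3) mem_Sigma_iff order_refl snd_conv zero_le_one UNIV_I)
  then show ?thesis by (rule that)
qed

text \<open>Equal shifts make the linear interpolation of the two lifts shift in the same way at
  every time, so it descends to the torus. With the invariance of the shifts this classifies maps up
  to homotopy by m and n.\<close>

lemma torus_lifts_homotopic:
  assumes "is_torus_lift f F m n" "is_torus_lift g G m n"
  shows "homotopic_maps f g"
proof -
  \<comment> \<open>An arbitrary section, with no continuity; \<open>K\<close> shows below that the
    interpolation does not depend on it.\<close>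
  define \<sigma> where "\<sigma> = (\<lambda>p. SOME z. torus_exp z = p)"
  have \<sigma>: "torus_exp (\<sigma> p) = p" for p
    unfolding \<sigma>_def by (rule someI_ex[OF torus_exp_surj])
  define K where "K = (\<lambda>(t::real) z. (1 - t) *\<^sub>R F z + t *\<^sub>R G z)"
  define H where "H = (\<lambda>x. torus_exp (K (fst x) (\<sigma> (snd x))))"
  have K: "torus_exp (K t (\<sigma> (torus_exp z))) = torus_exp (K t z)" for t z
  proof -
    define v where "v = \<sigma> (torus_exp z) - z"
    have v: "v \<in> lattice" "\<sigma> (torus_exp z) = z + v"
      using \<sigma>[of "torus_exp z"] by (auto simp: v_def torus_exp_eq_iff)
    define w where "w = of_real (Re v) * m + of_real (Im v) * n"
    have "F (z + v) = F z + w" "G (z + v) = G z + w"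
      using is_torus_lift_lattice[OF assms(1) v(1)] is_torus_lift_lattice[OF assms(2) v(1)]
      by (simp_all add: w_def)
    then have "K t (z + v) = K t z + w"
      by (simp add: K_def algebra_simps)
    moreover have "w \<in> lattice"
      using assms(1) v(1) unfolding w_def is_torus_lift_def
      by (intro lattice_add lattice_mult) (auto simp: lattice_def)
    ultimately show ?thesis
      by (simp add: v(2) torus_exp_eq_iff)
  qed
  have "continuous_on ({0..1} \<times> UNIV) (\<lambda>x. torus_exp (K (fst x) (snd x)))"
  proof (rule continuous_on_compose2[OF continuous_on_torus_exp])
    have "continuous_on ({0..1} \<times> UNIV) (\<lambda>x::real \<times> complex. F (snd x))"
      "continuous_on ({0..1} \<times> UNIV) (\<lambda>x::real \<times> complex. G (snd x))"
      using assms by (auto simp: is_torus_lift_def intro!: continuous_on_compose2[of UNIV F]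
          continuous_on_compose2[of UNIV G] continuous_intros)
    then show "continuous_on ({0..1} \<times> UNIV) (\<lambda>x. K (fst x) (snd x))"
      unfolding K_def by (intro continuous_intros)
  qed auto
  then have "continuous_on ({0..1} \<times> UNIV) H"
    by (intro continuous_on_times_torusI) (simp add: H_def K)
  moreover have "H (0, p) = f p" "H (1, p) = g p" for p
    using assms \<sigma>[of p] by (simp_all add: H_def K_def is_torus_lift_def) (metis, metis)
  ultimately show ?thesis
    by (subst homotopic_with) (auto simp: continuous_map_unit_interval_times_iff)
qed

lemma ex_map_with_torus_lift:
  assumes "continuous_on UNIV F" "m \<in> lattice" "n \<in> lattice"
    and "\<And>z. F (z + 1) = F z + m" "\<And>z. F (z + \<i>) = F z + n"
  obtains f where "is_torus_lift f F m n"
proof -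
  define f where "f = (\<lambda>p. torus_exp (F (SOME z. torus_exp z = p)))"
  have "f (torus_exp z) = torus_exp (F z)" for z
  proof -
    define w where "w = (SOME w. torus_exp w = torus_exp z)"
    have "torus_exp w = torus_exp z"
      unfolding w_def by (rule someI) simp
    then obtain k l where kl: "Re (w - z) = of_int k" "Im (w - z) = of_int l"
      by (auto simp: torus_exp_eq_iff lattice_def elim!: Ints_cases)
    have "w = z + of_int k * 1 + of_int l * \<i>"
      using kl by (simp add: complex_eq_iff)
    then have "F w = F z + of_int k * m + of_int l * n"
      using add_of_int_multiple[of F 1 m z k] add_of_int_multiple[of F \<i> n "z + of_int k * 1" l] assms(4,5)
      by simp
    moreover have "of_int k * m + of_int l * n \<in> lattice"
      using assms(2,3) by (intro lattice_add lattice_mult) auto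
    ultimately have "torus_exp (F w) = torus_exp (F z)"
      by (simp add: torus_exp_eq_iff add.assoc)
    then show ?thesis
      by (simp add: f_def w_def)
  qed
  then have "is_torus_lift f F m n"
    using assms by (simp add: is_torus_lift_def)
  then show ?thesis by (rule that)
qed

text \<open>Both loops lift to paths starting at \<open>F 0\<close>, so they are homotopic exactly
  when the lifted endpoints agree. This determines the image of every vector, hence the unique
  matrix that the description operator asks for.\<close>

lemma pi1_matrix_eq:
  assumes "is_torus_lift f F (Complex (of_int p) (of_int q)) (Complex (of_int r) (of_int s))"
  shows "pi1_matrix f = vector [vector [p, r], vector [q, s]]"
proof -
  let ?M = "vector [vector [p, r], vector [q, s]] :: int ^ 2 ^ 2"
  let ?c = "\<lambda>v::int^2. Complex (of_int (vec_nth v 1)) (of_int (vec_nth v 2))"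
  have loop: "torus_loop (torus_exp c) v = torus_exp \<circ> (\<lambda>t. c + of_real t * ?c v)" for c v
    by (simp add: torus_loop_def fun_eq_iff torus_exp_add) (simp add: torus_exp_def)
  have iff: "homotopic_paths UNIV (f \<circ> torus_loop 0 v) (torus_loop (f 0) w) \<longleftrightarrow> w = ?M *v v" for v w
  proof -
    have F: "continuous_on UNIV F" "\<And>z. f (torus_exp z) = torus_exp (F z)"
      using assms by (auto simp: is_torus_lift_def)
    have 1: "f \<circ> torus_loop 0 v = torus_exp \<circ> (\<lambda>t. F (of_real t * ?c v))"
      using loop[of 0 v] F by (simp add: fun_eq_iff)
    have 2: "torus_loop (f 0) w = torus_exp \<circ> (\<lambda>t. F 0 + of_real t * ?c w)"
      using loop[of "F 0" w] F(2)[of 0] by simp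
    have paths: "path (\<lambda>t. F (of_real t * ?c v))" "path (\<lambda>t. F 0 + of_real t * ?c w)"
      unfolding path_def by (auto intro!: continuous_on_compose2[OF F(1)] continuous_intros)
    let ?X = "of_real (Re (?c v)) * Complex (of_int p) (of_int q)
        + of_real (Im (?c v)) * Complex (of_int r) (of_int s)"
    have X: "F (?c v) = F 0 + ?X"
      using is_torus_lift_lattice[OF assms, of "?c v" 0] by simp
    have "homotopic_paths UNIV (f \<circ> torus_loop 0 v) (torus_loop (f 0) w) \<longleftrightarrow> F (?c v) - (F 0 + ?c w) = 0"
      unfolding 1 2 homotopic_paths_torus_exp_iff[OF paths] by (simp add: pathstart_def pathfinish_def)
    also have "\<dots> \<longleftrightarrow> ?c w = ?X"
      unfolding X by auto
    also have "\<dots> \<longleftrightarrow> real_of_int (vec_nth w 1) = of_int (p * vec_nth v 1 + r * vec_nth v 2) \<and>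
      real_of_int (vec_nth w 2) = of_int (q * vec_nth v 1 + s * vec_nth v 2)"
      by (simp add: complex_eq_iff algebra_simps)
    also have "\<dots> \<longleftrightarrow> w = ?M *v v"
      unfolding of_int_eq_iff by (simp add: vec_eq_iff forall_2 matrix_vector_mult_def sum_2)
    finally show ?thesis .
  qed
  show ?thesis
    unfolding pi1_matrix_def iff
  proof (rule the_equality)
    fix M assume M: "\<forall>v. M *v v = ?M *v v"
    show "M = ?M"
      unfolding vec_eq_iff
    proof (intro allI)
      fix i j
      have "vec_nth (vec_nth A i) j = vec_nth (A *v axis j 1) i" for A :: "int ^ 2 ^ 2"
        by (simp add: matrix_vector_mult_def axis_def if_distrib cong: if_cong)
      then show "vec_nth (vec_nth M i) j = vec_nth (vec_nth ?M i) j"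
        using M by metis
    qed
  qed simp
qed

section \<open>Coincidences in terms of lifts\<close>

lemma torus_log_torus_exp:
  assumes "norm z < 1/2"
  shows "torus_log (torus_exp z) = z"
proof -
  have z: "\<bar>Re z\<bar> < 1/2" "\<bar>Im z\<bar> < 1/2"
    using assms abs_Re_le_cmod[of z] abs_Im_le_cmod[of z] by linarith+
  show ?thesis
    unfolding torus_log_def
  proof (rule the_equality)
    fix w assume w: "Re w \<in> {-1/2..<1/2} \<and> Im w \<in> {-1/2..<1/2} \<and> torus_exp w = torus_exp z"
    then have "Re w - Re z \<in> \<int>" "Im w - Im z \<in> \<int>"
      by (auto simp: torus_exp_eq_iff lattice_def)
    moreover have "\<bar>Re w - Re z\<bar> < 1" "\<bar>Im w - Im z\<bar> < 1"
      using w z by auto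
    ultimately show "w = z"
      using Ints_nonzero_abs_less1 by (metis complex_eq_iff eq_iff_diff_eq_0)
  qed (use z in auto)
qed

lemma local_degree_translate: "local_degree (\<lambda>w. F (z + w)) 0 = local_degree F z"
proof -
  have "(\<lambda>w. F (z + w)) \<circ> circlepath 0 r = F \<circ> circlepath z r" for r
    by (simp add: fun_eq_iff circlepath)
  then show ?thesis
    by (simp add: local_degree_def)
qed

lemma finite_lattice_cball: "finite {v \<in> lattice. norm v \<le> R}"
proof (rule finite_subset)
  let ?N = "{- \<lceil>R\<rceil>..\<lceil>R\<rceil>}"
  show "{v \<in> lattice. norm v \<le> R} \<subseteq> (\<lambda>(k, l). Complex (of_int k) (of_int l)) ` (?N \<times> ?N)"
  proof
    fix v assume v: "v \<in> {v \<in> lattice. norm v \<le> R}"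
    then obtain k l where kl: "Re v = of_int k" "Im v = of_int l"
      by (auto simp: lattice_def elim!: Ints_cases)
    have "\<bar>real_of_int k\<bar> \<le> R" "\<bar>real_of_int l\<bar> \<le> R"
      using v abs_Re_le_cmod[of v] abs_Im_le_cmod[of v] kl by auto
    then have "k \<in> ?N" "l \<in> ?N"
      by (auto simp: abs_le_iff) linarith+
    moreover have "v = Complex (of_int k) (of_int l)"
      by (simp add: complex_eq_iff kl)
    ultimately show "v \<in> (\<lambda>(k, l). Complex (of_int k) (of_int l)) ` (?N \<times> ?N)"
      by auto
  qed
qed auto

lemma finite_torus_exp_vimage_cball:
  assumes "finite D"
  shows "finite {z \<in> cball 0 R. torus_exp z \<in> D}"
proof -
  have "finite {z \<in> cball 0 R. torus_exp z = p}" for p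
  proof -
    obtain z0 where z0: "torus_exp z0 = p" using torus_exp_surj by blast
    have "{z \<in> cball 0 R. torus_exp z = p} \<subseteq> (+) z0 ` {v \<in> lattice. norm v \<le> R + norm z0}"
    proof
      fix z assume z: "z \<in> {z \<in> cball 0 R. torus_exp z = p}"
      then have "z - z0 \<in> lattice" using z0 by (auto simp: torus_exp_eq_iff[symmetric])
      moreover have "norm (z - z0) \<le> R + norm z0"
        using z norm_triangle_ineq4[of z z0] by auto
      ultimately show "z \<in> (+) z0 ` {v \<in> lattice. norm v \<le> R + norm z0}"
        by (intro image_eqI[of _ _ "z - z0"]) auto
    qed
    then show ?thesis
      using finite_lattice_cball finite_subset by blast
  qed
  moreover have "{z \<in> cball 0 R. torus_exp z \<in> D} = (\<Union>p\<in>D. {z \<in> cball 0 R. torus_exp z = p})"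
    by auto
  ultimately show ?thesis
    using assms by simp
qed

lemma lattice_translate_into_cell:
  obtains v where "v \<in> lattice" "Re a \<le> Re (z + v)" "Re (z + v) < Re a + 1"
    "Im a \<le> Im (z + v)" "Im (z + v) < Im a + 1"
proof
  let ?v = "Complex (- of_int \<lfloor>Re z - Re a\<rfloor>) (- of_int \<lfloor>Im z - Im a\<rfloor>)"
  show "?v \<in> lattice" by (simp add: lattice_def)
  show "Re a \<le> Re (z + ?v)" "Re (z + ?v) < Re a + 1" "Im a \<le> Im (z + ?v)" "Im (z + ?v) < Im a + 1"
    using floor_correct[of "Re z - Re a"] floor_correct[of "Im z - Im a"] unfolding plus_complex.sel complex.sel
    by linarith+
qed

lemma lattice_small_eq:
  assumes "z - w \<in> lattice" "\<bar>Re z - Re w\<bar> < 1" "\<bar>Im z - Im w\<bar> < 1"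
  shows "z = w"
proof -
  have "Re z - Re w = 0" "Im z - Im w = 0"
    using assms Ints_nonzero_abs_less1[of "Re z - Re w"] Ints_nonzero_abs_less1[of "Im z - Im w"]
    by (auto simp: lattice_def)
  then show ?thesis by (simp add: complex_eq_iff)
qed

text \<open>No point of the invariant set lies on the grid through \<open>a\<close>, so the open
  unit cell contains exactly one lift of each point of its projection.\<close>

lemma bij_betw_torus_exp_cell:
  assumes per: "\<And>z v. z \<in> A \<Longrightarrow> v \<in> lattice \<Longrightarrow> z + v \<in> A"
    and bd: "\<And>z. z \<in> A \<Longrightarrow> Re z \<noteq> Re a \<and> Im z \<noteq> Im a"
  shows "bij_betw torus_exp {z \<in> box a (a + Complex 1 1). z \<in> A} (torus_exp ` A)"
  unfolding bij_betw_def
proof (intro conjI equalityI subsetI)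
  show "inj_on torus_exp {z \<in> box a (a + Complex 1 1). z \<in> A}"
    by (rule inj_onI, rule lattice_small_eq) (auto simp: torus_exp_eq_iff[symmetric] in_box_complex_iff)
  fix p assume "p \<in> torus_exp ` A"
  then obtain z where z: "z \<in> A" "p = torus_exp z" by auto
  obtain v where v: "v \<in> lattice" "Re a \<le> Re (z + v)" "Re (z + v) < Re a + 1"
    "Im a \<le> Im (z + v)" "Im (z + v) < Im a + 1"
    using lattice_translate_into_cell by blast
  have "z + v \<in> box a (a + Complex 1 1)"
    using v bd[OF per[OF z(1) v(1)]] by (auto simp: in_box_complex_iff)
  moreover have "torus_exp (z + v) = p"
    using v(1) z(2) by (simp add: torus_exp_eq_iff)
  ultimately show "p \<in> torus_exp ` {z \<in> box a (a + Complex 1 1). z \<in> A}"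
    using per[OF z(1) v(1)] by (intro image_eqI[of _ _ "z + v"]) auto
qed auto

text \<open>A countable set has countable projections to both axes. This is how cell boundaries are
  kept off the zeros.\<close>

lemma countable_avoid_lines:
  fixes A :: "complex set"
  assumes "countable A"
  obtains a where "\<And>z. z \<in> A \<Longrightarrow> Re z \<noteq> Re a \<and> Im z \<noteq> Im a"
proof -
  have "\<exists>x::real. x \<notin> P ` A" for P
  proof -
    have "countable (P ` A)" using assms by simp
    then have "P ` A \<noteq> UNIV" using uncountable_UNIV_real by metis
    then show ?thesis by blast
  qed
  then obtain x y where "x \<notin> Re ` A" "y \<notin> Im ` A" by metis
  then show ?thesis
    by (intro that[of "Complex x y"]) auto
qed

lemma local_degree_neg_cnj: "local_degree (\<lambda>z. - cnj z) 0 = -1"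
  and winding_number_reflected_circlepath:
    "0 < r \<Longrightarrow> winding_number ((\<lambda>z. - cnj z + c) \<circ> circlepath z r) (- cnj z + c) = -1"
proof -
  show refl: "winding_number ((\<lambda>z. - cnj z + c) \<circ> circlepath z r) (- cnj z + c) = -1" if "0 < r" for c z r
  proof -
    \<comment> \<open>A logarithm of the reflected circle -r exp(-2 pi i t): the term pi i produces
      the sign, and the angle runs clockwise.\<close>
    let ?q = "\<lambda>t. of_real (ln r) + of_real pi * \<i> - 2 * of_real pi * \<i> * of_real t"
    have "path ?q"
      unfolding path_def by (intro continuous_intros)
    then have "winding_number (\<lambda>t. ((\<lambda>z. - cnj z + c) \<circ> circlepath z r) t - (- cnj z + c)) 0 =
        (pathfinish ?q - pathstart ?q) / (2 * of_real pi * \<i>)"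
    proof (rule winding_number_exp)
      fix t :: real
      have "exp (?q t) = of_real r * (- 1) * exp (- (2 * of_real pi * \<i> * of_real t))"
        using that by (simp add: exp_diff exp_add exp_of_real exp_minus divide_inverse)
      then show "((\<lambda>z. - cnj z + c) \<circ> circlepath z r) t - (- cnj z + c) = exp (?q t)"
        by (simp add: circlepath exp_cnj)
    qed
    also have "\<dots> = -1"
      by (simp add: pathfinish_def pathstart_def)
    finally show ?thesis
      by (subst winding_number_offset)
  qed
  have "of_int (local_degree (\<lambda>z. - cnj z) 0) = winding_number ((\<lambda>z. - cnj z) \<circ> circlepath 0 1) 0"
    by (rule local_degree_eqI[symmetric]) (auto intro!: continuous_intros)
  also have "\<dots> = -1"
    using refl[of 1 0 0] by simp
  finally show "local_degree (\<lambda>z. - cnj z) 0 = -1"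
    using of_int_eq_iff[of "local_degree (\<lambda>z. - cnj z) 0" "-1", where 'a = complex] by simp
qed

lemma tau1_torus_exp: "\<tau>\<^sub>1 (torus_exp z) = torus_exp (z + 1/2)"
  by (simp add: torus_exp_def tau1.abs_eq)

lemma tau2_torus_exp: "\<tau>\<^sub>2 (torus_exp z) = torus_exp (- cnj z + \<i>/2)"
  by (simp add: torus_exp_def tau2.abs_eq add.commute)

text \<open>Preserving norms keeps small vectors inside the branch of \<open>torus_log\<close>, so
  near 0 the chart expression is \<open>l\<close> itself.\<close>

lemma torus_local_degree_linear:
  assumes "\<And>c z. h (c + torus_exp z) - h c = torus_exp (l z)" "\<And>z. norm (l z) = norm z"
  shows "torus_local_degree h c = local_degree l 0"
  unfolding torus_local_degree_def assms(1)
proof (rule local_degree_cong)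
  show "\<forall>\<^sub>F w in nhds 0. torus_log (torus_exp (l w)) = l w"
    unfolding eventually_nhds_metric
    by (intro exI[of _ "1/2"]) (auto simp: assms(2) intro!: torus_log_torus_exp)
qed

lemma reverses_orientation_tau2: "reverses_orientation \<tau>\<^sub>2"
  unfolding reverses_orientation_def
proof
  fix c
  have "\<tau>\<^sub>2 (c + torus_exp z) - \<tau>\<^sub>2 c = torus_exp (- cnj z)" for c z
  proof -
    obtain w where "torus_exp w = c" using torus_exp_surj by blast
    then show ?thesis
      by (auto simp: tau2_torus_exp torus_exp_add[symmetric] torus_exp_diff[symmetric])
  qed
  then have "torus_local_degree \<tau>\<^sub>2 c = local_degree (\<lambda>z. - cnj z) 0"
    by (rule torus_local_degree_linear) simp
  then show "torus_local_degree \<tau>\<^sub>2 c = -1"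
    by (simp add: local_degree_neg_cnj)
qed

lemma not_reverses_orientation_tau1: "\<not> reverses_orientation \<tau>\<^sub>1"
proof -
  have "\<tau>\<^sub>1 (c + torus_exp z) - \<tau>\<^sub>1 c = torus_exp z" for c z
  proof -
    obtain w where "torus_exp w = c" using torus_exp_surj by blast
    then show ?thesis
      by (auto simp: tau1_torus_exp torus_exp_add[symmetric] torus_exp_diff[symmetric])
  qed
  then have "torus_local_degree \<tau>\<^sub>1 c = local_degree (\<lambda>z. z) 0" for c
    by (rule torus_local_degree_linear) simp
  moreover have "of_int (local_degree (\<lambda>z. z) 0) = winding_number ((\<lambda>z. z) \<circ> circlepath 0 1) 0"
    by (rule local_degree_eqI[symmetric]) (auto intro!: continuous_intros)
  then have "of_int (local_degree (\<lambda>z. z) 0) = (1::complex)"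
    by (simp add: o_def winding_number_circlepath_centre)
  then have "local_degree (\<lambda>z. z) 0 = 1"
    using of_int_eq_1_iff by blast
  ultimately show ?thesis
    by (simp add: reverses_orientation_def)
qed

text \<open>
  Both involutions are treated at once: \<open>\<mu> = 0\<close> and \<open>\<nu>\<close> is the first column of the matrix of \<open>g\<close>
  for \<open>\<tau>\<^sub>1\<close>, while \<open>\<mu>\<close> and \<open>\<nu>\<close> are the two columns for \<open>\<tau>\<^sub>2\<close>.
\<close>

locale coincidence_lift =
  fixes g \<tau> :: "torus \<Rightarrow> torus" and G \<sigma> \<Phi> :: "complex \<Rightarrow> complex" and \<mu> \<nu> :: complex
  assumes continuous_G: "continuous_on UNIV G" and continuous_\<sigma>: "continuous_on UNIV \<sigma>"
    and g_torus_exp: "g (torus_exp z) = torus_exp (G z)"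
    and \<tau>_torus_exp: "\<tau> (torus_exp z) = torus_exp (\<sigma> z)"
    and \<tau>_\<tau>: "\<tau> (\<tau> x) = x"
    and \<Phi>_eq: "\<Phi> z = G z - G (\<sigma> z)"
    and \<mu>_lattice: "\<mu> \<in> lattice" and \<nu>_lattice: "\<nu> \<in> lattice"
    and \<Phi>_shift: "v \<in> lattice \<Longrightarrow> \<Phi> (z + v) = \<Phi> z + 2 * of_real (Re v) * \<mu>"
    and \<Phi>_\<sigma>: "\<Phi> (\<sigma> z) = - \<Phi> z - \<nu>"
    and finite_Coin: "finite (Coin g (g \<circ> \<tau>))"
begin

lemma continuous_\<Phi>: "continuous_on UNIV \<Phi>"
proof -
  have "continuous_on UNIV (\<lambda>z. G z - G (\<sigma> z))"
    by (intro continuous_on_diff continuous_G continuous_on_compose2[OF continuous_G continuous_\<sigma>]) auto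
  then show ?thesis
    by (simp add: \<Phi>_eq[abs_def])
qed

lemma torus_exp_in_Coin_iff: "torus_exp z \<in> Coin g (g \<circ> \<tau>) \<longleftrightarrow> \<Phi> z \<in> lattice"
  by (simp add: Coin_def g_torus_exp \<tau>_torus_exp torus_exp_eq_iff \<Phi>_eq)

text \<open>The value of \<Phi> at a point of the torus is defined only up to these shifts, which
  come from the choice of a lift; for \<mu> = 0 the relation is equality.\<close>

definition congr :: "complex \<Rightarrow> complex \<Rightarrow> bool" where
  "congr u w \<longleftrightarrow> (\<exists>k::int. u = w + 2 * of_int k * \<mu>)"

lemma congr_refl: "congr u u"
  unfolding congr_def by (rule exI[of _ 0]) simp

lemma congr_sym:
  assumes "congr u w"
  shows "congr w u"
proof -
  obtain k :: int where "u = w + 2 * of_int k * \<mu>"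
    using assms by (auto simp: congr_def)
  then have "w = u + 2 * of_int (- k) * \<mu>" by simp
  then show ?thesis unfolding congr_def by blast
qed

lemma congr_trans:
  assumes "congr u w" "congr w x"
  shows "congr u x"
proof -
  obtain k l :: int where "u = w + 2 * of_int k * \<mu>" "w = x + 2 * of_int l * \<mu>"
    using assms by (auto simp: congr_def)
  then have "u = x + 2 * of_int (k + l) * \<mu>" by (simp add: algebra_simps)
  then show ?thesis unfolding congr_def by blast
qed

text \<open>The map u -> -u - \<nu> is the effect of \<sigma> on the values of \<Phi>.\<close>

lemma congr_reflect: "congr u w \<Longrightarrow> congr (- u - \<nu>) (- w - \<nu>)"
proof -
  assume "congr u w"
  then obtain k :: int where "u = w + 2 * of_int k * \<mu>" by (auto simp: congr_def)
  then have "- u - \<nu> = - w - \<nu> + 2 * of_int (- k) * \<mu>" by simp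
  then show ?thesis unfolding congr_def by blast
qed

lemma congr_lattice: "congr u w \<Longrightarrow> w \<in> lattice \<Longrightarrow> u \<in> lattice"
proof -
  assume "congr u w" and w: "w \<in> lattice"
  then obtain k :: int where "u = w + of_int (2 * k) * \<mu>" by (auto simp: congr_def)
  then show ?thesis using w \<mu>_lattice lattice_add lattice_mult lattice_simps(4) by metis
qed

lemma congr_shift: "v \<in> lattice \<Longrightarrow> congr (\<Phi> (z + v)) (\<Phi> z)"
  using \<Phi>_shift[of v z] unfolding congr_def lattice_def by (auto elim!: Ints_cases)

lemma congr_torus_exp_eq: "torus_exp z = torus_exp z' \<Longrightarrow> congr (\<Phi> z) (\<Phi> z')"
  using congr_shift[of "z - z'" z'] by (simp add: torus_exp_eq_iff)

text \<open>For a lifted path c, the two image paths are homotopic rel endpoints exactly when \<Phi>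
  takes the same lattice value at both ends of c. Other lifts of the ends change \<Phi> by multiples
  of 2\<mu>.\<close>

lemma Nielsen_related_iff:
  assumes "\<Phi> a \<in> lattice" "\<Phi> b \<in> lattice"
  shows "Nielsen_related g (g \<circ> \<tau>) (torus_exp a) (torus_exp b) \<longleftrightarrow> congr (\<Phi> a) (\<Phi> b)"
proof
  assume "Nielsen_related g (g \<circ> \<tau>) (torus_exp a) (torus_exp b)"
  then obtain \<gamma> where \<gamma>: "path \<gamma>" "\<gamma> 0 = torus_exp a" "\<gamma> 1 = torus_exp b"
    "homotopic_paths UNIV (g \<circ> \<gamma>) (g \<circ> \<tau> \<circ> \<gamma>)"
    by (auto simp: Nielsen_related_def pathstart_def pathfinish_def)
  have "contractible {0..1::real}" by (intro convex_imp_contractible) auto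
  then obtain c where c: "continuous_on {0..1} c" "\<And>t. t \<in> {0..1} \<Longrightarrow> \<gamma> t = torus_exp (c t)"
    using lift_to_plane \<gamma>(1) unfolding path_def by blast
  have paths: "path (G \<circ> c)" "path (G \<circ> \<sigma> \<circ> c)"
    using c(1) unfolding path_def o_def
    by (auto intro!: continuous_on_compose2[OF continuous_G] continuous_on_compose2[OF continuous_\<sigma>])
  have lifted: "path (torus_exp \<circ> (G \<circ> c))" "path (torus_exp \<circ> (G \<circ> \<sigma> \<circ> c))"
    using paths continuous_on_torus_exp continuous_on_subset by (auto intro!: path_continuous_image)
  have "homotopic_paths UNIV (torus_exp \<circ> (G \<circ> c)) (g \<circ> \<gamma>)"
    by (rule homotopic_paths_eq) (use lifted c(2) g_torus_exp in auto)
  moreover have "homotopic_paths UNIV (torus_exp \<circ> (G \<circ> \<sigma> \<circ> c)) (g \<circ> \<tau> \<circ> \<gamma>)"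
    by (rule homotopic_paths_eq) (use lifted c(2) g_torus_exp \<tau>_torus_exp in auto)
  ultimately have "homotopic_paths UNIV (torus_exp \<circ> (G \<circ> c)) (torus_exp \<circ> (G \<circ> \<sigma> \<circ> c))"
    using \<gamma>(4) homotopic_paths_sym homotopic_paths_trans by blast
  then have "\<Phi> (c 1) = \<Phi> (c 0)"
    by (simp add: homotopic_paths_torus_exp_iff[OF paths] pathstart_def pathfinish_def \<Phi>_eq)
  moreover have "congr (\<Phi> a) (\<Phi> (c 0))" "congr (\<Phi> b) (\<Phi> (c 1))"
    using \<gamma>(2,3) c(2)[of 0] c(2)[of 1] by (auto intro!: congr_torus_exp_eq)
  ultimately show "congr (\<Phi> a) (\<Phi> b)"
    using congr_sym congr_trans by metis
next
  assume "congr (\<Phi> a) (\<Phi> b)"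
  then obtain k :: int where k: "\<Phi> a = \<Phi> b + 2 * of_int k * \<mu>" by (auto simp: congr_def)
  \<comment> \<open>Moving b by k units along the first circle adds 2k\<mu> to \<Phi>, so that a
    straight segment works.\<close>
  define b' where "b' = b + of_int k"
  have b': "\<Phi> b' = \<Phi> a" "torus_exp b' = torus_exp b"
    using \<Phi>_shift[of "of_int k" b] k by (auto simp: b'_def torus_exp_eq_iff)
  let ?c = "linepath a b'"
  have paths: "path (G \<circ> ?c)" "path (G \<circ> \<sigma> \<circ> ?c)"
    unfolding path_def o_def using continuous_on_linepath[of UNIV]
    by (auto intro!: continuous_on_compose2[OF continuous_G] continuous_on_compose2[OF continuous_\<sigma>]
        continuous_on_linepath)
  have "homotopic_paths UNIV (torus_exp \<circ> (G \<circ> ?c)) (torus_exp \<circ> (G \<circ> \<sigma> \<circ> ?c))"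
    unfolding homotopic_paths_torus_exp_iff[OF paths]
    using assms(1) b'(1) by (simp add: pathstart_compose pathfinish_compose \<Phi>_eq)
  moreover have "torus_exp \<circ> (G \<circ> ?c) = g \<circ> (torus_exp \<circ> ?c)"
    "torus_exp \<circ> (G \<circ> \<sigma> \<circ> ?c) = g \<circ> \<tau> \<circ> (torus_exp \<circ> ?c)"
    by (auto simp: fun_eq_iff g_torus_exp \<tau>_torus_exp)
  moreover have "path (torus_exp \<circ> ?c)"
    using continuous_on_torus_exp continuous_on_subset by (intro path_continuous_image) auto
  ultimately show "Nielsen_related g (g \<circ> \<tau>) (torus_exp a) (torus_exp b)"
    unfolding Nielsen_related_def using b'(2)
    by (intro exI[of _ "torus_exp \<circ> ?c"]) (simp add: pathstart_compose pathfinish_compose)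
qed

lemma finite_coincidences_cball: "finite {z \<in> cball 0 R. \<Phi> z \<in> lattice}"
  using finite_torus_exp_vimage_cball[OF finite_Coin, of R] by (simp add: torus_exp_in_Coin_iff)

lemma isolated_coincidence:
  assumes "\<Phi> z \<in> lattice"
  obtains r where "0 < r" "\<And>x. x \<in> ball z r - {z} \<Longrightarrow> \<Phi> x \<notin> lattice"
proof -
  define S where "S = ball z 1 - ({x \<in> cball 0 (norm z + 1). \<Phi> x \<in> lattice} - {z})"
  have "open S" "z \<in> S"
    unfolding S_def using finite_coincidences_cball by (auto intro!: open_Diff finite_imp_closed)
  then obtain r where r: "r > 0" "ball z r \<subseteq> S"
    using open_contains_ball by metis
  have "\<Phi> x \<notin> lattice" if x: "x \<in> ball z r - {z}" for x
  proof
    assume "\<Phi> x \<in> lattice"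
    moreover have "x \<in> S" using x r(2) by auto
    moreover have "norm x \<le> norm z + 1"
      using \<open>x \<in> S\<close> norm_triangle_ineq2[of x z] by (auto simp: S_def dist_norm norm_minus_commute)
    ultimately show False using x by (auto simp: S_def)
  qed
  with r(1) show ?thesis by (rule that)
qed

definition deg :: "complex \<Rightarrow> int" where
  "deg z = local_degree (\<lambda>x. \<Phi> x - \<Phi> z) z"

lemma coin_index_torus_exp: "coin_index g (g \<circ> \<tau>) (torus_exp z) = deg z"
proof -
  have d: "g (torus_exp z) - (g \<circ> \<tau>) (torus_exp z) = torus_exp (\<Phi> z)" for z
    by (simp add: g_torus_exp \<tau>_torus_exp \<Phi>_eq torus_exp_diff)
  have "coin_index g (g \<circ> \<tau>) (torus_exp z) =
      local_degree (\<lambda>w. torus_log (torus_exp (\<Phi> (z + w) - \<Phi> z))) 0"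
    unfolding coin_index_def torus_local_degree_def torus_exp_add[symmetric] d torus_exp_diff[symmetric] ..
  also have "\<dots> = local_degree (\<lambda>w. \<Phi> (z + w) - \<Phi> z) 0"
  proof (rule local_degree_cong)
    have "continuous_on UNIV (\<lambda>w. \<Phi> (w + z) - \<Phi> z)"
      using continuous_on_translate[OF continuous_\<Phi>, of z] by (rule continuous_on_diff) simp
    then have "isCont (\<lambda>w. \<Phi> (z + w) - \<Phi> z) 0"
      by (simp add: continuous_on_eq_continuous_at add.commute)
    then have "((\<lambda>w. \<Phi> (z + w) - \<Phi> z) \<longlongrightarrow> 0) (nhds 0)"
      using tendsto_at_iff_tendsto_nhds[of "\<lambda>w. \<Phi> (z + w) - \<Phi> z" 0] by (simp add: isCont_def)
    then have "\<forall>\<^sub>F w in nhds 0. dist (\<Phi> (z + w) - \<Phi> z) 0 < 1/2"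
      by (rule tendstoD) simp
    then show "\<forall>\<^sub>F w in nhds 0. torus_log (torus_exp (\<Phi> (z + w) - \<Phi> z)) = \<Phi> (z + w) - \<Phi> z"
      by eventually_elim (simp add: torus_log_torus_exp)
  qed
  also have "\<dots> = deg z"
    using local_degree_translate[of "\<lambda>x. \<Phi> x - \<Phi> z" z] by (simp add: deg_def)
  finally show ?thesis .
qed

text \<open>The function exp(pi i x / \<mu>) has the multiples of 2\<mu> as periods, so one zero set
  collects a whole residue class. For \<mu> = 0 congruence is equality and \<Phi> is already doubly
  periodic.\<close>

definition \<Psi> :: "complex \<Rightarrow> complex \<Rightarrow> complex" where
  "\<Psi> w z = (if \<mu> = 0 then \<Phi> z - w else exp (of_real pi * \<i> * (\<Phi> z - w) / \<mu>) - 1)"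

lemma continuous_\<Psi>: "continuous_on UNIV (\<Psi> w)"
  unfolding \<Psi>_def using continuous_\<Phi> by (cases "\<mu> = 0") (auto intro!: continuous_intros)

lemma \<Psi>_eq_0_iff: "\<Psi> w z = 0 \<longleftrightarrow> congr (\<Phi> z) w"
proof (cases "\<mu> = 0")
  case True
  show ?thesis unfolding \<Psi>_def congr_def using True by simp
next
  case False
  have "\<Psi> w z = 0 \<longleftrightarrow> exp (of_real pi * \<i> * (\<Phi> z - w) / \<mu>) = exp 0"
    using False by (simp add: \<Psi>_def)
  also have "\<dots> \<longleftrightarrow> (\<exists>k::int. of_real pi * \<i> * (\<Phi> z - w) / \<mu> = 0 + of_real (of_int (2 * k) * pi) * \<i>)"
    by (rule exp_eq)
  also have "\<dots> \<longleftrightarrow> congr (\<Phi> z) w"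
  proof -
    have "of_real pi * \<i> * (\<Phi> z - w) / \<mu> = 0 + of_real (of_int (2 * k) * pi) * \<i> \<longleftrightarrow>
        \<Phi> z = w + 2 * of_int k * \<mu>" for k :: int
    proof -
      have "of_real pi * \<i> * (\<Phi> z - w) / \<mu> = 0 + of_real (of_int (2 * k) * pi) * \<i> \<longleftrightarrow>
         (of_real pi * \<i>) * (\<Phi> z - w) = (of_real pi * \<i>) * (2 * of_int k * \<mu>)"
        using False by (simp add: divide_eq_eq mult_ac)
      also have "\<dots> \<longleftrightarrow> \<Phi> z - w = 2 * of_int k * \<mu>"
        by (subst mult_cancel_left) simp
      finally show ?thesis by (auto simp: diff_eq_eq add.commute)
    qed
    then show ?thesis by (simp add: congr_def)
  qed
  finally show ?thesis .
qed

lemma \<Psi>_shift: "v \<in> lattice \<Longrightarrow> \<Psi> w (z + v) = \<Psi> w z"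
proof -
  assume v: "v \<in> lattice"
  then obtain k :: int where k: "Re v = of_int k" by (auto simp: lattice_def elim!: Ints_cases)
  have "exp (of_real pi * \<i> * (\<Phi> (z + v) - w) / \<mu>) = exp (of_real pi * \<i> * (\<Phi> z - w) / \<mu>)" if "\<mu> \<noteq> 0"
  proof -
    have "\<Phi> (z + v) - w = (\<Phi> z - w) + of_int (2 * k) * \<mu>"
      by (simp add: \<Phi>_shift[OF v] k)
    then have "of_real pi * \<i> * (\<Phi> (z + v) - w) / \<mu> =
        of_real pi * \<i> * (\<Phi> z - w) / \<mu> + of_real pi * \<i> * (of_int (2 * k) * \<mu>) / \<mu>"
      by (simp only: distrib_left add_divide_distrib)
    also have "of_real pi * \<i> * (of_int (2 * k) * \<mu>) / \<mu> = of_real (of_int (2 * k) * pi) * \<i>"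
      using that by simp
    finally have "of_real pi * \<i> * (\<Phi> (z + v) - w) / \<mu> =
        of_real pi * \<i> * (\<Phi> z - w) / \<mu> + of_real (of_int (2 * k) * pi) * \<i>" .
    then show ?thesis using exp_eq by blast
  qed
  then show ?thesis using \<Phi>_shift[OF v, of z] by (simp add: \<Psi>_def)
qed

text \<open>If \<mu> is nonzero, periodicity replaces w by \<Phi> z, and exp(c x) - 1 is x times a
  continuous function whose value at 0 is the derivative c. This factor is nonzero at x = 0 and
  leaves the local degree unchanged.\<close>

lemma local_degree_\<Psi>:
  assumes "w \<in> lattice" "congr (\<Phi> z) w"
  shows "local_degree (\<Psi> w) z = deg z"
proof (cases "\<mu> = 0")
  case True
  then have "\<Phi> z = w"
    using assms(2) unfolding congr_def by simp
  then have "\<Psi> w = (\<lambda>x. \<Phi> x - \<Phi> z)"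
    unfolding \<Psi>_def[abs_def] using True by simp
  then show ?thesis
    unfolding deg_def by simp
next
  case False
  define c where "c = of_real pi * \<i> / \<mu>"
  define k where "k = (\<lambda>\<zeta>. if \<zeta> = 0 then c else (exp (c * \<zeta>) - 1) / \<zeta>)"
  have c0: "c \<noteq> 0" using False by (simp add: c_def)
  have "continuous_on UNIV k"
    unfolding continuous_on_eq_continuous_at[OF open_UNIV]
  proof
    fix x :: complex
    show "isCont k x"
    proof (cases "x = 0")
      case True
      have "((\<lambda>\<zeta>. exp (c * \<zeta>)) has_field_derivative c) (at 0)"
        by (auto intro!: derivative_eq_intros)
      then have "((\<lambda>\<zeta>. (exp (c * \<zeta>) - 1) / \<zeta>) \<longlongrightarrow> c) (at 0)"
        by (simp add: has_field_derivative_iff)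
      then have "(k \<longlongrightarrow> c) (at 0)"
        by (rule Lim_transform_eventually) (auto simp: k_def eventually_at_filter)
      then show ?thesis
        using True by (simp add: isCont_def k_def)
    next
      case False
      then have "\<forall>\<^sub>F \<zeta> in nhds x. \<zeta> \<noteq> 0"
        by (rule t1_space_nhds)
      then have "\<forall>\<^sub>F \<zeta> in nhds x. k \<zeta> = (exp (c * \<zeta>) - 1) / \<zeta>"
        by eventually_elim (simp add: k_def)
      moreover have "isCont (\<lambda>\<zeta>. (exp (c * \<zeta>) - 1) / \<zeta>) x"
        using False by (intro continuous_intros)
      ultimately show ?thesis
        by (simp add: isCont_cong)
    qed
  qed
  moreover have "continuous_on UNIV (\<lambda>x. \<Phi> x - \<Phi> z)"
    using continuous_\<Phi> by (intro continuous_intros)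
  ultimately have contK: "continuous_on UNIV (\<lambda>x. k (\<Phi> x - \<Phi> z))"
    by (rule continuous_on_compose2) auto
  obtain n :: int where n: "\<Phi> z = w + 2 * of_int n * \<mu>" using assms(2) by (auto simp: congr_def)
  have lat: "\<Phi> z \<in> lattice" using assms congr_lattice by blast
  have "\<Psi> w x = (\<Phi> x - \<Phi> z) * k (\<Phi> x - \<Phi> z)" for x
  proof -
    have "\<Phi> x - w = (\<Phi> x - \<Phi> z) + of_int (2 * n) * \<mu>"
      by (simp add: n)
    then have "of_real pi * \<i> * (\<Phi> x - w) / \<mu> =
        of_real pi * \<i> * (\<Phi> x - \<Phi> z) / \<mu> + of_real pi * \<i> * (of_int (2 * n) * \<mu>) / \<mu>"
      by (simp only: distrib_left add_divide_distrib)
    then have "of_real pi * \<i> * (\<Phi> x - w) / \<mu> = c * (\<Phi> x - \<Phi> z) + of_real (of_int (2 * n) * pi) * \<i>"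
      using False by (simp add: c_def)
    then have "exp (of_real pi * \<i> * (\<Phi> x - w) / \<mu>) = exp (c * (\<Phi> x - \<Phi> z))"
      using exp_eq by blast
    then show ?thesis using False by (simp add: \<Psi>_def k_def)
  qed
  then have "local_degree (\<Psi> w) z = local_degree (\<lambda>x. (\<Phi> x - \<Phi> z) * k (\<Phi> x - \<Phi> z)) z"
    by (intro arg_cong[where f = "\<lambda>F. local_degree F z"] ext)
  also have "\<dots> = deg z"
    unfolding deg_def
  proof -
    obtain r where r: "0 < r" "\<And>x. x \<in> ball z r - {z} \<Longrightarrow> \<Phi> x \<notin> lattice"
      using isolated_coincidence[OF lat] by blast
    show "local_degree (\<lambda>x. (\<Phi> x - \<Phi> z) * k (\<Phi> x - \<Phi> z)) z = local_degree (\<lambda>x. \<Phi> x - \<Phi> z) z"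
    proof (rule local_degree_mult[where S = "ball z r"])
      show "continuous_on (ball z r) (\<lambda>x. k (\<Phi> x - \<Phi> z))"
        using contK continuous_on_subset by blast
      show "continuous_on (ball z r) (\<lambda>x. \<Phi> x - \<Phi> z)"
        using continuous_\<Phi> by (intro continuous_intros) (auto intro: continuous_on_subset)
      show "\<Phi> x - \<Phi> z \<noteq> 0" if "x \<in> ball z r - {z}" for x
        using r(2)[OF that] lat by auto
    qed (use r c0 in \<open>auto simp: k_def\<close>)
  qed
  finally show ?thesis .
qed

definition cls :: "complex \<Rightarrow> complex set" where
  "cls w = {z. congr (\<Phi> z) w}"

lemma cls_cong:
  assumes "congr u w"
  shows "cls u = cls w"
  using congr_trans[OF _ assms] congr_trans[OF _ congr_sym[OF assms]] by (auto simp: cls_def)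

lemma cls_shift: "z \<in> cls w \<Longrightarrow> v \<in> lattice \<Longrightarrow> z + v \<in> cls w"
  by (auto simp: cls_def intro: congr_trans[OF congr_shift])

lemma finite_cls_cball:
  assumes "w \<in> lattice"
  shows "finite {z \<in> cball 0 R. \<Psi> w z = 0}"
  by (rule finite_subset[OF _ finite_coincidences_cball[of R]])
     (use assms congr_lattice in \<open>auto simp: \<Psi>_eq_0_iff\<close>)

lemma cls_avoid_lines:
  assumes "w \<in> lattice"
  obtains a where "\<And>z. z \<in> cls w \<Longrightarrow> Re z \<noteq> Re a \<and> Im z \<noteq> Im a"
proof -
  have "cls w = (\<Union>n::nat. {z \<in> cball 0 (of_nat n). \<Psi> w z = 0})"
    using real_arch_simple by (auto simp: \<Psi>_eq_0_iff cls_def)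
  moreover have "countable (\<Union>n::nat. {z \<in> cball 0 (of_nat n). \<Psi> w z = 0})"
    by (intro countable_UN countable_finite finite_cls_cball assms countableI_type)
  ultimately have "countable (cls w)"
    by simp
  then show ?thesis using countable_avoid_lines that by blast
qed

text \<open>The unit cell picks one lift of each coincidence of the class, so the index becomes a
  sum of local degrees of a doubly periodic function.\<close>

lemma sum_coin_index_cls:
  assumes "w \<in> lattice"
  shows "coin_index_set g (g \<circ> \<tau>) (torus_exp ` cls w) = 0"
proof -
  obtain a where a: "\<And>z. z \<in> cls w \<Longrightarrow> Re z \<noteq> Re a \<and> Im z \<noteq> Im a"
    using cls_avoid_lines[OF assms] by blast
  have bij: "bij_betw torus_exp {z \<in> box a (a + Complex 1 1). z \<in> cls w} (torus_exp ` cls w)"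
    by (rule bij_betw_torus_exp_cell) (use a cls_shift in auto)
  have "coin_index_set g (g \<circ> \<tau>) (torus_exp ` cls w) =
      (\<Sum>z | z \<in> box a (a + Complex 1 1) \<and> z \<in> cls w. coin_index g (g \<circ> \<tau>) (torus_exp z))"
    unfolding coin_index_set_def by (rule sum.reindex_bij_betw[OF bij, symmetric])
  also have "\<dots> = (\<Sum>z | z \<in> box a (a + Complex 1 1) \<and> \<Psi> w z = 0. local_degree (\<Psi> w) z)"
    by (rule sum.cong) (auto simp: cls_def \<Psi>_eq_0_iff coin_index_torus_exp local_degree_\<Psi>[OF assms])
  also have "\<dots> = 0"
  proof (rule sum_local_degree_periodic[OF continuous_\<Psi>])
    show "\<Psi> w z \<noteq> 0" if "Re z = Re a \<or> Im z = Im a" for z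
      using that a[of z] by (auto simp: \<Psi>_eq_0_iff cls_def)
  qed (use finite_cls_cball[OF assms] in \<open>auto intro: \<Psi>_shift\<close>)
  finally show ?thesis .
qed

section \<open>Nielsen classes and Borsuk-Ulam classes as residues modulo 2\<mu>\<close>

lemma Nielsen_class_of_torus_exp:
  assumes "\<Phi> z \<in> lattice"
  shows "{(x, y). x \<in> Coin g (g \<circ> \<tau>) \<and> y \<in> Coin g (g \<circ> \<tau>) \<and> Nielsen_related g (g \<circ> \<tau>) x y}
      `` {torus_exp z} = torus_exp ` cls (\<Phi> z)" (is "?r `` _ = _")
proof -
  have iff: "torus_exp y \<in> ?r `` {torus_exp z} \<longleftrightarrow> y \<in> cls (\<Phi> z)" for y
    using assms Nielsen_related_iff[of z y] congr_lattice[of "\<Phi> y" "\<Phi> z"]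
      congr_sym[of "\<Phi> z" "\<Phi> y"] congr_sym[of "\<Phi> y" "\<Phi> z"]
    by (auto simp: torus_exp_in_Coin_iff cls_def)
  show ?thesis
  proof (intro equalityI subsetI)
    fix p assume p: "p \<in> ?r `` {torus_exp z}"
    obtain y where y: "torus_exp y = p" using torus_exp_surj by blast
    then have "y \<in> cls (\<Phi> z)" using iff[of y] p by simp
    then show "p \<in> torus_exp ` cls (\<Phi> z)" using y by blast
  next
    fix p assume "p \<in> torus_exp ` cls (\<Phi> z)"
    then show "p \<in> ?r `` {torus_exp z}" using iff by blast
  qed
qed

lemma Nielsen_class_eq:
  assumes "D \<in> Nielsen_classes g (g \<circ> \<tau>)"
  obtains w where "w \<in> lattice" "D = torus_exp ` cls w"
proof -
  obtain x where x: "x \<in> Coin g (g \<circ> \<tau>)"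
    "D = {(x, y). x \<in> Coin g (g \<circ> \<tau>) \<and> y \<in> Coin g (g \<circ> \<tau>) \<and> Nielsen_related g (g \<circ> \<tau>) x y} `` {x}"
    using assms unfolding Nielsen_classes_def by (rule quotientE)
  obtain z where z: "torus_exp z = x" using torus_exp_surj by blast
  have \<Phi>z: "\<Phi> z \<in> lattice" using x z torus_exp_in_Coin_iff by blast
  then show ?thesis using that[OF \<Phi>z] Nielsen_class_of_torus_exp[OF \<Phi>z] x(2) z by simp
qed

lemma torus_exp_cls_Nielsen_class:
  assumes "z \<in> cls w" "w \<in> lattice"
  shows "torus_exp ` cls w \<in> Nielsen_classes g (g \<circ> \<tau>)"
proof -
  have \<Phi>z: "\<Phi> z \<in> lattice" "cls (\<Phi> z) = cls w"
    using assms congr_lattice cls_cong by (auto simp: cls_def)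
  then show ?thesis
    unfolding Nielsen_classes_def \<Phi>z(2)[symmetric] Nielsen_class_of_torus_exp[OF \<Phi>z(1), symmetric]
    by (intro quotientI) (simp add: torus_exp_in_Coin_iff)
qed

definition orbit :: "complex \<Rightarrow> torus set" where
  "orbit z = {torus_exp z, torus_exp (\<sigma> z)}"

definition orbs :: "complex \<Rightarrow> torus set set" where
  "orbs w = orbit ` cls w"

lemma BUCoin_eq: "BUCoin g \<tau> = orbit ` {z. \<Phi> z \<in> lattice}"
proof -
  have "Coin g (g \<circ> \<tau>) = torus_exp ` {z. \<Phi> z \<in> lattice}"
    using torus_exp_in_Coin_iff torus_exp_surj by (auto simp: image_iff) metis
  then show ?thesis
    by (auto simp: BUCoin_def orbit_def \<tau>_torus_exp)
qed

lemma orbit_cong: "torus_exp z = torus_exp z' \<Longrightarrow> orbit z = orbit z'"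
  by (simp add: orbit_def \<tau>_torus_exp[symmetric])

lemma orbit_\<sigma>: "orbit (\<sigma> z) = orbit z"
proof -
  have "torus_exp (\<sigma> (\<sigma> z)) = torus_exp z"
    by (metis \<tau>_\<tau> \<tau>_torus_exp)
  then show ?thesis by (auto simp: orbit_def)
qed

lemma torus_exp_in_orbit: "torus_exp y \<in> orbit z \<Longrightarrow> orbit y = orbit z"
  by (metis insertE orbit_\<sigma> orbit_cong orbit_def singletonD)

lemma torus_exp_in_orbit_congr:
  assumes "torus_exp y \<in> orbit z"
  shows "congr (\<Phi> y) (\<Phi> z) \<or> congr (\<Phi> y) (- \<Phi> z - \<nu>)"
  using assms congr_torus_exp_eq[of y z] congr_torus_exp_eq[of y "\<sigma> z"] by (auto simp: orbit_def \<Phi>_\<sigma>)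

text \<open>An orbit has representatives y and \<sigma> y with values \<Phi> y and -\<Phi> y -
  \<nu>. A relation between any points of the two orbits therefore means that one representative has
  a value congruent to \<Phi> z, which is all that \<open>orbs\<close> records.\<close>

lemma BU_class_of_orbit:
  assumes "\<Phi> z \<in> lattice"
  shows "BU_rel g \<tau> `` {orbit z} = orbs (\<Phi> z)"
proof (intro equalityI subsetI)
  fix Q assume "Q \<in> BU_rel g \<tau> `` {orbit z}"
  then obtain x y where xy: "Q \<in> BUCoin g \<tau>" "x \<in> orbit z" "y \<in> Q" "Nielsen_related g (g \<circ> \<tau>) x y"
    by (auto simp: BU_rel_def)
  obtain x' y' where x': "x = torus_exp x'" "y = torus_exp y'" using torus_exp_surj by metis
  obtain q where q: "\<Phi> q \<in> lattice" "Q = orbit q" using xy(1) by (auto simp: BUCoin_eq)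
  have latr: "- \<Phi> q - \<nu> \<in> lattice" "- \<Phi> z - \<nu> \<in> lattice"
    using q assms \<nu>_lattice by (auto intro!: lattice_diff lattice_uminus)
  have px: "congr (\<Phi> x') (\<Phi> z) \<or> congr (\<Phi> x') (- \<Phi> z - \<nu>)"
    using torus_exp_in_orbit_congr xy(2) x'(1) by blast
  have py: "congr (\<Phi> y') (\<Phi> q) \<or> congr (\<Phi> y') (- \<Phi> q - \<nu>)"
    using torus_exp_in_orbit_congr xy(3) x'(2) q(2) by blast
  have lat: "\<Phi> x' \<in> lattice" "\<Phi> y' \<in> lattice"
    using px py latr q assms congr_lattice by blast+
  have "congr (\<Phi> x') (\<Phi> y')" using Nielsen_related_iff[OF lat] xy(4) x' by simp
  then have "congr (\<Phi> y') (\<Phi> z) \<or> congr (\<Phi> y') (- \<Phi> z - \<nu>)"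
    using px congr_sym congr_trans by blast
  moreover have "Q = orbit y'" using q(2) xy(3) x'(2) torus_exp_in_orbit by simp
  \<comment> \<open>In the reflected case \<sigma> y' is the representative to use; it spans the
    same orbit.\<close>
  moreover have "congr (- \<Phi> y' - \<nu>) (\<Phi> z)" if "congr (\<Phi> y') (- \<Phi> z - \<nu>)"
    using congr_reflect[OF that] by simp
  ultimately show "Q \<in> orbs (\<Phi> z)"
    unfolding orbs_def cls_def using orbit_\<sigma>[of y'] \<Phi>_\<sigma>[of y']
    by (metis (mono_tags, lifting) image_eqI mem_Collect_eq)
next
  fix Q assume "Q \<in> orbs (\<Phi> z)"
  then obtain q where q: "congr (\<Phi> q) (\<Phi> z)" "Q = orbit q" by (auto simp: orbs_def cls_def)
  have lq: "\<Phi> q \<in> lattice" using q(1) assms congr_lattice by blast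
  then have "Nielsen_related g (g \<circ> \<tau>) (torus_exp z) (torus_exp q)"
    using Nielsen_related_iff[OF assms lq] q(1) congr_sym by blast
  then show "Q \<in> BU_rel g \<tau> `` {orbit z}"
    using q(2) lq assms by (auto simp: BU_rel_def BUCoin_eq orbit_def)
qed

lemma BU_classes_eq: "BU_classes g \<tau> = {orbs w |w. w \<in> lattice \<and> cls w \<noteq> {}}"
proof (intro equalityI subsetI)
  fix C assume "C \<in> BU_classes g \<tau>"
  then obtain z where "\<Phi> z \<in> lattice" "C = BU_rel g \<tau> `` {orbit z}"
    by (auto simp: BU_classes_def BUCoin_eq elim: quotientE)
  then show "C \<in> {orbs w |w. w \<in> lattice \<and> cls w \<noteq> {}}"
    using BU_class_of_orbit[of z] congr_refl[of "\<Phi> z"] by (auto simp: cls_def)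
next
  fix C assume "C \<in> {orbs w |w. w \<in> lattice \<and> cls w \<noteq> {}}"
  then obtain w z where wz: "w \<in> lattice" "congr (\<Phi> z) w" "C = orbs w" by (auto simp: cls_def)
  have lz: "\<Phi> z \<in> lattice" using wz congr_lattice by blast
  have "cls w = cls (\<Phi> z)" using wz(2) cls_cong by simp
  then have "C = BU_rel g \<tau> `` {orbit z}" using BU_class_of_orbit[OF lz] wz(3) by (simp add: orbs_def)
  then show "C \<in> BU_classes g \<tau>"
    unfolding BU_classes_def using lz by (auto simp: BUCoin_eq intro!: quotientI)
qed

text \<open>The partner of a coincidence with value w has value -w - \<nu>, so a point is Nielsen
  related to its partner when its residue is fixed by the reflection.\<close>

lemma BU_single_iff:
  assumes "w \<in> lattice" "cls w \<noteq> {}"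
  shows "BU_single g \<tau> (orbs w) \<longleftrightarrow> congr w (- w - \<nu>)"
proof
  assume "BU_single g \<tau> (orbs w)"
  then obtain z x where z: "congr (\<Phi> z) w" "x \<in> orbit z" "Nielsen_related g (g \<circ> \<tau>) x (\<tau> x)"
    by (auto simp: BU_single_def orbs_def cls_def)
  obtain y where y: "x = torus_exp y" using torus_exp_surj by metis
  have py: "congr (\<Phi> y) (\<Phi> z) \<or> congr (\<Phi> y) (- \<Phi> z - \<nu>)"
    using torus_exp_in_orbit_congr z(2) y by blast
  have lz: "\<Phi> z \<in> lattice" using z(1) assms congr_lattice by blast
  then have ly: "\<Phi> y \<in> lattice" "\<Phi> (\<sigma> y) \<in> lattice"
    using py congr_lattice lattice_diff lattice_uminus \<nu>_lattice \<Phi>_\<sigma> by metis+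
  have "congr (\<Phi> y) (- \<Phi> y - \<nu>)"
    using Nielsen_related_iff[OF ly] z(3) by (simp add: y \<tau>_torus_exp \<Phi>_\<sigma>)
  \<comment> \<open>The point witnessing singleness may be either member of the orbit, so its
    residue is that of w or of the reflection of w.\<close>
  moreover have "congr (\<Phi> y) w \<or> congr (\<Phi> y) (- w - \<nu>)"
    using py congr_trans[OF _ z(1)] congr_trans[OF _ congr_reflect[OF z(1)]] by blast
  then have "congr w (\<Phi> y) \<and> congr (- \<Phi> y - \<nu>) (- w - \<nu>) \<or>
      congr w (- \<Phi> y - \<nu>) \<and> congr (\<Phi> y) (- w - \<nu>)"
    using congr_reflect[of "\<Phi> y" w] congr_reflect[of "\<Phi> y" "- w - \<nu>"]
      congr_sym[of "\<Phi> y" w] congr_sym[of "- \<Phi> y - \<nu>" w] by auto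
  ultimately show "congr w (- w - \<nu>)"
    by (meson congr_sym congr_trans)
next
  assume *: "congr w (- w - \<nu>)"
  obtain z where z: "congr (\<Phi> z) w" using assms(2) by (auto simp: cls_def)
  have lz: "\<Phi> z \<in> lattice" "\<Phi> (\<sigma> z) \<in> lattice"
    using z assms congr_lattice lattice_diff lattice_uminus \<nu>_lattice \<Phi>_\<sigma> by metis+
  have "congr (\<Phi> z) (\<Phi> (\<sigma> z))"
    using z * congr_reflect[OF z] congr_sym congr_trans \<Phi>_\<sigma> by metis
  then have "Nielsen_related g (g \<circ> \<tau>) (torus_exp z) (\<tau> (torus_exp z))"
    using Nielsen_related_iff[OF lz] by (simp add: \<tau>_torus_exp)
  then show "BU_single g \<tau> (orbs w)"
    using z by (auto simp: BU_single_def orbs_def cls_def orbit_def)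
qed

lemma cls_\<sigma>:
  assumes "congr w (- w - \<nu>)"
  shows "\<sigma> z \<in> cls w \<longleftrightarrow> z \<in> cls w"
proof -
  have "congr (- u - \<nu>) w" if "congr u w" for u
    using congr_reflect[OF that] assms congr_sym congr_trans by blast
  from this[of "\<Phi> z"] this[of "- \<Phi> z - \<nu>"] show ?thesis
    by (auto simp: cls_def \<Phi>_\<sigma>)
qed

text \<open>Whichever usual class the choice operator returns, its index is 0, so nothing about the
  choice has to be known.\<close>

lemma pseudo_index_double:
  assumes "w \<in> lattice" "cls w \<noteq> {}" "\<not> BU_single g \<tau> (orbs w)"
  shows "pseudo_index g \<tau> (orbs w) = 0"
proof -
  define D where "D = (SOME D. D \<in> Nielsen_classes g (g \<circ> \<tau>) \<and> D \<subseteq> \<Union>(orbs w))"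
  have "torus_exp ` cls w \<in> Nielsen_classes g (g \<circ> \<tau>) \<and> torus_exp ` cls w \<subseteq> \<Union>(orbs w)"
    using assms torus_exp_cls_Nielsen_class by (auto simp: orbs_def orbit_def)
  then have "D \<in> Nielsen_classes g (g \<circ> \<tau>) \<and> D \<subseteq> \<Union>(orbs w)"
    unfolding D_def by (rule someI)
  then have "coin_index_set g (g \<circ> \<tau>) D = 0"
    using Nielsen_class_eq sum_coin_index_cls by metis
  then show ?thesis
    using assms(3) by (simp add: pseudo_index_def D_def[symmetric] Let_def)
qed

text \<open>A single class fills one whole Nielsen class, since \<sigma> preserves its residue, and
  half of index 0 is 0.\<close>

lemma NBU_finite_preserving:
  assumes "\<not> reverses_orientation \<tau>"
  shows "NBU_finite g \<tau> = 0"
proof -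
  have "pseudo_index g \<tau> (orbs w) = 0" if w: "w \<in> lattice" "cls w \<noteq> {}" for w
  proof (cases "BU_single g \<tau> (orbs w)")
    case True
    then have *: "congr w (- w - \<nu>)" using BU_single_iff[OF w] by simp
    have "\<Union>(orbs w) = torus_exp ` cls w"
      using cls_\<sigma>[OF *] by (auto simp: orbs_def orbit_def)
    then show ?thesis
      using True assms sum_coin_index_cls[OF w(1)] by (simp add: pseudo_index_def)
  next
    case False
    then show ?thesis using pseudo_index_double[OF w] by simp
  qed
  then have "{C \<in> BU_classes g \<tau>. essential_BU_class g \<tau> C} = {}"
    by (auto simp: BU_classes_eq essential_BU_class_def)
  then show ?thesis unfolding NBU_finite_def by (simp only: card.empty)
qed

end

section \<open>The orientation-reversing involution\<close>

locale coincidence_lift_reflection = coincidence_lift +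
  assumes \<sigma>_eq: "\<sigma> z = - cnj z + \<i> / 2"
begin

text \<open>Composing \<Phi> with \<sigma> gives -\<Phi> - \<nu>. Negation of the plane keeps the
  orientation and \<sigma> reverses it, whence the sign.\<close>

lemma deg_\<sigma>:
  assumes "\<Phi> z \<in> lattice"
  shows "deg (\<sigma> z) = - deg z"
proof -
  define F where "F = (\<lambda>x. \<Phi> x - \<Phi> (\<sigma> z))"
  have lat: "\<Phi> (\<sigma> z) \<in> lattice"
    using assms \<nu>_lattice by (simp add: \<Phi>_\<sigma> lattice_diff lattice_uminus)
  obtain r where r: "0 < r" "\<And>x. x \<in> ball (\<sigma> z) r - {\<sigma> z} \<Longrightarrow> \<Phi> x \<notin> lattice"
    using isolated_coincidence[OF lat] by blast
  define s where "s = r / 2"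
  have s: "0 < s" "s < r" using r(1) by (auto simp: s_def)
  have dist: "dist (\<sigma> x) (\<sigma> y) = dist x y" for x y
  proof -
    have "\<sigma> x - \<sigma> y = - cnj (x - y)" by (simp add: \<sigma>_eq)
    then show ?thesis by (simp only: dist_norm norm_minus_cancel complex_mod_cnj)
  qed
  have contF: "continuous_on UNIV F"
    unfolding F_def using continuous_\<Phi> by (intro continuous_intros)
  have img: "path_image (\<sigma> \<circ> circlepath z s) \<subseteq> ball (\<sigma> z) r - {\<sigma> z}"
    unfolding path_image_compose_circlepath[OF s(1)]
    using s dist by (auto simp flip: dist_eq_0_iff[of "\<sigma> _" "\<sigma> _"])
  have \<sigma>fun: "\<sigma> = (\<lambda>z. - cnj z + \<i> / 2)"
    using \<sigma>_eq by blast
  \<comment> \<open>One winding number is computed twice. Here it comes from the zero of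
    \<open>F\<close> at \<sigma> z, around which the reflected circle runs clockwise.\<close>
  have "winding_number (F \<circ> (\<sigma> \<circ> circlepath z s)) 0 =
      (\<Sum>x\<in>{\<sigma> z}. of_int (local_degree F x) * winding_number (\<sigma> \<circ> circlepath z s) x)"
  proof (rule winding_number_eq_sum_local_degree[where S = "ball (\<sigma> z) r"])
    show "continuous_on (ball (\<sigma> z) r) F"
      using contF continuous_on_subset by blast
    show "F x = 0 \<longleftrightarrow> x \<in> {\<sigma> z}" if "x \<in> ball (\<sigma> z) r" for x
      using r(2)[of x] that lat by (cases "x = \<sigma> z") (auto simp: F_def)
    show "path (\<sigma> \<circ> circlepath z s)"
      using continuous_\<sigma> continuous_on_subset by (intro path_continuous_image) auto
  qed (use r img in \<open>auto simp: pathfinish_compose pathstart_compose\<close>)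
  also have "\<dots> = - of_int (deg (\<sigma> z))"
    using winding_number_reflected_circlepath[OF s(1), of "\<i> / 2" z] by (simp add: \<sigma>fun F_def deg_def)
  finally have 1: "winding_number (F \<circ> (\<sigma> \<circ> circlepath z s)) 0 = - of_int (deg (\<sigma> z))" .
  \<comment> \<open>For the second computation \<open>F\<close> after \<sigma> is the negative of
    \<Phi> - \<Phi> z, followed along an ordinary circle around z.\<close>
  have F\<sigma>: "F \<circ> \<sigma> = (\<lambda>x. (\<Phi> x - \<Phi> z) * (-1))"
    by (auto simp: F_def \<Phi>_\<sigma>)
  have iso: "\<Phi> x \<noteq> \<Phi> z" if "x \<in> ball z r - {z}" for x
  proof
    assume "\<Phi> x = \<Phi> z"
    then have "\<Phi> (\<sigma> x) \<in> lattice" using lat by (simp add: \<Phi>_\<sigma>)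
    moreover have "\<sigma> x \<in> ball (\<sigma> z) r - {\<sigma> z}"
      using that dist[of z x] dist[of x z] by (auto simp: \<sigma>_eq)
    ultimately show False using r(2) by blast
  qed
  have cont: "continuous_on S (\<lambda>x. \<Phi> x - \<Phi> z)" for S
    using continuous_\<Phi> by (intro continuous_intros) (auto intro: continuous_on_subset)
  have "winding_number ((\<lambda>x. (\<Phi> x - \<Phi> z) * (-1)) \<circ> circlepath z s) 0 =
      of_int (local_degree (\<lambda>x. (\<Phi> x - \<Phi> z) * (-1)) z)"
  proof (rule local_degree_eqI)
    show "continuous_on (cball z s) (\<lambda>x. (\<Phi> x - \<Phi> z) * (-1))"
      by (intro continuous_on_mult_right cont)
    show "(\<Phi> x - \<Phi> z) * (-1) \<noteq> 0" if "x \<in> cball z s - {z}" for x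
      using iso[of x] that s by auto
  qed (use s in auto)
  also have "local_degree (\<lambda>x. (\<Phi> x - \<Phi> z) * (-1)) z = deg z"
    unfolding deg_def by (rule local_degree_mult[where S = "ball z r"]) (use r iso cont in auto)
  finally have 2: "winding_number (F \<circ> (\<sigma> \<circ> circlepath z s)) 0 = of_int (deg z)"
    unfolding o_assoc F\<sigma> .
  have "complex_of_int (deg z) = of_int (- deg (\<sigma> z))"
    using 1 2 by simp
  then have "deg z = - deg (\<sigma> z)"
    using of_int_eq_iff by blast
  then show ?thesis by simp
qed

text \<open>\<sigma> raises the imaginary part by 1/2, so of the two lifts of an orbit in a unit
  cell exactly one lies in the lower half.\<close>

lemma bij_betw_orbit_half_cell:
  assumes "congr w (- w - \<nu>)" and bd: "\<And>z. z \<in> cls w \<Longrightarrow> Re z \<noteq> Re a \<and> Im z \<noteq> Im a"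
  shows "bij_betw orbit {z \<in> box a (a + Complex 1 (1/2)). z \<in> cls w} (orbs w)"
  unfolding bij_betw_def
proof (intro conjI equalityI subsetI)
  show "inj_on orbit {z \<in> box a (a + Complex 1 (1/2)). z \<in> cls w}"
  proof (rule inj_onI)
    fix x y assume x: "x \<in> {z \<in> box a (a + Complex 1 (1/2)). z \<in> cls w}"
      and y: "y \<in> {z \<in> box a (a + Complex 1 (1/2)). z \<in> cls w}" and eq: "orbit x = orbit y"
    have "torus_exp x \<in> orbit y" using eq by (auto simp: orbit_def)
    then have "x - y \<in> lattice \<or> x - \<sigma> y \<in> lattice"
      by (auto simp: orbit_def torus_exp_eq_iff)
    moreover have "x - \<sigma> y \<notin> lattice"
    proof
      assume "x - \<sigma> y \<in> lattice"
      \<comment> \<open>Two heights in the same half cell differ by less than 1/2, which places this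
        number strictly between -1 and 0.\<close>
      then have "Im x - Im y - 1/2 \<in> \<int>" by (simp add: \<sigma>_eq lattice_def algebra_simps)
      moreover have "\<bar>Im x - Im y - 1/2\<bar> < 1" "Im x - Im y - 1/2 \<noteq> 0"
        using x y by (auto simp: in_box_complex_iff)
      ultimately show False using Ints_nonzero_abs_less1 by blast
    qed
    ultimately have "x - y \<in> lattice" by blast
    then show "x = y"
      by (rule lattice_small_eq) (use x y in \<open>auto simp: in_box_complex_iff\<close>)
  qed
  show "P \<in> orbs w" if "P \<in> orbit ` {z \<in> box a (a + Complex 1 (1/2)). z \<in> cls w}" for P
    using that by (auto simp: orbs_def)
  have orbit_add: "orbit (z + v) = orbit z" if "v \<in> lattice" for z v
    using that by (intro orbit_cong) (simp add: torus_exp_eq_iff)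
  fix P assume "P \<in> orbs w"
  then obtain z where z: "z \<in> cls w" "P = orbit z" by (auto simp: orbs_def)
  obtain v where v: "v \<in> lattice" "Re a \<le> Re (z + v)" "Re (z + v) < Re a + 1"
    "Im a \<le> Im (z + v)" "Im (z + v) < Im a + 1"
    using lattice_translate_into_cell by blast
  define y where "y = z + v"
  have y: "y \<in> cls w" "P = orbit y"
    using cls_shift[OF z(1) v(1)] orbit_add[OF v(1)] z(2) by (simp_all add: y_def)
  show "P \<in> orbit ` {z \<in> box a (a + Complex 1 (1/2)). z \<in> cls w}"
  proof (cases "Im y < Im a + 1/2")
    case True
    then have "y \<in> box a (a + Complex 1 (1/2))"
      using v bd[OF y(1)] by (auto simp: in_box_complex_iff y_def[symmetric])
    then show ?thesis using y by blast
  next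
    case False
    obtain v' where v': "v' \<in> lattice" "Re a \<le> Re (\<sigma> y + v')" "Re (\<sigma> y + v') < Re a + 1"
      "Im a \<le> Im (\<sigma> y + v')" "Im (\<sigma> y + v') < Im a + 1"
      using lattice_translate_into_cell by blast
    define x where "x = \<sigma> y + v'"
    have x: "x \<in> cls w" "P = orbit x"
      using cls_shift[OF _ v'(1), of "\<sigma> y"] cls_\<sigma>[OF assms(1)] y orbit_add[OF v'(1)] orbit_\<sigma>
      by (simp_all add: x_def)
    \<comment> \<open>The reflected point, brought back by a lattice vector, lies exactly 1/2 below
      y. The borderline height Im a + 1/2 of y is then excluded by \<open>bd\<close> at x.\<close>
    have "Im x = Im a + (Im y - Im a - 1/2)"
    proof -
      have "Im x - (Im y - 1/2) \<in> \<int>"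
        using v'(1) Ints_add[of "Im v'" 1] by (simp add: x_def \<sigma>_eq lattice_def algebra_simps)
      moreover have "\<bar>Im x - (Im y - 1/2)\<bar> < 1"
        using v' v False by (auto simp: x_def[symmetric] y_def[symmetric])
      ultimately have "Im x - (Im y - 1/2) = 0" using Ints_nonzero_abs_less1 by blast
      then show ?thesis by simp
    qed
    then have "x \<in> box a (a + Complex 1 (1/2))"
      using v v' bd[OF x(1)] by (auto simp: in_box_complex_iff x_def[symmetric] y_def[symmetric])
    then show ?thesis using x by blast
  qed
qed

text \<open>Either point of an orbit may be chosen, because their indices are opposite and only
  parity matters. Reindexing over the half cell leaves the half-period count, with k = -1 or k =
  0.\<close>

lemma sum_coin_index_orbs_parity:
  assumes w: "w \<in> lattice" and single: "congr w (- w - \<nu>)"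
  shows "(\<Sum>P\<in>orbs w. coin_index g (g \<circ> \<tau>) (SOME x. x \<in> P)) mod 2 = (if \<mu> = 0 then 0 else 1)"
proof -
  obtain a where a: "\<And>z. z \<in> cls w \<Longrightarrow> Re z \<noteq> Re a \<and> Im z \<noteq> Im a"
    using cls_avoid_lines[OF w] by blast
  have \<Psi>0: "\<Psi> w z = 0 \<longleftrightarrow> z \<in> cls w" for z
    by (simp add: \<Psi>_eq_0_iff cls_def)
  have parity: "coin_index g (g \<circ> \<tau>) (SOME x. x \<in> orbit z) mod 2 = local_degree (\<Psi> w) z mod 2"
    if z: "z \<in> cls w" for z
  proof -
    have "\<Phi> z \<in> lattice" using z w congr_lattice by (auto simp: cls_def)
    then have "deg (\<sigma> z) = - deg z"
      by (rule deg_\<sigma>)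
    then have "deg (\<sigma> z) mod 2 = deg z mod 2"
      by presburger
    moreover have "(SOME x. x \<in> orbit z) \<in> orbit z"
      by (rule someI[of _ "torus_exp z"]) (simp add: orbit_def)
    ultimately have "coin_index g (g \<circ> \<tau>) (SOME x. x \<in> orbit z) mod 2 = deg z mod 2"
      by (auto simp: orbit_def coin_index_torus_exp)
    then show ?thesis
      using local_degree_\<Psi>[OF w] z by (simp add: cls_def)
  qed
  have reindex: "(\<Sum>P\<in>orbs w. coin_index g (g \<circ> \<tau>) (SOME x. x \<in> P)) =
      (\<Sum>z | z \<in> box a (a + Complex 1 (1/2)) \<and> z \<in> cls w. coin_index g (g \<circ> \<tau>) (SOME x. x \<in> orbit z))"
    by (rule sum.reindex_bij_betw[OF bij_betw_orbit_half_cell[OF single a], symmetric])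
  have "(\<Sum>P\<in>orbs w. coin_index g (g \<circ> \<tau>) (SOME x. x \<in> P)) mod 2 =
      (\<Sum>z | z \<in> box a (a + Complex 1 (1/2)) \<and> z \<in> cls w. coin_index g (g \<circ> \<tau>) (SOME x. x \<in> orbit z) mod 2) mod 2"
    unfolding reindex by (rule mod_sum_eq[symmetric])
  also have "\<dots> = (\<Sum>z | z \<in> box a (a + Complex 1 (1/2)) \<and> \<Psi> w z = 0. local_degree (\<Psi> w) z mod 2) mod 2"
    by (rule arg_cong[where f = "\<lambda>x. x mod 2"], rule sum.cong) (auto simp: \<Psi>0 parity)
  also have "\<dots> = (\<Sum>z | z \<in> box a (a + Complex 1 (1/2)) \<and> \<Psi> w z = 0. local_degree (\<Psi> w) z) mod 2"
    by (rule mod_sum_eq)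
  also have "\<dots> = (if \<mu> = 0 then 0 else - 1) mod 2"
  proof -
    obtain j :: int where j: "w = - w - \<nu> + 2 * of_int j * \<mu>"
      using single by (auto simp: congr_def)
    \<comment> \<open>A logarithm of the factor relating \<Psi> after \<sigma> to \<Psi>. The factor
      is -1 if \<mu> = 0; otherwise 1/e - 1 = (e - 1)(-1/e) gives -1/e. In both cases pi i accounts
      for the sign.\<close>
    define \<kappa> where "\<kappa> = (\<lambda>z. if \<mu> = 0 then of_real pi * \<i> else of_real pi * \<i> - of_real pi * \<i> * (\<Phi> z - w) / \<mu>)"
    \<comment> \<open>Singleness enters here: modulo 2\<mu> it makes the reflection of values
      symmetric about w.\<close>
    have refl: "\<Phi> (\<sigma> z) - w = - (\<Phi> z - w) + of_int (2 * - j) * \<mu>" for z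
    proof -
      have "\<nu> = - 2 * w + 2 * of_int j * \<mu>" using j by (simp add: algebra_simps)
      then show ?thesis by (simp add: \<Phi>_\<sigma>)
    qed
    show ?thesis
    proof (rule sum_local_degree_half_period[OF continuous_\<Psi>, where \<kappa> = \<kappa>])
      show "\<Psi> w (z + 1) = \<Psi> w z" for z
        by (rule \<Psi>_shift) simp
      show "\<Psi> w (- cnj z + \<i> / 2) = \<Psi> w z * exp (\<kappa> z)" for z
      proof (cases "\<mu> = 0")
        case True
        have "\<Psi> w (\<sigma> z) = \<Psi> w z * exp (\<kappa> z)"
          unfolding \<Psi>_def \<kappa>_def using refl[of z] True by simp
        then show ?thesis by (simp add: \<sigma>_eq)
      next
        case False
        let ?e = "exp (of_real pi * \<i> * (\<Phi> z - w) / \<mu>)"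
        have "of_real pi * \<i> * (\<Phi> (\<sigma> z) - w) / \<mu> =
            of_real pi * \<i> * (- (\<Phi> z - w)) / \<mu> + of_real pi * \<i> * (of_int (2 * - j) * \<mu>) / \<mu>"
          unfolding refl by (simp only: distrib_left add_divide_distrib)
        also have "\<dots> = - (of_real pi * \<i> * (\<Phi> z - w) / \<mu>) + of_real (of_int (2 * - j) * pi) * \<i>"
          using False by (simp only: mult_minus_right minus_divide_left) simp
        finally have "exp (of_real pi * \<i> * (\<Phi> (\<sigma> z) - w) / \<mu>) = exp (- (of_real pi * \<i> * (\<Phi> z - w) / \<mu>))"
          using exp_eq by blast
        then have "\<Psi> w (\<sigma> z) = inverse ?e - 1"
          unfolding \<Psi>_def using False by (simp add: exp_minus)
        also have "\<dots> = (?e - 1) * (- 1 / ?e)"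
          by (simp add: field_simps)
        also have "- 1 / ?e = exp (\<kappa> z)"
          using False by (simp add: \<kappa>_def exp_diff)
        also have "?e - 1 = \<Psi> w z"
          using False by (simp add: \<Psi>_def)
        finally show ?thesis by (simp add: \<sigma>_eq)
      qed
      show "continuous_on UNIV \<kappa>"
        unfolding \<kappa>_def using continuous_\<Phi> by (cases "\<mu> = 0") (auto intro!: continuous_intros)
      \<comment> \<open>For nonzero \<mu> a unit step adds 2\<mu> to \<Phi>, so \<kappa> drops by 2
        pi i: this is the source of the odd parity.\<close>
      show "\<kappa> (z + 1) = \<kappa> z + 2 * of_real pi * \<i> * of_int (if \<mu> = 0 then 0 else - 1)" for z
        using \<Phi>_shift[of 1 z] by (cases "\<mu> = 0") (simp_all add: \<kappa>_def field_simps)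
      show "finite {z \<in> cball 0 R. \<Psi> w z = 0}" for R
        by (rule finite_cls_cball[OF w])
      show "\<Psi> w z \<noteq> 0" if "Re z = Re a \<or> Im z = Im a" for z
        using that a[of z] by (auto simp: \<Psi>0)
    qed
  qed
  finally show ?thesis by auto
qed

lemma essential_iff:
  assumes "reverses_orientation \<tau>" "w \<in> lattice" "cls w \<noteq> {}"
  shows "essential_BU_class g \<tau> (orbs w) \<longleftrightarrow> \<mu> \<noteq> 0 \<and> congr w (- w - \<nu>)"
proof (cases "BU_single g \<tau> (orbs w)")
  case True
  then have *: "congr w (- w - \<nu>)" using BU_single_iff assms by blast
  then have "pseudo_index g \<tau> (orbs w) = of_int (if \<mu> = 0 then 0 else 1)"
    using True assms(1) sum_coin_index_orbs_parity[OF assms(2) *] by (simp add: pseudo_index_def)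
  then show ?thesis
    using * by (simp add: essential_BU_class_def)
next
  case False
  then have "\<not> congr w (- w - \<nu>)" using BU_single_iff assms by blast
  moreover have "\<not> essential_BU_class g \<tau> (orbs w)"
    using pseudo_index_double[OF assms(2,3) False] by (simp add: essential_BU_class_def)
  ultimately show ?thesis by blast
qed

text \<open>The parity count did not assume that coincidences exist, and an empty sum would be
  even.\<close>

lemma single_cls_nonempty:
  assumes "\<mu> \<noteq> 0" "w \<in> lattice" "congr w (- w - \<nu>)"
  shows "cls w \<noteq> {}"
proof
  assume "cls w = {}"
  then have "orbs w = {}" by (simp add: orbs_def)
  then show False
    using sum_coin_index_orbs_parity[OF assms(2,3)] assms(1) by simp
qed

lemma essential_classes_eq:
  assumes "reverses_orientation \<tau>"
  shows "{C \<in> BU_classes g \<tau>. essential_BU_class g \<tau> C} =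
     {orbs w |w. w \<in> lattice \<and> \<mu> \<noteq> 0 \<and> congr w (- w - \<nu>)}"
proof (intro equalityI subsetI)
  fix C assume "C \<in> {C \<in> BU_classes g \<tau>. essential_BU_class g \<tau> C}"
  then obtain w where w: "C = orbs w" "w \<in> lattice" "cls w \<noteq> {}" "essential_BU_class g \<tau> C"
    by (auto simp: BU_classes_eq)
  then show "C \<in> {orbs w |w. w \<in> lattice \<and> \<mu> \<noteq> 0 \<and> congr w (- w - \<nu>)}"
    using essential_iff[OF assms w(2,3)] by blast
next
  fix C assume "C \<in> {orbs w |w. w \<in> lattice \<and> \<mu> \<noteq> 0 \<and> congr w (- w - \<nu>)}"
  then obtain w where w: "C = orbs w" "w \<in> lattice" "\<mu> \<noteq> 0" "congr w (- w - \<nu>)"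
    by blast
  have ne: "cls w \<noteq> {}" using single_cls_nonempty w by blast
  show "C \<in> {C \<in> BU_classes g \<tau>. essential_BU_class g \<tau> C}"
    using essential_iff[OF assms w(2) ne] w ne by (auto simp: BU_classes_eq)
qed

text \<open>Single residues solve 2w = -\<nu> modulo 2\<mu>, that is w = -\<nu>/2 + k\<mu>. If
  \<nu>/2 is in the lattice, the parity of k leaves two residues; otherwise there is no solution in
  the lattice.\<close>

lemma NBU_finite_reversing:
  assumes "reverses_orientation \<tau>"
  shows "NBU_finite g \<tau> = (if \<mu> \<noteq> 0 \<and> \<nu> / 2 \<in> lattice then 2 else 0)"
proof (cases "\<mu> \<noteq> 0 \<and> \<nu> / 2 \<in> lattice")
  case True
  define u where "u = - (\<nu> / 2)"
  have u: "u \<in> lattice" "- u - \<nu> = u" "u + \<mu> \<in> lattice"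
    using True \<mu>_lattice by (auto simp: u_def lattice_uminus lattice_add lattice_diff)
  have iff: "congr w (- w - \<nu>) \<longleftrightarrow> congr w u \<or> congr w (u + \<mu>)" if "w \<in> lattice" for w
  proof
    assume "congr w (- w - \<nu>)"
    then obtain k :: int where "w = - w - \<nu> + 2 * of_int k * \<mu>" by (auto simp: congr_def)
    then have "2 * w = 2 * (u + of_int k * \<mu>)" by (simp add: u_def algebra_simps)
    then have w: "w = u + of_int k * \<mu>" by (subst (asm) mult_cancel_left) simp
    show "congr w u \<or> congr w (u + \<mu>)"
    proof (cases "even k")
      case True
      then obtain l where "k = 2 * l" by blast
      then have "w = u + 2 * of_int l * \<mu>" using w by simp
      then show ?thesis unfolding congr_def by blast
    next
      case False
      then obtain l where "k = 2 * l + 1" by (rule oddE)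
      then have "w = (u + \<mu>) + 2 * of_int l * \<mu>" using w by (simp add: algebra_simps)
      then show ?thesis unfolding congr_def by blast
    qed
  next
    assume "congr w u \<or> congr w (u + \<mu>)"
    moreover have "congr (- (u + \<mu>) - \<nu>) (u + \<mu>)"
    proof -
      have "- (u + \<mu>) - \<nu> = (u + \<mu>) + 2 * of_int (-1) * \<mu>" by (simp add: u_def field_simps)
      then show ?thesis unfolding congr_def by blast
    qed
    ultimately show "congr w (- w - \<nu>)"
      using congr_reflect[of w u] congr_reflect[of w "u + \<mu>"] u(2)
      by (metis congr_sym congr_trans)
  qed
  have orbs_cong: "orbs x = orbs y" if "congr x y" for x y
    using cls_cong[OF that] by (simp add: orbs_def)
  have "{C \<in> BU_classes g \<tau>. essential_BU_class g \<tau> C} = {orbs u, orbs (u + \<mu>)}"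
    unfolding essential_classes_eq[OF assms]
  proof (intro equalityI subsetI)
    fix C assume "C \<in> {orbs w |w. w \<in> lattice \<and> \<mu> \<noteq> 0 \<and> congr w (- w - \<nu>)}"
    then show "C \<in> {orbs u, orbs (u + \<mu>)}"
      using iff orbs_cong by blast
  next
    fix C assume "C \<in> {orbs u, orbs (u + \<mu>)}"
    then show "C \<in> {orbs w |w. w \<in> lattice \<and> \<mu> \<noteq> 0 \<and> congr w (- w - \<nu>)}"
      using iff[of u] iff[of "u + \<mu>"] u congr_refl True by blast
  qed
  \<comment> \<open>Equal classes would make \<mu> an even multiple of itself; reflection gives no
    further identification, because u is its own reflection.\<close>
  moreover have "orbs u \<noteq> orbs (u + \<mu>)"
  proof
    assume eq: "orbs u = orbs (u + \<mu>)"
    have "cls u \<noteq> {}"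
      using single_cls_nonempty[of u] True u iff[of u] congr_refl by blast
    then obtain z where z: "congr (\<Phi> z) u" by (auto simp: cls_def)
    then have "orbit z \<in> orbs (u + \<mu>)" using eq by (auto simp: orbs_def cls_def)
    then obtain y where y: "congr (\<Phi> y) (u + \<mu>)" "orbit z = orbit y"
      by (auto simp: orbs_def cls_def)
    have "torus_exp y \<in> orbit z" using y(2) by (simp add: orbit_def)
    then have "congr (\<Phi> y) (\<Phi> z) \<or> congr (\<Phi> y) (- \<Phi> z - \<nu>)"
      by (rule torus_exp_in_orbit_congr)
    moreover have "congr (- \<Phi> z - \<nu>) u"
      using congr_reflect[OF z] u(2) by simp
    ultimately have "congr (\<Phi> y) u"
      using z congr_trans by blast
    then have "congr (u + \<mu>) u"
      using y(1) congr_sym congr_trans by blast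
    then obtain k :: int where "u + \<mu> = u + 2 * of_int k * \<mu>" by (auto simp: congr_def)
    then have "(of_int (2 * k) - 1) * \<mu> = 0" by (simp add: algebra_simps)
    then have "complex_of_int (2 * k) = of_int 1" using True by simp
    then have "2 * k = 1" using of_int_eq_iff by blast
    then show False by presburger
  qed
  ultimately show ?thesis
    using True by (simp add: NBU_finite_def)
next
  case False
  have "\<nu> / 2 \<in> lattice" if w: "w \<in> lattice" and single: "congr w (- w - \<nu>)" for w
  proof -
    obtain k :: int where "w = - w - \<nu> + 2 * of_int k * \<mu>" using single by (auto simp: congr_def)
    then have "\<nu> / 2 = of_int k * \<mu> - w" by (simp add: field_simps)
    moreover have "of_int k * \<mu> - w \<in> lattice"
      using w \<mu>_lattice by (simp add: lattice_diff lattice_mult)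
    ultimately show ?thesis by (simp only:)
  qed
  then have "{C \<in> BU_classes g \<tau>. essential_BU_class g \<tau> C} = {}"
    unfolding essential_classes_eq[OF assms] using False by blast
  then show ?thesis
    unfolding NBU_finite_def using False by (simp only: card.empty if_False)
qed

end

section \<open>Realization\<close>

lemma is_torus_lift_coincidence_tau1:
  assumes "is_torus_lift g G m n" "finite (Coin g (g \<circ> \<tau>\<^sub>1))"
  shows "coincidence_lift g \<tau>\<^sub>1 G (\<lambda>z. z + 1/2) (\<lambda>z. G z - G (z + 1/2)) 0 m"
proof
  show "G (z + v) - G (z + v + 1/2) = G z - G (z + 1/2) + 2 * of_real (Re v) * 0" if "v \<in> lattice" for z v
    using is_torus_lift_lattice[OF assms(1) that, of z] is_torus_lift_lattice[OF assms(1) that, of "z + 1/2"]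
    by (simp add: add_ac)
  \<comment> \<open>Two half steps make a full period, so \<nu> is the first shift m.\<close>
  have eq: "z + 1/2 + 1/2 = z + 1" for z :: complex by simp
  show "G (z + 1/2) - G (z + 1/2 + 1/2) = - (G z - G (z + 1/2)) - m" for z
    unfolding eq using assms(1) by (simp add: is_torus_lift_def)
qed (use assms in \<open>auto simp: is_torus_lift_def tau1_torus_exp tau1_free_involution intro!: continuous_intros\<close>)

lemma is_torus_lift_coincidence_tau2:
  assumes "is_torus_lift g G m n" "finite (Coin g (g \<circ> \<tau>\<^sub>2))"
  shows "coincidence_lift_reflection g \<tau>\<^sub>2 G (\<lambda>z. - cnj z + \<i>/2) (\<lambda>z. G z - G (- cnj z + \<i>/2)) m n"
proof
  show "G (z + v) - G (- cnj (z + v) + \<i>/2) = G z - G (- cnj z + \<i>/2) + 2 * of_real (Re v) * m"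
    if "v \<in> lattice" for z v
  proof -
    have "- cnj v \<in> lattice" using that by (simp add: lattice_def)
    from is_torus_lift_lattice[OF assms(1) this, of "- cnj z + \<i>/2"] is_torus_lift_lattice[OF assms(1) that, of z]
    show ?thesis by (simp add: algebra_simps)
  qed
  \<comment> \<open>The glide reflection squares to the translation by \<i>, so \<nu> is the second
    shift n.\<close>
  have eq: "- cnj (- cnj z + \<i>/2) + \<i>/2 = z + \<i>" for z :: complex
    by (simp add: complex_eq_iff)
  show "G (- cnj z + \<i>/2) - G (- cnj (- cnj z + \<i>/2) + \<i>/2) = - (G z - G (- cnj z + \<i>/2)) - n" for z
    unfolding eq using assms(1) by (simp add: is_torus_lift_def)
qed (use assms in \<open>auto simp: is_torus_lift_def tau2_torus_exp tau2_free_involution intro!: continuous_intros\<close>)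

lemma NBU_finite_tau1:
  assumes "is_torus_lift g G m n" "finite (Coin g (g \<circ> \<tau>\<^sub>1))"
  shows "NBU_finite g \<tau>\<^sub>1 = 0"
  by (rule coincidence_lift.NBU_finite_preserving[OF is_torus_lift_coincidence_tau1[OF assms]
        not_reverses_orientation_tau1])

lemma NBU_finite_tau2:
  assumes "is_torus_lift g G m n" "finite (Coin g (g \<circ> \<tau>\<^sub>2))"
  shows "NBU_finite g \<tau>\<^sub>2 = (if m \<noteq> 0 \<and> n / 2 \<in> lattice then 2 else 0)"
  by (rule coincidence_lift_reflection.NBU_finite_reversing[OF is_torus_lift_coincidence_tau2[OF assms]
        reverses_orientation_tau2])

text \<open>The factor 1/2 anticipates that D changes sign under the involution: the perturbation
  then contributes exactly D to \<Phi>.\<close>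

lemma ex_perturbed_linear_lift:
  assumes "m \<in> lattice" "n \<in> lattice" "continuous_on UNIV D" "\<And>z. D (z + 1) = D z" "\<And>z. D (z + \<i>) = D z"
  obtains g where "is_torus_lift g (\<lambda>z. of_real (Re z) * m + of_real (Im z) * n + D z / 2) m n"
proof (rule ex_map_with_torus_lift[OF _ assms(1,2)])
  show "continuous_on UNIV (\<lambda>z. of_real (Re z) * m + of_real (Im z) * n + D z / 2)"
    using assms(3) by (intro continuous_intros) auto
qed (use that in \<open>auto simp: assms algebra_simps\<close>)

text \<open>The linear map has \<Phi> constantly -m/2. Adding a curve on the circle of radius 1/4
  avoids the lattice, because twice a lattice value plus m would be 2D, of norm 1/2.\<close>

lemma ex_map_Coin_tau1_empty:
  assumes "m \<in> lattice" "n \<in> lattice"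
  obtains g G where "is_torus_lift g G m n" "Coin g (g \<circ> \<tau>\<^sub>1) = {}"
proof -
  define D where "D = (\<lambda>z. exp (2 * of_real pi * \<i> * of_real (Re z)) / 4)"
  have half: "D (z + 1/2) = - D z" for z
    by (simp add: D_def exp_add distrib_left)
  have per: "D (z + 1) = D z" "D (z + \<i>) = D z" for z
  proof -
    have eq: "z + 1/2 + 1/2 = z + 1" by simp
    show "D (z + 1) = D z" using half[of z] half[of "z + 1/2"] unfolding eq by simp
    show "D (z + \<i>) = D z" by (simp add: D_def)
  qed
  have "continuous_on UNIV D"
    unfolding D_def by (intro continuous_intros) auto
  then obtain g where g: "is_torus_lift g (\<lambda>z. of_real (Re z) * m + of_real (Im z) * n + D z / 2) m n"
    using ex_perturbed_linear_lift[OF assms _ per] by blast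
  let ?G = "\<lambda>z. of_real (Re z) * m + of_real (Im z) * n + D z / 2"
  have "torus_exp z \<notin> Coin g (g \<circ> \<tau>\<^sub>1)" for z
  proof
    assume "torus_exp z \<in> Coin g (g \<circ> \<tau>\<^sub>1)"
    then have "?G z - ?G (z + 1/2) \<in> lattice"
      using g by (simp add: Coin_def is_torus_lift_def tau1_torus_exp torus_exp_eq_iff)
    also have "?G z - ?G (z + 1/2) = D z - m / 2"
      using half[of z] by (simp add: algebra_simps)
    finally have "D z - m / 2 + (D z - m / 2) + m \<in> lattice"
      using assms by (intro lattice_add)
    then have "2 * D z \<in> lattice"
      by simp
    moreover have "norm (2 * D z) = 1/2"
      by (simp add: D_def norm_divide norm_mult)
    ultimately show False
      using lattice_norm_ge_1[of "2 * D z"] by (cases "D z = 0") auto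
  qed
  then have "Coin g (g \<circ> \<tau>\<^sub>1) = {}"
    using torus_exp_surj by (metis equals0I)
  with g that show ?thesis by blast
qed

text \<open>For the linear map \<Phi> does not see the imaginary part of z, so its coincidences, if
  any, fill whole circles; D has to break them up.\<close>

lemma ex_map_Coin_tau2:
  assumes "m \<in> lattice" "n \<in> lattice" "continuous_on UNIV D" "\<And>z. D (z + 1) = D z"
    and anti: "\<And>z. D (- cnj z + \<i>/2) = - D z"
  obtains g G where "is_torus_lift g G m n"
    "\<And>z. torus_exp z \<in> Coin g (g \<circ> \<tau>\<^sub>2) \<longleftrightarrow> 2 * of_real (Re z) * m - n / 2 + D z \<in> lattice"
proof -
  have "D (z + \<i>) = D z" for z
  proof -
    have eq: "- cnj (- cnj z + \<i>/2) + \<i>/2 = z + \<i>" by (simp add: complex_eq_iff)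
    show ?thesis using anti[of z] anti[of "- cnj z + \<i>/2"] unfolding eq by simp
  qed
  then obtain g where g: "is_torus_lift g (\<lambda>z. of_real (Re z) * m + of_real (Im z) * n + D z / 2) m n"
    using ex_perturbed_linear_lift[OF assms(1-4)] by blast
  let ?G = "\<lambda>z. of_real (Re z) * m + of_real (Im z) * n + D z / 2"
  have "torus_exp z \<in> Coin g (g \<circ> \<tau>\<^sub>2) \<longleftrightarrow> 2 * of_real (Re z) * m - n / 2 + D z \<in> lattice" for z
  proof -
    have "torus_exp z \<in> Coin g (g \<circ> \<tau>\<^sub>2) \<longleftrightarrow> ?G z - ?G (- cnj z + \<i>/2) \<in> lattice"
      using g by (simp add: Coin_def is_torus_lift_def tau2_torus_exp torus_exp_eq_iff)
    moreover have "?G z - ?G (- cnj z + \<i>/2) = 2 * of_real (Re z) * m - n / 2 + D z"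
      using anti[of z] by (simp add: algebra_simps)
    ultimately show ?thesis by (simp only:)
  qed
  with g that show ?thesis by blast
qed

text \<open>With first column 0 the linear part of \<Phi> is the constant -n/2, and the norm
  argument used for \<open>\<tau>\<^sub>1\<close> applies to a curve driven by the imaginary part,
  which \<sigma> moves by half a turn.\<close>

lemma ex_map_Coin_tau2_empty:
  assumes "n \<in> lattice"
  obtains g G where "is_torus_lift g G 0 n" "Coin g (g \<circ> \<tau>\<^sub>2) = {}"
proof -
  define D where "D = (\<lambda>z. exp (2 * of_real pi * \<i> * of_real (Im z)) / 4)"
  have "continuous_on UNIV D"
    unfolding D_def by (intro continuous_intros) auto
  moreover have "D (- cnj z + \<i>/2) = - D z" "D (z + 1) = D z" for z
    by (simp_all add: D_def exp_add distrib_left)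
  ultimately obtain g G where g: "is_torus_lift g G 0 n"
    "\<And>z. torus_exp z \<in> Coin g (g \<circ> \<tau>\<^sub>2) \<longleftrightarrow> 2 * of_real (Re z) * 0 - n / 2 + D z \<in> lattice"
    using ex_map_Coin_tau2[OF _ assms] lattice_simps(1) by metis
  have "torus_exp z \<notin> Coin g (g \<circ> \<tau>\<^sub>2)" for z
  proof
    assume "torus_exp z \<in> Coin g (g \<circ> \<tau>\<^sub>2)"
    then have "D z - n / 2 \<in> lattice"
      using g(2) by simp
    then have "D z - n / 2 + (D z - n / 2) + n \<in> lattice"
      using assms by (intro lattice_add)
    then have "2 * D z \<in> lattice"
      by simp
    moreover have "norm (2 * D z) = 1/2"
      by (simp add: D_def norm_divide norm_mult)
    ultimately show False
      using lattice_norm_ge_1[of "2 * D z"] by (cases "D z = 0") auto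
  qed
  then have "Coin g (g \<circ> \<tau>\<^sub>2) = {}"
    using torus_exp_surj by (metis equals0I)
  with g that show ?thesis by blast
qed

text \<open>The values depend on j modulo K only, so finitely many occur and the nonzero ones stay
  away from 0.\<close>

lemma sin_rational_gap:
  assumes "0 < (K::int)"
  obtains \<delta> where "0 < \<delta>" "\<delta> < 1"
    "\<And>j::int. \<bar>sin (2 * pi * (of_int j / of_int K))\<bar> \<le> \<delta> \<Longrightarrow> sin (2 * pi * (of_int j / of_int K)) = 0"
proof -
  let ?s = "\<lambda>j::int. sin (2 * pi * (of_int j / of_int K))"
  define A where "A = (\<lambda>j. \<bar>?s j\<bar>) ` {0..<K} - {0}"
  \<comment> \<open>Inserting 1 keeps the set nonempty and, after halving, the bound below
    1.\<close>
  define \<delta> where "\<delta> = Min (insert 1 A) / 2"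
  have fin: "finite (insert 1 A)" by (simp add: A_def)
  have pos: "0 < a" if "a \<in> insert 1 A" for a using that by (auto simp: A_def)
  have "0 < Min (insert 1 A)" using fin pos by (subst Min_gr_iff) auto
  moreover have "Min (insert 1 A) \<le> 1" using fin by (intro Min_le) auto
  ultimately have \<delta>: "0 < \<delta>" "\<delta> < 1" "\<delta> < Min (insert 1 A)" by (auto simp: \<delta>_def)
  have "?s j = 0" if le: "\<bar>?s j\<bar> \<le> \<delta>" for j
  proof (rule ccontr)
    assume ne: "?s j \<noteq> 0"
    have "real_of_int j = of_int (j mod K) + of_int K * of_int (j div K)"
      by (metis add.commute mult_div_mod_eq of_int_add of_int_mult)
    then have "of_int j / of_int K = of_int (j mod K) / of_int K + real_of_int (j div K)"
      using assms by (simp add: field_simps)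
    then have "2 * pi * (of_int j / of_int K) = 2 * pi * (of_int (j mod K) / of_int K) + of_int (j div K) * (2 * pi)"
      by (simp only: distrib_left mult.commute)
    then have "?s j = ?s (j mod K)"
      using sin.plus_of_int[of "2 * pi * (of_int (j mod K) / of_int K)" "j div K"] by simp
    then have "\<bar>?s j\<bar> \<in> A"
      using assms ne by (auto simp: A_def)
    then have "Min (insert 1 A) \<le> \<bar>?s j\<bar>"
      using fin by (intro Min_le) auto
    then show False using le \<delta>(3) by linarith
  qed
  with \<delta> that show ?thesis by blast
qed

lemma sin_2pi_eq_0_iff: "sin (2 * pi * x) = 0 \<longleftrightarrow> 2 * x \<in> \<int>"
proof -
  have "sin (2 * pi * x) = 0 \<longleftrightarrow> (\<exists>i::int. 2 * pi * x = of_int i * pi)"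
    by (rule sin_zero_iff_int2)
  also have "\<dots> \<longleftrightarrow> (\<exists>i::int. 2 * x = of_int i)"
    by (intro iff_exI) auto
  finally show ?thesis by (auto simp: Ints_def)
qed

lemma cos_2pi_eq_0_iff: "cos (2 * pi * x) = 0 \<longleftrightarrow> 2 * x - 1/2 \<in> \<int>"
proof -
  have "cos (2 * pi * x) = sin (2 * pi * (1/4 - x))"
    by (simp add: cos_sin_eq algebra_simps)
  then have "cos (2 * pi * x) = 0 \<longleftrightarrow> 2 * (1/4 - x) \<in> \<int>"
    by (simp only: sin_2pi_eq_0_iff)
  also have "\<dots> \<longleftrightarrow> - (2 * (1/4 - x)) \<in> \<int>"
    by (metis Ints_minus minus_minus)
  finally show ?thesis by simp
qed

text \<open>The perturbation pushes \<Phi> in the direction \<i> m, perpendicular to its linear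
  motion along m. Lattice values force s to vanish, and the gap in the sine values splits s = 0 into
  sine and cosine both 0, leaving isolated points. If n/2 is not in the lattice, the same map has no
  coincidence at all.\<close>

lemma ex_map_Coin_tau2_four_points:
  assumes "m \<in> lattice" "n \<in> lattice" "m \<noteq> 0"
  obtains g G where "is_torus_lift g G m n"
    "\<And>z. torus_exp z \<in> Coin g (g \<circ> \<tau>\<^sub>2) \<longleftrightarrow> n / 2 \<in> lattice \<and> 2 * Re z \<in> \<int> \<and> 2 * Im z - 1/2 \<in> \<int>"
proof -
  obtain p q where pq: "Re m = of_int p" "Im m = of_int q"
    using assms(1) by (auto simp: lattice_def elim!: Ints_cases)
  define N where "N = p * p + q * q"
  have N: "0 < N" and cm: "cnj m * m = of_int N"
  proof -
    have "p \<noteq> 0 \<or> q \<noteq> 0" using assms(3) pq complex_eq_iff by auto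
    then show "0 < N" unfolding N_def
      by (metis add_nonneg_pos add_pos_nonneg less_le mult_eq_0_iff zero_le_square)
    show "cnj m * m = of_int N"
      by (simp add: complex_eq_iff pq N_def)
  qed
  \<comment> \<open>Lattice values will force the real part of z to be a multiple of 1/(4N), hence
    this denominator.\<close>
  obtain \<delta> where \<delta>: "0 < \<delta>" "\<delta> < 1"
    "\<And>j::int. \<bar>sin (2 * pi * (of_int j / of_int (4 * N)))\<bar> \<le> \<delta> \<Longrightarrow> sin (2 * pi * (of_int j / of_int (4 * N))) = 0"
    using sin_rational_gap[of "4 * N"] N by auto
  \<comment> \<open>The sine is odd in the real part and the cosine changes sign under a half step
    in the imaginary part, so s changes sign under the glide reflection.\<close>
  define s where "s = (\<lambda>z. sin (2 * pi * Re z) + \<delta> * cos (2 * pi * Im z))"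
  \<comment> \<open>The constant 8N makes the imaginary part found below equal to s/4, of modulus
    less than 1, so that integrality forces s = 0.\<close>
  define D where "D = (\<lambda>z. of_real (s z / (8 * of_int N)) * (\<i> * m))"
  have "continuous_on UNIV D"
    unfolding D_def s_def using N by (intro continuous_intros) auto
  moreover have "D (z + 1) = D z" for z
    using sin_periodic[of "2 * pi * Re z"] by (simp add: D_def s_def distrib_left)
  moreover have "D (- cnj z + \<i>/2) = - D z" for z
  proof -
    have "s (- cnj z + \<i>/2) = - s z"
      using cos_periodic_pi[of "2 * pi * Im z"] by (simp add: s_def distrib_left add.commute)
    then show ?thesis by (simp add: D_def)
  qed
  ultimately obtain g G where g: "is_torus_lift g G m n"
    "\<And>z. torus_exp z \<in> Coin g (g \<circ> \<tau>\<^sub>2) \<longleftrightarrow> 2 * of_real (Re z) * m - n / 2 + D z \<in> lattice"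
    using ex_map_Coin_tau2[OF assms(1,2)] by metis
  have "2 * of_real (Re z) * m - n / 2 + D z \<in> lattice \<longleftrightarrow>
      n / 2 \<in> lattice \<and> 2 * Re z \<in> \<int> \<and> 2 * Im z - 1/2 \<in> \<int>" (is "?\<phi> \<in> lattice \<longleftrightarrow> ?R") for z
  proof
    assume "?R"
    then have "s z = 0"
      using sin_2pi_eq_0_iff[of "Re z"] cos_2pi_eq_0_iff[of "Im z"] by (simp add: s_def)
    moreover have "of_real (2 * Re z) * m \<in> lattice"
      using \<open>?R\<close> assms(1) by (intro lattice_mult) (auto simp: lattice_def)
    ultimately show "?\<phi> \<in> lattice"
      using \<open>?R\<close> by (simp add: D_def lattice_diff)
  next
    assume \<phi>: "?\<phi> \<in> lattice"
    have cnjm: "cnj m \<in> lattice" using assms(1) by (simp add: lattice_def)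
    \<comment> \<open>Doubling removes n/2, and multiplying by the conjugate of m turns the
      directions m and \<i> m into the real and imaginary axes.\<close>
    have lat: "cnj m * (?\<phi> + ?\<phi> + n) \<in> lattice"
      by (rule lattice_mult[OF cnjm lattice_add[OF lattice_add[OF \<phi> \<phi>] assms(2)]])
    have "cnj m * (?\<phi> + ?\<phi> + n) = of_real (4 * Re z) * (cnj m * m) + of_real (s z / (4 * of_int N)) * \<i> * (cnj m * m)"
      by (simp add: D_def algebra_simps)
    also have "\<dots> = Complex (4 * Re z * of_int N) (s z / 4)"
      unfolding cm using N by (simp add: complex_eq_iff)
    finally have "cnj m * (?\<phi> + ?\<phi> + n) = Complex (4 * Re z * of_int N) (s z / 4)" .
    then have int: "4 * Re z * of_int N \<in> \<int>" "s z / 4 \<in> \<int>"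
      using lat by (auto simp: lattice_def)
    have "\<bar>\<delta> * cos (2 * pi * Im z)\<bar> \<le> \<delta>"
      using \<delta>(1) abs_cos_le_one[of "2 * pi * Im z"] by (simp add: abs_mult mult_left_le)
    moreover have "\<bar>sin (2 * pi * Re z)\<bar> \<le> 1" by simp
    ultimately have "\<bar>s z\<bar> < 4"
      using \<delta>(2) unfolding s_def by linarith
    then have "\<bar>s z / 4\<bar> < 1"
      by simp
    then have s0: "s z = 0"
      using Ints_nonzero_abs_less1[OF int(2)] by simp
    obtain j where "4 * Re z * of_int N = of_int j" using int(1) Ints_cases by blast
    then have Rez: "Re z = of_int j / of_int (4 * N)"
      using N by (simp add: field_simps)
    have "\<bar>sin (2 * pi * Re z)\<bar> \<le> \<delta>"
      using s0 \<open>\<bar>\<delta> * cos (2 * pi * Im z)\<bar> \<le> \<delta>\<close> unfolding s_def by linarith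
    then have sin0: "sin (2 * pi * Re z) = 0"
      using \<delta>(3)[of j] unfolding Rez by blast
    then have "cos (2 * pi * Im z) = 0"
      using s0 \<delta>(1) by (simp add: s_def)
    with sin0 have int2: "2 * Re z \<in> \<int>" "2 * Im z - 1/2 \<in> \<int>"
      by (simp_all only: sin_2pi_eq_0_iff cos_2pi_eq_0_iff)
    have "of_real (2 * Re z) * m \<in> lattice"
      using int2 assms(1) by (intro lattice_mult) (auto simp: lattice_def)
    then have "of_real (2 * Re z) * m - ?\<phi> \<in> lattice"
      using \<phi> lattice_diff by blast
    moreover have "of_real (2 * Re z) * m - ?\<phi> = n / 2"
      by (simp add: D_def s0)
    ultimately have "n / 2 \<in> lattice" by simp
    with int2 show "?R" by blast
  qed
  with g that show ?thesis by simp
qed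

text \<open>The first coordinate is 0 or 1/2, fixed by the sign change modulo 1; the second is 1/4
  or 3/4, interchanged by the half step. So four points form two orbits.\<close>

lemma card_BUCoin_tau2:
  assumes "\<And>z. torus_exp z \<in> Coin g (g \<circ> \<tau>\<^sub>2) \<longleftrightarrow> 2 * Re z \<in> \<int> \<and> 2 * Im z - 1/2 \<in> \<int>"
  shows "finite (Coin g (g \<circ> \<tau>\<^sub>2))" "card (BUCoin g \<tau>\<^sub>2) = 2"
proof -
  have half: "(1/2::real) \<notin> \<int>"
    using fraction_not_in_Ints[of 2 1, where 'a = real] by simp
  define e where "e = (\<lambda>k l. torus_exp (Complex (k/2) (1/4 + l/2)))"
  have mem: "e 0 0 \<in> Coin g (g \<circ> \<tau>\<^sub>2)" "e 0 1 \<in> Coin g (g \<circ> \<tau>\<^sub>2)"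
    "e 1 0 \<in> Coin g (g \<circ> \<tau>\<^sub>2)" "e 1 1 \<in> Coin g (g \<circ> \<tau>\<^sub>2)"
    by (simp_all add: e_def assms)
  have Coin: "Coin g (g \<circ> \<tau>\<^sub>2) = {e 0 0, e 0 1, e 1 0, e 1 1}"
  proof (intro equalityI subsetI)
    fix x assume x: "x \<in> Coin g (g \<circ> \<tau>\<^sub>2)"
    obtain z where z: "x = torus_exp z" using torus_exp_surj by metis
    obtain k l where kl: "2 * Re z = of_int k" "2 * Im z - 1/2 = of_int l"
      using x assms[of z] z by (auto elim!: Ints_cases)
    have "x = e (of_int (k mod 2)) (of_int (l mod 2))"
    proof -
      have "real_of_int k = 2 * of_int (k div 2) + of_int (k mod 2)"
        "real_of_int l = 2 * of_int (l div 2) + of_int (l mod 2)"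
        by (metis mult_div_mod_eq of_int_add of_int_mult of_int_numeral)+
      then have "Re z - of_int (k mod 2) / 2 = of_int (k div 2)"
        "Im z - (1/4 + of_int (l mod 2) / 2) = of_int (l div 2)"
        using kl by (simp_all add: field_simps)
      then show ?thesis
        unfolding z e_def torus_exp_eq_iff lattice_def by simp
    qed
    moreover have "k mod 2 = 0 \<or> k mod 2 = 1" "l mod 2 = 0 \<or> l mod 2 = 1" by auto
    ultimately show "x \<in> {e 0 0, e 0 1, e 1 0, e 1 1}" by auto
  qed (use mem in auto)
  then show "finite (Coin g (g \<circ> \<tau>\<^sub>2))" by simp
  have \<tau>: "\<tau>\<^sub>2 (e 0 0) = e 0 1" "\<tau>\<^sub>2 (e 0 1) = e 0 0" "\<tau>\<^sub>2 (e 1 0) = e 1 1" "\<tau>\<^sub>2 (e 1 1) = e 1 0"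
    by (simp_all add: e_def tau2_torus_exp torus_exp_eq_iff lattice_def)
  have "BUCoin g \<tau>\<^sub>2 = {{e 0 0, e 0 1}, {e 1 0, e 1 1}}"
    unfolding BUCoin_def Coin by (simp add: \<tau> insert_commute)
  moreover have "e 0 0 \<noteq> e 1 0" "e 0 0 \<noteq> e 1 1"
    using half by (simp_all add: e_def torus_exp_eq_iff lattice_def)
  then have "{e 0 0, e 0 1} \<noteq> {e 1 0, e 1 1}" by blast
  ultimately show "card (BUCoin g \<tau>\<^sub>2) = 2" by simp
qed

text \<open>Existence comes from one example with finitely many coincidences. Uniqueness comes from
  the invariance of the shift vectors: any competing map has a lift with the same m and n, so the
  last hypothesis applies to it.\<close>

lemma NBU_eqI:
  assumes "is_torus_lift f F m n" "is_torus_lift g G m n" "finite (Coin g (g \<circ> \<tau>))"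
    and "\<And>g G. is_torus_lift g G m n \<Longrightarrow> finite (Coin g (g \<circ> \<tau>)) \<Longrightarrow> NBU_finite g \<tau> = c"
  shows "NBU f \<tau> = c"
  unfolding NBU_def
proof (rule the_equality)
  have "homotopic_maps f g"
    using torus_lifts_homotopic[OF assms(1,2)] .
  then show "\<exists>g. homotopic_maps f g \<and> finite (Coin g (g \<circ> \<tau>)) \<and> c = NBU_finite g \<tau>"
    using assms(3) assms(4)[OF assms(2,3)] by metis
  fix c' assume "\<exists>g. homotopic_maps f g \<and> finite (Coin g (g \<circ> \<tau>)) \<and> c' = NBU_finite g \<tau>"
  then obtain h where h: "homotopic_maps f h" "finite (Coin h (h \<circ> \<tau>))" "c' = NBU_finite h \<tau>"
    by blast
  obtain H where "is_torus_lift h H m n"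
    using homotopic_torus_lift[OF assms(1) h(1)] by blast
  then show "c' = c"
    using assms(4) h by blast
qed

lemma ex_realizing_map_tau2:
  assumes "m \<in> lattice" "n \<in> lattice"
  obtains g G where "is_torus_lift g G m n" "finite (Coin g (g \<circ> \<tau>\<^sub>2))"
    "card (BUCoin g \<tau>\<^sub>2) = (if m \<noteq> 0 \<and> n / 2 \<in> lattice then 2 else 0)"
proof (cases "m = 0")
  case True
  then show ?thesis
    using ex_map_Coin_tau2_empty[OF assms(2)] that by (auto simp: BUCoin_def)
next
  case False
  obtain g G where g: "is_torus_lift g G m n"
    "\<And>z. torus_exp z \<in> Coin g (g \<circ> \<tau>\<^sub>2) \<longleftrightarrow> n / 2 \<in> lattice \<and> 2 * Re z \<in> \<int> \<and> 2 * Im z - 1/2 \<in> \<int>"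
    using ex_map_Coin_tau2_four_points[OF assms False] by blast
  show ?thesis
  proof (cases "n / 2 \<in> lattice")
    case True
    then show ?thesis
      using that[OF g(1)] card_BUCoin_tau2[of g] g(2) False by simp
  next
    case n: False
    then have "Coin g (g \<circ> \<tau>\<^sub>2) = {}"
      using g(2) torus_exp_surj by (metis equals0I)
    then show ?thesis
      using that[OF g(1)] n by (simp add: BUCoin_def)
  qed
qed

theorem theorem4p3:
  fixes f :: "torus \<Rightarrow> torus"
  assumes "continuous_on UNIV f"
  shows "NBU f \<tau>\<^sub>1 = 0 \<and>
    NBU f \<tau>\<^sub>2 =
      (if \<exists>p q k l :: int. pi1_matrix f = vector [vector [p, 2 * k], vector [q, 2 * l]]
                           \<and> (p, q) \<noteq> (0, 0)
       then 2 else 0) \<and>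
    (\<forall>\<tau>\<in>{\<tau>\<^sub>1, \<tau>\<^sub>2}. \<exists>f'. realizes_NBU f' f \<tau>)"
proof -
  obtain F m n where F: "is_torus_lift f F m n"
    using ex_torus_lift[OF assms] by blast
  then have mn: "m \<in> lattice" "n \<in> lattice" by (auto simp: is_torus_lift_def)
  obtain p q where m: "m = Complex (of_int p) (of_int q)"
    using mn(1) by (auto simp: lattice_def complex_eq_iff elim!: Ints_cases)
  obtain r s where n: "n = Complex (of_int r) (of_int s)"
    using mn(2) by (auto simp: lattice_def complex_eq_iff elim!: Ints_cases)
  have M: "pi1_matrix f = vector [vector [p, r], vector [q, s]]"
    using pi1_matrix_eq F unfolding m n by blast
  have vec: "(vector [vector [p, r], vector [q, s]] :: int ^ 2 ^ 2) = vector [vector [p', 2 * k], vector [q', 2 * l]]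
      \<longleftrightarrow> p' = p \<and> q' = q \<and> r = 2 * k \<and> s = 2 * l" for p' q' k l
    by (auto simp: vec_eq_iff forall_2)
  \<comment> \<open>This translates evenness of the second column of the matrix into the condition
    on the lift.\<close>
  have "n / 2 \<in> lattice \<longleftrightarrow> (\<exists>k l. r = 2 * k \<and> s = 2 * l)"
  proof -
    have *: "real_of_int i / 2 \<in> \<int> \<longleftrightarrow> (\<exists>k. i = 2 * k)" for i
    proof
      assume "real_of_int i / 2 \<in> \<int>"
      then obtain k where "real_of_int i / 2 = of_int k" by (rule Ints_cases)
      then have "real_of_int i = of_int (2 * k)" by simp
      then show "\<exists>k. i = 2 * k" using of_int_eq_iff by blast
    qed auto
    have "n / 2 \<in> lattice \<longleftrightarrow> real_of_int r / 2 \<in> \<int> \<and> real_of_int s / 2 \<in> \<int>"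
      by (simp add: n lattice_def)
    then show ?thesis unfolding * by blast
  qed
  moreover have "m \<noteq> 0 \<longleftrightarrow> (p, q) \<noteq> (0, 0)"
    by (auto simp: m complex_eq_iff)
  ultimately have cond: "m \<noteq> 0 \<and> n / 2 \<in> lattice \<longleftrightarrow>
      (\<exists>p q k l :: int. pi1_matrix f = vector [vector [p, 2 * k], vector [q, 2 * l]] \<and> (p, q) \<noteq> (0, 0))"
    unfolding M vec by blast
  obtain g1 G1 where g1: "is_torus_lift g1 G1 m n" "Coin g1 (g1 \<circ> \<tau>\<^sub>1) = {}"
    using ex_map_Coin_tau1_empty[OF mn] by blast
  have NBU1: "NBU f \<tau>\<^sub>1 = 0"
    using NBU_eqI[OF F g1(1)] g1(2) NBU_finite_tau1 by (metis finite.emptyI)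
  have "realizes_NBU g1 f \<tau>\<^sub>1"
    using torus_lifts_homotopic[OF F g1(1)] g1(2) NBU1 by (simp add: realizes_NBU_def BUCoin_def)
  obtain g2 G2 where g2: "is_torus_lift g2 G2 m n" "finite (Coin g2 (g2 \<circ> \<tau>\<^sub>2))"
    "card (BUCoin g2 \<tau>\<^sub>2) = (if m \<noteq> 0 \<and> n / 2 \<in> lattice then 2 else 0)"
    using ex_realizing_map_tau2[OF mn] by blast
  have NBU2: "NBU f \<tau>\<^sub>2 = (if m \<noteq> 0 \<and> n / 2 \<in> lattice then 2 else 0)"
    by (rule NBU_eqI[OF F g2(1,2) NBU_finite_tau2])
  have "realizes_NBU g2 f \<tau>\<^sub>2"
    using torus_lifts_homotopic[OF F g2(1)] g2(2,3) NBU2 by (simp add: realizes_NBU_def BUCoin_def)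
  with \<open>realizes_NBU g1 f \<tau>\<^sub>1\<close> NBU1 NBU2 show ?thesis
    unfolding cond by blast
qed

end
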